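(* Let $1\le p < \infty$, $m \in \mathbb{N}$, $0 \le \ell < d$, and $a \in \mathbb{R}$. In case that $W^m_p (\mathbb{R}^d)$ is an algebra with respect to pointwise multiplication there exists a constant $c$ such that $$\|u\cdot v|\mathcal{K}^{m}_{2a-\frac{d}{p},p} (\mathbb{R}^d,\mathbb{R}^\ell_* )\|\le c \, \|u|\mathcal{K}^{m}_{a,p} (\mathbb{R}^d,\mathbb{R}^\ell_* )\| \, \|v|\mathcal{K}^{m}_{a,p} (\mathbb{R}^d,\mathbb{R}^\ell_* )\|$$ holds for all $u, v \in \mathcal{K}^{m}_{a,p} (\mathbb{R}^d,\mathbb{R}^\ell_* )$.
   Context: $\mathbb{N}=\{1,2,\dots\}$, $\mathbb{N}_0=\mathbb{N}\cup\{0\}$. For an integer $0\le\ell<d$ put $\mathbb{R}^\ell_*=\{x\in\mathbb{R}^d: x_1=\dots=x_{d-\ell}=0\}$ (so $\mathbb{R}^0_*=\{0\}$) and $\rho(x)=\min\big(1,(\sum_{i=1}^{d-\ell}|x_i|^2)^{1/2}\big)$. For $m\in\mathbb{N}_0$, $a\in\mathbb{R}$, $1\le p<\infty$, the Kondratiev space $\mathcal{K}^m_{a,p}(\mathbb{R}^d,\mathbb{R}^\ell_* )$ consists of all measurable functions $u$ on $\mathbb{R}^d\setminus\mathbb{R}^\ell_*$ having weak derivatives $\partial^\alpha u$, $|\alpha|\le m$, in $\mathbb{R}^d\setminus\mathbb{R}^\ell_*$ with $\|u|\mathcal{K}^m_{a,p}(\mathbb{R}^d,\mathbb{R}^\ell_*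 )\|=\big(\sum_{|\alpha|\le m}\int_{\mathbb{R}^d\setminus\mathbb{R}^\ell_*}|\rho(x)^{|\alpha|-a}\partial^\alpha u(x)|^p\,dx\big)^{1/p}<\infty$. $W^m_p(\mathbb{R}^d)$ is the standard Sobolev space; it is an algebra with respect to pointwise multiplication if there is a constant $c$ with $\|uv|W^m_p(\mathbb{R}^d)\|\le c\|u|W^m_p(\mathbb{R}^d)\|\,\|v|W^m_p(\mathbb{R}^d)\|$ for all $u,v\in W^m_p(\mathbb{R}^d)$ (it is known that this holds if, and only if, either $1<p<\infty$ and $m>d/p$, or $p=1$ and $m\ge d$). *)

theory Defs
  imports "HOL-Analysis.Analysis"
begin

(* Points of R^d are vectors in real ^ 'n with d = CARD('n); the linear order on the index
   type 'n says which coordinates are the first ones.  Scalars are a type 'b of sort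
   {real_normed_field, euclidean_space}, so real- and complex-valued functions are both
   covered. *)

(* Same type as real ^ 'n; the caret syntax would force the sort of 'n to be just finite. *)
type_synonym 'n rvec = "(real, 'n) vec"

definition partial_deriv :: "'n::finite \<Rightarrow> ('n rvec \<Rightarrow> real) \<Rightarrow> 'n rvec \<Rightarrow> real" where
  "partial_deriv i f x = frechet_derivative f (at x) (axis i 1)"

definition iterated_partial_deriv ::
    "'n::finite list \<Rightarrow> ('n rvec \<Rightarrow> real) \<Rightarrow> 'n rvec \<Rightarrow> real" where
  "iterated_partial_deriv is f = foldr partial_deriv is f"

definition smooth :: "('n::finite rvec \<Rightarrow> real) \<Rightarrow> bool" where
  "smooth f \<longleftrightarrow> (\<forall>is. iterated_partial_deriv is f differentiable_on UNIV)"

definition multi_order :: "('n::finite \<Rightarrow> nat) \<Rightarrow> nat" where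
  "multi_order \<alpha> = (\<Sum>i\<in>UNIV. \<alpha> i)"

(* For smooth functions the order in which the partial derivatives are taken is immaterial;
   the order of the index type is used to fix one. *)
definition multi_deriv ::
    "('n::{finite,linorder} \<Rightarrow> nat) \<Rightarrow> ('n rvec \<Rightarrow> real) \<Rightarrow> 'n rvec \<Rightarrow> real" where
  "multi_deriv \<alpha> =
     iterated_partial_deriv (concat (map (\<lambda>i. replicate (\<alpha> i) i) (sorted_list_of_set UNIV)))"

definition test_functions :: "'n::finite rvec set \<Rightarrow> ('n rvec \<Rightarrow> real) set" where
  "test_functions \<Omega> =
     {\<phi>. smooth \<phi> \<and> compact (closure {x. \<phi> x \<noteq> 0}) \<and> closure {x. \<phi> x \<noteq> 0} \<subseteq> \<Omega>}"

definition locally_integrable_on ::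
    "('n::finite rvec \<Rightarrow> 'b::euclidean_space) \<Rightarrow> ('n rvec) set \<Rightarrow> bool" where
  "locally_integrable_on u \<Omega> \<longleftrightarrow>
     (\<forall>K. compact K \<longrightarrow> K \<subseteq> \<Omega> \<longrightarrow> set_integrable lebesgue K u)"

definition has_weak_deriv ::
    "'n::{finite,linorder} rvec set \<Rightarrow> ('n \<Rightarrow> nat) \<Rightarrow>
     ('n rvec \<Rightarrow> 'b::euclidean_space) \<Rightarrow> ('n rvec \<Rightarrow> 'b) \<Rightarrow> bool" where
  "has_weak_deriv \<Omega> \<alpha> u g \<longleftrightarrow>
     locally_integrable_on u \<Omega> \<and> locally_integrable_on g \<Omega> \<and>
     (\<forall>\<phi>\<in>test_functions \<Omega>.
        set_lebesgue_integral lebesgue \<Omega> (\<lambda>x. multi_deriv \<alpha> \<phi> x *\<^sub>R u x) =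
        (- 1) ^ multi_order \<alpha> *\<^sub>R set_lebesgue_integral lebesgue \<Omega> (\<lambda>x. \<phi> x *\<^sub>R g x))"

(* On open sets weak derivatives are unique almost everywhere, so for the norms below it does
   not matter which one is chosen. *)
definition weak_deriv ::
    "'n::{finite,linorder} rvec set \<Rightarrow> ('n \<Rightarrow> nat) \<Rightarrow>
     ('n rvec \<Rightarrow> 'b::euclidean_space) \<Rightarrow> 'n rvec \<Rightarrow> 'b" where
  "weak_deriv \<Omega> \<alpha> u = (SOME g. has_weak_deriv \<Omega> \<alpha> u g)"

(* Since the integral of a non-integrable function is 0 here, finiteness of the norm is
   expressed by integrability of every summand; the value of the norm is meaningful for
   members of the space only.  The same applies to the Kondratiev spaces below. *)
definition sobolev_space ::
    "nat \<Rightarrow> real \<Rightarrow> ('n::{finite,linorder} rvec \<Rightarrow> 'b::euclidean_space) set" where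
  "sobolev_space m p =
     {u. u \<in> borel_measurable lebesgue \<and>
         (\<forall>\<alpha>. multi_order \<alpha> \<le> m \<longrightarrow>
            (\<exists>g. has_weak_deriv UNIV \<alpha> u g) \<and>
            integrable lebesgue (\<lambda>x. norm (weak_deriv UNIV \<alpha> u x) powr p))}"

definition sobolev_norm ::
    "nat \<Rightarrow> real \<Rightarrow> ('n::{finite,linorder} rvec \<Rightarrow> 'b::euclidean_space) \<Rightarrow> real" where
  "sobolev_norm m p u =
     (\<Sum>\<alpha> | multi_order \<alpha> \<le> m.
        integral\<^sup>L lebesgue (\<lambda>x. norm (weak_deriv UNIV \<alpha> u x) powr p)) powr (1 / p)"

definition pointwise_algebra ::
    "('a \<Rightarrow> 'b::real_normed_field) set \<Rightarrow> (('a \<Rightarrow> 'b) \<Rightarrow> real) \<Rightarrow> bool" where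
  "pointwise_algebra X N \<longleftrightarrow>
     (\<exists>c. \<forall>u\<in>X. \<forall>v\<in>X. (\<lambda>x. u x * v x) \<in> X \<and> N (\<lambda>x. u x * v x) \<le> c * N u * N v)"

definition leading_coords :: "nat \<Rightarrow> 'n::{finite,linorder} set" where
  "leading_coords k = {i. card {j. j \<le> i} \<le> k}"

definition edge :: "nat \<Rightarrow> 'n::{finite,linorder} rvec set" where
  "edge l = {x. \<forall>i\<in>leading_coords (CARD('n) - l). x $ i = 0}"

definition edge_weight :: "nat \<Rightarrow> 'n::{finite,linorder} rvec \<Rightarrow> real" where
  "edge_weight l x = min 1 (sqrt (\<Sum>i\<in>leading_coords (CARD('n) - l). \<bar>x $ i\<bar>\<^sup>2))"

definition kondratiev_space ::
    "nat \<Rightarrow> real \<Rightarrow> real \<Rightarrow> nat \<Rightarrow>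
     ('n::{finite,linorder} rvec \<Rightarrow> 'b::euclidean_space) set" where
  "kondratiev_space m a p l =
     {u. u \<in> borel_measurable (lebesgue_on (- edge l)) \<and>
         (\<forall>\<alpha>. multi_order \<alpha> \<le> m \<longrightarrow>
            (\<exists>g. has_weak_deriv (- edge l) \<alpha> u g) \<and>
            set_integrable lebesgue (- edge l)
              (\<lambda>x. norm (edge_weight l x powr (real (multi_order \<alpha>) - a) *\<^sub>R
                         weak_deriv (- edge l) \<alpha> u x) powr p))}"

definition kondratiev_norm ::
    "nat \<Rightarrow> real \<Rightarrow> real \<Rightarrow> nat \<Rightarrow>
     ('n::{finite,linorder} rvec \<Rightarrow> 'b::euclidean_space) \<Rightarrow> real" where
  "kondratiev_norm m a p l u =
     (\<Sum>\<alpha> | multi_order \<alpha> \<le> m.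
        set_lebesgue_integral lebesgue (- edge l)
          (\<lambda>x. norm (edge_weight l x powr (real (multi_order \<alpha>) - a) *\<^sub>R
                     weak_deriv (- edge l) \<alpha> u x) powr p)) powr (1 / p)"

end

theory Submission
  imports Defs
begin

text \<open>The complement of the edge is covered by Whitney cubes of side \<open>r\<close> comparable to the weight
  \<open>\<rho>\<close>, with bounded overlap. On each of them one rescales to the unit cube, cuts off \<open>u\<close> and \<open>v\<close> by a
  fixed bump function, and applies the algebra property of the Sobolev space to the two resulting
  functions on the whole space. Scaling back, the weight is a constant up to a bounded factor, and with the
  exponent \<open>2 a - d / p\<close> all powers of \<open>r\<close> cancel. This gives \<open>N (u v) \<le> C N u N v\<close>, where \<open>N\<close> is the \<open>p\<close>-th
  power of the Kondratiev norm on a single cube (slightly enlarged on the right). Summing over the cubes,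
  the factor \<open>N v\<close> is bounded by the global one and the factors \<open>N u\<close> add up to at most a multiple of
  the global one. The local weak derivatives of \<open>u v\<close> are glued by a smooth partition of test functions.\<close>

subsection \<open>Smooth functions\<close>

text \<open>The hypothesis speaks only of functions on the whole space and gives no formula for the
  derivatives of a product. So even the existence of weak derivatives of the product must come from
  it: on a cube, the product equals a product of two cut-off Sobolev functions, and that product has
  derivatives by the algebra property. This is why three concentric cubes occur, of half-side 1, 2
  and 3 in units of r: the inner ones cover, on the middle one the bump is 1, and the outer one
  contains its support. The constant is uniform because bump and algebra constant belong to one
  reference cube; only explicit powers of r vary. The change of variables costs r^(-d) for each
  factor and returns r^d, so r^(-d) remains; the weights contribute r^(a p) twice and r^(-(2 a -
  d/p) p) once. Norms are treated as \<open>ennreal\<close> integrals, so that finiteness is a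
  result of the estimates. As \<open>weak_deriv\<close> is an arbitrary choice, uniqueness almost
  everywhere enters whenever derivatives obtained in different ways are compared.\<close>

lemma has_derivative_partial_deriv:
  assumes "(f has_derivative f') (at x)"
  shows "partial_deriv i f x = f' (axis i 1)"
  using frechet_derivative_at[OF assms] by (simp add: partial_deriv_def)

lemma iterated_partial_deriv_Nil [simp]: "iterated_partial_deriv [] f = f"
  and iterated_partial_deriv_Cons:
    "iterated_partial_deriv (i # is) f = partial_deriv i (iterated_partial_deriv is f)"
  and iterated_partial_deriv_append:
    "iterated_partial_deriv (is @ js) f = iterated_partial_deriv is (iterated_partial_deriv js f)"
  by (simp_all add: iterated_partial_deriv_def)

lemma smooth_differentiable: "smooth f \<Longrightarrow> f differentiable (at x)"
  unfolding smooth_def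
  by (metis UNIV_I differentiable_on_def iterated_partial_deriv_Nil)

lemma smooth_iterated_partial_deriv: "smooth f \<Longrightarrow> smooth (iterated_partial_deriv is f)"
  unfolding smooth_def by (metis iterated_partial_deriv_append)

lemma smooth_partial_deriv: "smooth f \<Longrightarrow> smooth (partial_deriv i f)"
  using smooth_iterated_partial_deriv[of f "[i]"] by (simp add: iterated_partial_deriv_Cons)

lemma smooth_continuous: "smooth f \<Longrightarrow> continuous_on UNIV f"
  by (simp add: continuous_at_imp_continuous_on differentiable_imp_continuous_within
      smooth_differentiable)

text \<open>Smoothness asks for differentiability of every iterated partial derivative, and a class
  closed under partial derivatives contains all of them. This avoids explicit formulas for higher
  derivatives.\<close>

lemma smooth_coinduct:
  assumes "P f"
    and diff: "\<And>g x. P g \<Longrightarrow> g differentiable (at x)"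
    and step: "\<And>g i. P g \<Longrightarrow> P (partial_deriv i g)"
  shows "smooth f"
proof -
  have "P (iterated_partial_deriv is f)" for "is"
    by (induction "is") (auto simp: assms iterated_partial_deriv_Cons)
  then show ?thesis
    by (simp add: smooth_def diff differentiable_on_def)
qed

text \<open>For k = 0 this is the classical flat function exp(-1/t). The factor t^(-k) makes the
  family closed under differentiation up to linear combinations, as an argument by closure under
  derivatives requires.\<close>

definition flat_exp :: "nat \<Rightarrow> real \<Rightarrow> real" where
  "flat_exp k t = (if t \<le> 0 then 0 else exp (- inverse t) * inverse t ^ k)"

text \<open>With s = 1/t the limit from the right is that of s^k / exp s at infinity; from the left
  the function is constantly 0.\<close>

lemma flat_exp_tendsto_0: "(flat_exp k \<longlongrightarrow> 0) (at 0)"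
proof -
  have "((\<lambda>t. inverse t ^ k / exp (inverse t)) \<longlongrightarrow> (0::real)) (at_right 0)"
    by (rule filterlim_compose[OF tendsto_power_div_exp_0 filterlim_inverse_at_top_right])
  moreover have "eventually (\<lambda>t. inverse t ^ k / exp (inverse t) = flat_exp k t) (at_right 0)"
    by (auto simp: eventually_at_filter flat_exp_def exp_minus divide_inverse mult.commute)
  ultimately have r: "(flat_exp k \<longlongrightarrow> 0) (at_right 0)"
    by (rule Lim_transform_eventually)
  have "eventually (\<lambda>t. flat_exp k t = 0) (at_left 0)"
    by (auto simp: eventually_at_filter flat_exp_def)
  then have "(flat_exp k \<longlongrightarrow> 0) (at_left 0)"
    using tendsto_eventually by blast
  with r show ?thesis
    by (simp add: filterlim_at_split)
qed

lemma flat_exp_has_derivative: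
  "(flat_exp k has_real_derivative (flat_exp (k + 2) t - real k * flat_exp (k + 1) t)) (at t)"
proof -
  consider "t < 0" | "t = 0" | "t > 0" by linarith
  then show ?thesis
  proof cases
    case 1
    have "((\<lambda>_. 0) has_real_derivative 0) (at t)" by simp
    then have "(flat_exp k has_real_derivative 0) (at t)"
      by (rule has_field_derivative_transform_within_open[where S = "{..<0}"])
        (use 1 in \<open>auto simp: flat_exp_def\<close>)
    then show ?thesis using 1 by (simp add: flat_exp_def)
  next
    case 2
    \<comment> \<open>At 0 the difference quotient of \<open>flat_exp k\<close> is itself
      \<open>flat_exp (k + 1)\<close>, so the derivative there is the limit already
      computed.\<close>
    have "flat_exp (Suc k) t = (flat_exp k (0 + t) - flat_exp k 0) / t" if "t \<noteq> 0" for t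
      using that by (auto simp: flat_exp_def field_simps)
    then have "eventually (\<lambda>t. flat_exp (Suc k) t = (flat_exp k (0 + t) - flat_exp k 0) / t) (at 0)"
      by (simp add: eventually_at_filter)
    from Lim_transform_eventually[OF flat_exp_tendsto_0 this]
    show ?thesis using 2 by (simp add: DERIV_def flat_exp_def)
  next
    case 3
    have "((\<lambda>t. exp (- inverse t) * inverse t ^ k) has_real_derivative
        (flat_exp (k + 2) t - real k * flat_exp (k + 1) t)) (at t)"
    proof -
      have e: "((\<lambda>t. exp (- inverse t)) has_real_derivative (exp (- inverse t) * inverse t ^ 2)) (at t)"
        using 3 by (auto intro!: derivative_eq_intros simp: power2_eq_square)
      have "(inverse has_real_derivative (- (inverse t ^ 2))) (at t)"
        using 3 DERIV_inverse[of t] by (simp add: power2_eq_square)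
      from DERIV_mult[OF e DERIV_power[OF this, of k]]
      show ?thesis
        using 3 by (cases k) (auto simp: flat_exp_def power2_eq_square algebra_simps)
    qed
    then show ?thesis
      by (rule has_field_derivative_transform_within_open[where S = "{0<..}"])
        (use 3 in \<open>auto simp: flat_exp_def\<close>)
  qed
qed

text \<open>Smoothness of all expressions built from smooth ones is obtained in one stroke, because their
  class is closed under partial derivatives.\<close>

inductive smooth_expr :: "('n::finite rvec \<Rightarrow> real) \<Rightarrow> bool" where
  smooth: "smooth f \<Longrightarrow> smooth_expr f"
| const: "smooth_expr (\<lambda>_. c)"
| flat: "smooth_expr (\<lambda>x. flat_exp k (c * x $ i + b))"
| add: "smooth_expr f \<Longrightarrow> smooth_expr g \<Longrightarrow> smooth_expr (\<lambda>x. f x + g x)"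
| mult: "smooth_expr f \<Longrightarrow> smooth_expr g \<Longrightarrow> smooth_expr (\<lambda>x. f x * g x)"
| inverse: "smooth_expr f \<Longrightarrow> (\<And>x. f x \<noteq> 0) \<Longrightarrow> smooth_expr (\<lambda>x. inverse (f x))"

lemma flat_exp_coord_has_derivative:
  "((\<lambda>x::'n::finite rvec. flat_exp k (c * x $ i + b)) has_derivative
    (\<lambda>h. (flat_exp (k + 2) (c * x $ i + b) - real k * flat_exp (k + 1) (c * x $ i + b)) * (c * h $ i))) (at x)"
proof -
  have "((\<lambda>x::'n rvec. c * x $ i + b) has_derivative (\<lambda>h. c * h $ i)) (at x)"
    by (auto intro!: derivative_eq_intros bounded_linear_imp_has_derivative bounded_linear_vec_nth)
  from has_derivative_compose[OF this flat_exp_has_derivative[unfolded has_field_derivative_def]]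
  show ?thesis by (simp add: o_def)
qed

lemma smooth_expr_differentiable: "smooth_expr f \<Longrightarrow> f differentiable (at x)"
proof (induction rule: smooth_expr.induct)
  case (flat k c i b)
  then show ?case
    using flat_exp_coord_has_derivative differentiable_def by blast
next
  case (mult f g)
  then show ?case by (simp add: differentiable_mult)
next
  case (inverse f)
  then show ?case by (simp add: differentiable_inverse)
qed (auto simp: smooth_differentiable)

lemma partial_deriv_const [simp]: "partial_deriv i (\<lambda>_. c) = (\<lambda>_. 0)"
  by (simp add: fun_eq_iff has_derivative_partial_deriv[OF has_derivative_const])

lemma partial_deriv_add:
  assumes "f differentiable (at x)" "g differentiable (at x)"
  shows "partial_deriv i (\<lambda>x. f x + g x) x = partial_deriv i f x + partial_deriv i g x"
  using assms unfolding frechet_derivative_works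
  by (subst has_derivative_partial_deriv[OF has_derivative_add]) (auto simp: partial_deriv_def)

lemma partial_deriv_mult:
  assumes "f differentiable (at x)" "g differentiable (at x)"
  shows "partial_deriv i (\<lambda>x. f x * g x) x = f x * partial_deriv i g x + partial_deriv i f x * g x"
  using assms unfolding frechet_derivative_works
  by (subst has_derivative_partial_deriv[OF has_derivative_mult]) (auto simp: partial_deriv_def)

lemma partial_deriv_inverse:
  assumes "f differentiable (at x)" "f x \<noteq> 0"
  shows "partial_deriv i (\<lambda>x. inverse (f x)) x = - (inverse (f x) * partial_deriv i f x * inverse (f x))"
  using assms unfolding frechet_derivative_works
  by (subst has_derivative_partial_deriv[OF Deriv.has_derivative_inverse]) (auto simp: partial_deriv_def)

lemma smooth_expr_partial_deriv: "smooth_expr f \<Longrightarrow> smooth_expr (partial_deriv j f)"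
proof (induction rule: smooth_expr.induct)
  case (smooth f)
  then show ?case by (simp add: smooth_expr.smooth smooth_partial_deriv)
next
  case (const c)
  then show ?case by (simp add: smooth_expr.const)
next
  case (flat k c i b)
  have "partial_deriv j (\<lambda>x. flat_exp k (c * x $ i + b)) =
     (\<lambda>x::'a rvec. (flat_exp (k + 2) (c * x $ i + b) + (- real k) * flat_exp (k + 1) (c * x $ i + b))
        * (c * axis j 1 $ i))"
    by (simp add: fun_eq_iff has_derivative_partial_deriv[OF flat_exp_coord_has_derivative])
  then show ?case
    by (simp only:) (intro smooth_expr.intros)
next
  case (add f g)
  have "partial_deriv j (\<lambda>x. f x + g x) = (\<lambda>x. partial_deriv j f x + partial_deriv j g x)"
    using add by (simp add: fun_eq_iff partial_deriv_add smooth_expr_differentiable)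
  then show ?case using add by (simp add: smooth_expr.add)
next
  case (mult f g)
  have "partial_deriv j (\<lambda>x. f x * g x) = (\<lambda>x. f x * partial_deriv j g x + partial_deriv j f x * g x)"
    using mult by (simp add: fun_eq_iff partial_deriv_mult smooth_expr_differentiable)
  then show ?case using mult by (simp add: smooth_expr.add smooth_expr.mult)
next
  case (inverse f)
  have "partial_deriv j (\<lambda>x. inverse (f x))
      = (\<lambda>x. (-1) * (inverse (f x) * partial_deriv j f x * inverse (f x)))"
    using inverse by (simp add: fun_eq_iff partial_deriv_inverse smooth_expr_differentiable)
  then show ?case
    using inverse by (simp only:) (intro smooth_expr.mult smooth_expr.const smooth_expr.inverse; simp)
qed

text \<open>The constructor \<open>smooth\<close> puts every smooth function into the class, and
  coinduction shows that it contains nothing else. The closure properties of smooth functions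
  thereby become introduction rules.\<close>

lemma smooth_iff_expr: "smooth f \<longleftrightarrow> smooth_expr f"
  using smooth_coinduct[of smooth_expr f] smooth_expr_differentiable smooth_expr_partial_deriv
    smooth_expr.smooth by blast

lemma smooth_const: "smooth (\<lambda>_. c)"
  and smooth_flat: "smooth (\<lambda>x. flat_exp k (c * x $ i + b))"
  and smooth_add: "smooth f \<Longrightarrow> smooth g \<Longrightarrow> smooth (\<lambda>x. f x + g x)"
  and smooth_mult: "smooth f \<Longrightarrow> smooth g \<Longrightarrow> smooth (\<lambda>x. f x * g x)"
  and smooth_inverse: "smooth f \<Longrightarrow> (\<And>x. f x \<noteq> 0) \<Longrightarrow> smooth (\<lambda>x. inverse (f x))"
  by (auto simp: smooth_iff_expr intro: smooth_expr.intros)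

lemma smooth_prod: "finite I \<Longrightarrow> (\<And>i. i \<in> I \<Longrightarrow> smooth (f i)) \<Longrightarrow> smooth (\<lambda>x. \<Prod>i\<in>I. f i x)"
  by (induction I rule: finite_induct) (auto intro: smooth_const smooth_mult)

section \<open>Affine changes of variable\<close>

lemma affine_has_derivative:
  assumes "smooth f"
  shows "((\<lambda>x. k * f (b + r *\<^sub>R x)) has_derivative
    (\<lambda>h. k * (r * frechet_derivative f (at (b + r *\<^sub>R x)) h))) (at x)"
proof -
  have "((\<lambda>x. b + r *\<^sub>R x) has_derivative (\<lambda>h. r *\<^sub>R h)) (at x)"
    by (auto intro!: derivative_eq_intros)
  moreover have "(f has_derivative frechet_derivative f (at (b + r *\<^sub>R x))) (at (b + r *\<^sub>R x))"
    using assms smooth_differentiable frechet_derivative_works by blast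
  ultimately have d: "((\<lambda>x. f (b + r *\<^sub>R x)) has_derivative
      (\<lambda>h. frechet_derivative f (at (b + r *\<^sub>R x)) (r *\<^sub>R h))) (at x)"
    by (rule has_derivative_compose)
  have l: "linear (frechet_derivative f (at (b + r *\<^sub>R x)))"
    using assms smooth_differentiable linear_frechet_derivative by blast
  show ?thesis
    using has_derivative_mult_right[OF d, of k] by (simp add: linear_cmul[OF l])
qed

lemma partial_deriv_affine:
  assumes "smooth f"
  shows "partial_deriv i (\<lambda>x. k * f (b + r *\<^sub>R x)) = (\<lambda>x. (k * r) * partial_deriv i f (b + r *\<^sub>R x))"
  by (simp add: fun_eq_iff has_derivative_partial_deriv[OF affine_has_derivative[OF assms]])
    (simp add: partial_deriv_def)

lemma iterated_partial_deriv_affine: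
  assumes "smooth f"
  shows "iterated_partial_deriv is (\<lambda>x. f (b + r *\<^sub>R x))
    = (\<lambda>x. r ^ length is * iterated_partial_deriv is f (b + r *\<^sub>R x))"
proof (induction "is")
  case (Cons i "is")
  show ?case
    by (simp add: iterated_partial_deriv_Cons Cons
        partial_deriv_affine[OF smooth_iterated_partial_deriv[OF assms]] mult.commute)
qed simp

lemma smooth_affine:
  assumes "smooth f"
  shows "smooth (\<lambda>x. f (b + r *\<^sub>R x))"
\<comment> \<open>The free scalar k absorbs the factor r that every differentiation
  produces.\<close>
proof (rule smooth_coinduct[where P = "\<lambda>g. \<exists>k f. smooth f \<and> g = (\<lambda>x. k * f (b + r *\<^sub>R x))"])
  show "\<exists>k f'. smooth f' \<and> (\<lambda>x. f (b + r *\<^sub>R x)) = (\<lambda>x. k * f' (b + r *\<^sub>R x))"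
    using assms by (intro exI[of _ 1] exI[of _ f]) simp
next
  fix g :: "'a rvec \<Rightarrow> real" and x
  assume "\<exists>k f. smooth f \<and> g = (\<lambda>x. k * f (b + r *\<^sub>R x))"
  then obtain k f where f: "smooth f" "g = (\<lambda>x. k * f (b + r *\<^sub>R x))" by blast
  then show "g differentiable (at x)"
    using affine_has_derivative differentiable_def by blast
next
  fix g :: "'a rvec \<Rightarrow> real" and i
  assume "\<exists>k f. smooth f \<and> g = (\<lambda>x. k * f (b + r *\<^sub>R x))"
  then show "\<exists>k f. smooth f \<and> partial_deriv i g = (\<lambda>x. k * f (b + r *\<^sub>R x))"
    using partial_deriv_affine smooth_partial_deriv by blast
qed

subsection \<open>Symmetry of the partial derivatives\<close>

lemma DERIV_along_axis:
  fixes f :: "'n::finite rvec \<Rightarrow> real"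
  assumes "smooth f"
  shows "((\<lambda>t. f (x + t *\<^sub>R axis i 1)) has_real_derivative partial_deriv i f (x + t *\<^sub>R axis i 1)) (at t)"
proof -
  have "(f has_derivative frechet_derivative f (at (x + t *\<^sub>R axis i 1))) (at (x + t *\<^sub>R axis i 1))"
    using assms smooth_differentiable frechet_derivative_works by blast
  moreover have "((\<lambda>t. x + t *\<^sub>R axis i 1) has_derivative (\<lambda>h. h *\<^sub>R axis i 1)) (at t)"
    by (auto intro!: derivative_eq_intros)
  ultimately have "((\<lambda>t. f (x + t *\<^sub>R axis i 1)) has_derivative
      (\<lambda>h. frechet_derivative f (at (x + t *\<^sub>R axis i 1)) (h *\<^sub>R axis i 1))) (at t)"
    by (rule has_derivative_compose[rotated])
  moreover have l: "linear (frechet_derivative f (at (x + t *\<^sub>R axis i 1)))"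
    using assms smooth_differentiable linear_frechet_derivative by blast
  ultimately show ?thesis
    by (simp add: has_field_derivative_def linear_cmul[OF l] partial_deriv_def mult.commute[of _ "frechet_derivative _ _ _"])
qed

text \<open>The mean value theorem in direction i is applied to the increment of f along j, and then
  once more in direction j. The second difference is symmetric in i and j while the right-hand side
  is not; the symmetry of mixed derivatives rests on this.\<close>

lemma second_difference_mean_value:
  fixes f :: "'n::finite rvec \<Rightarrow> real"
  assumes f: "smooth f" and "0 < h"
  shows "\<exists>s t. 0 < s \<and> s < h \<and> 0 < t \<and> t < h \<and>
    f (x + h *\<^sub>R axis i 1 + h *\<^sub>R axis j 1) - f (x + h *\<^sub>R axis i 1) - f (x + h *\<^sub>R axis j 1) + f x
      = h\<^sup>2 * partial_deriv j (partial_deriv i f) (x + s *\<^sub>R axis i 1 + t *\<^sub>R axis j 1)"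
proof -
  let ?F = "\<lambda>s. f (x + h *\<^sub>R axis j 1 + s *\<^sub>R axis i 1) - f (x + s *\<^sub>R axis i 1)"
  have "\<exists>s. 0 < s \<and> s < h \<and> ?F h - ?F 0 = (h - 0) *
      (partial_deriv i f (x + h *\<^sub>R axis j 1 + s *\<^sub>R axis i 1) - partial_deriv i f (x + s *\<^sub>R axis i 1))"
    using \<open>0 < h\<close> by (intro MVT2 DERIV_diff DERIV_along_axis f)
  then obtain s where s: "0 < s" "s < h" "?F h - ?F 0 = h *
      (partial_deriv i f (x + h *\<^sub>R axis j 1 + s *\<^sub>R axis i 1) - partial_deriv i f (x + s *\<^sub>R axis i 1))"
    by auto
  let ?G = "\<lambda>t. partial_deriv i f (x + s *\<^sub>R axis i 1 + t *\<^sub>R axis j 1)"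
  have "\<exists>t. 0 < t \<and> t < h \<and> ?G h - ?G 0 = (h - 0) *
      partial_deriv j (partial_deriv i f) (x + s *\<^sub>R axis i 1 + t *\<^sub>R axis j 1)"
    using \<open>0 < h\<close> by (intro MVT2 DERIV_along_axis smooth_partial_deriv f)
  then obtain t where t: "0 < t" "t < h" "?G h - ?G 0 = h *
      partial_deriv j (partial_deriv i f) (x + s *\<^sub>R axis i 1 + t *\<^sub>R axis j 1)"
    by auto
  have "?F h - ?F 0 = h * (?G h - ?G 0)"
    using s(3) by (simp add: add_ac)
  with t(3) have "?F h - ?F 0
      = h\<^sup>2 * partial_deriv j (partial_deriv i f) (x + s *\<^sub>R axis i 1 + t *\<^sub>R axis j 1)"
    by (simp add: power2_eq_square)
  with s t show ?thesis
    by (intro exI[of _ s] exI[of _ t]) (simp add: algebra_simps)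
qed

text \<open>Exchanging i and j leaves the second difference unchanged, so the two mixed derivatives
  take equal values at two points close to x; continuity carries this to x itself.\<close>

lemma partial_deriv_commute:
  fixes f :: "'n::finite rvec \<Rightarrow> real"
  assumes f: "smooth f"
  shows "partial_deriv i (partial_deriv j f) = partial_deriv j (partial_deriv i f)"
proof
  fix x
  define A where "A = partial_deriv i (partial_deriv j f)"
  define B where "B = partial_deriv j (partial_deriv i f)"
  have cont: "isCont A x" "isCont B x"
    using f by (auto simp: A_def B_def smooth_partial_deriv
        intro!: continuous_on_interior[OF smooth_continuous])
  have "\<bar>A x - B x\<bar> < e" if "e > 0" for e
  proof -
    obtain dA where dA: "dA > 0" "\<And>y. dist y x < dA \<Longrightarrow> dist (A y) (A x) < e / 2"
      using cont(1) \<open>e > 0\<close> unfolding continuous_at_eps_delta by (metis half_gt_zero)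
    obtain dB where dB: "dB > 0" "\<And>y. dist y x < dB \<Longrightarrow> dist (B y) (B x) < e / 2"
      using cont(2) \<open>e > 0\<close> unfolding continuous_at_eps_delta by (metis half_gt_zero)
    \<comment> \<open>The displacements s and t along the axes stay below h, so both intermediate
      points lie within 2 h of x and thus in both continuity neighbourhoods.\<close>
    define h where "h = min dA dB / 2"
    have h: "0 < h" "2 * h \<le> dA" "2 * h \<le> dB"
      using dA dB by (auto simp: h_def)
    have near: "dist (x + s *\<^sub>R axis k 1 + t *\<^sub>R axis l 1) x < 2 * h"
      if "0 < s" "s < h" "0 < t" "t < h" for s t k l
    proof -
      have "dist (x + s *\<^sub>R axis k 1 + t *\<^sub>R axis l 1) x = norm (s *\<^sub>R axis k 1 + t *\<^sub>R axis l (1::real) :: 'n rvec)"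
        by (simp add: dist_norm add.assoc)
      also have "\<dots> \<le> s + t"
        using norm_triangle_ineq[of "s *\<^sub>R axis k 1 :: 'n rvec" "t *\<^sub>R axis l 1"] that by simp
      finally show ?thesis using that by simp
    qed
    obtain s t where B: "0 < s" "s < h" "0 < t" "t < h"
      "f (x + h *\<^sub>R axis i 1 + h *\<^sub>R axis j 1) - f (x + h *\<^sub>R axis i 1) - f (x + h *\<^sub>R axis j 1) + f x
        = h\<^sup>2 * B (x + s *\<^sub>R axis i 1 + t *\<^sub>R axis j 1)"
      using second_difference_mean_value[OF f \<open>0 < h\<close>] unfolding B_def by blast
    obtain s' t' where A: "0 < s'" "s' < h" "0 < t'" "t' < h"
      "f (x + h *\<^sub>R axis j 1 + h *\<^sub>R axis i 1) - f (x + h *\<^sub>R axis j 1) - f (x + h *\<^sub>R axis i 1) + f x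
        = h\<^sup>2 * A (x + s' *\<^sub>R axis j 1 + t' *\<^sub>R axis i 1)"
      using second_difference_mean_value[OF f \<open>0 < h\<close>] unfolding A_def by blast
    have "h\<^sup>2 * A (x + s' *\<^sub>R axis j 1 + t' *\<^sub>R axis i 1) = h\<^sup>2 * B (x + s *\<^sub>R axis i 1 + t *\<^sub>R axis j 1)"
      using A(5) B(5) by (simp add: algebra_simps)
    then have eq: "A (x + s' *\<^sub>R axis j 1 + t' *\<^sub>R axis i 1) = B (x + s *\<^sub>R axis i 1 + t *\<^sub>R axis j 1)"
      using h by simp
    have "dist (A (x + s' *\<^sub>R axis j 1 + t' *\<^sub>R axis i 1)) (A x) < e / 2"
      using dA(2) near[OF A(1-4), of j i] h by force
    moreover have "dist (B (x + s *\<^sub>R axis i 1 + t *\<^sub>R axis j 1)) (B x) < e / 2"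
      using dB(2) near[OF B(1-4), of i j] h by force
    ultimately show ?thesis
      unfolding eq dist_real_def by argo
  qed
  then have "A x = B x"
    by (metis eq_iff_diff_eq_0 order_less_irrefl zero_less_abs_iff)
  then show "partial_deriv i (partial_deriv j f) x = partial_deriv j (partial_deriv i f) x"
    by (simp add: A_def B_def)
qed

lemma iterated_partial_deriv_commute:
  assumes "smooth f"
  shows "iterated_partial_deriv is (partial_deriv i f) = partial_deriv i (iterated_partial_deriv is f)"
  by (induction "is")
    (simp_all add: iterated_partial_deriv_Cons assms smooth_iterated_partial_deriv partial_deriv_commute[of _ i])

lemma iterated_partial_deriv_mset:
  assumes "smooth f" "mset is = mset js"
  shows "iterated_partial_deriv is f = iterated_partial_deriv js f"
  using assms(2)
proof (induction "is" arbitrary: js)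
  case (Cons i "is")
  then have "i \<in> set js" by (metis list.set_intros(1) mset_eq_setD)
  then obtain as bs where js: "js = as @ i # bs" by (meson split_list)
  with Cons have "iterated_partial_deriv is f = iterated_partial_deriv (as @ bs) f" by simp
  then show ?case
    by (simp add: js iterated_partial_deriv_Cons iterated_partial_deriv_append assms(1)
        iterated_partial_deriv_commute smooth_iterated_partial_deriv)
qed simp

section \<open>Multi-indices\<close>

lemma multi_index_list:
  fixes \<alpha> :: "'n::{finite,linorder} \<Rightarrow> nat"
  shows "count (mset (concat (map (\<lambda>i. replicate (\<alpha> i) i) (sorted_list_of_set UNIV)))) k = \<alpha> k"
    and "length (concat (map (\<lambda>i. replicate (\<alpha> i) i) (sorted_list_of_set UNIV))) = multi_order \<alpha>"
proof -
  have "count (mset (concat (map (\<lambda>i. replicate (\<alpha> i) i) xs))) k = (if k \<in> set xs then \<alpha> k else 0)"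
    if "distinct xs" for xs
    using that by (induction xs) auto
  then show "count (mset (concat (map (\<lambda>i. replicate (\<alpha> i) i) (sorted_list_of_set UNIV)))) k = \<alpha> k"
    by simp
  have "length (concat (map (\<lambda>i. replicate (\<alpha> i) i) xs)) = (\<Sum>i\<in>set xs. \<alpha> i)" if "distinct xs" for xs
    using that by (induction xs) auto
  then show "length (concat (map (\<lambda>i. replicate (\<alpha> i) i) (sorted_list_of_set UNIV))) = multi_order \<alpha>"
    by (simp add: multi_order_def)
qed

text \<open>The list of the raised index has the same multiset as the old list with i appended, and
  by symmetry only the multiset counts. The extra derivative can therefore be taken first, which is
  the form needed for iterating weak derivatives.\<close>

lemma multi_deriv_Suc:
  assumes "smooth f"
  shows "multi_deriv (\<alpha>(i := Suc (\<alpha> i))) f = multi_deriv \<alpha> (partial_deriv i f)"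
proof -
  let ?l = "\<lambda>\<alpha>. concat (map (\<lambda>i. replicate (\<alpha> i) i) (sorted_list_of_set UNIV))"
  have "mset (?l (\<alpha>(i := Suc (\<alpha> i)))) = mset (?l \<alpha> @ [i])"
    by (rule multiset_eqI) (simp del: mset_concat add: multi_index_list)
  from iterated_partial_deriv_mset[OF assms this] show ?thesis
    by (simp add: multi_deriv_def iterated_partial_deriv_append iterated_partial_deriv_Cons)
qed

lemma multi_deriv_affine:
  assumes "smooth f"
  shows "multi_deriv \<alpha> (\<lambda>x. f (b + r *\<^sub>R x)) = (\<lambda>x. r ^ multi_order \<alpha> * multi_deriv \<alpha> f (b + r *\<^sub>R x))"
  unfolding multi_deriv_def iterated_partial_deriv_affine[OF assms] multi_index_list(2) ..

lemma multi_order_Suc: "multi_order (\<alpha>(i := Suc (\<alpha> i))) = Suc (multi_order \<alpha>)"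
proof -
  have "multi_order (\<alpha>(i := Suc (\<alpha> i))) = (\<Sum>k\<in>UNIV. \<alpha> k + (if k = i then 1 else 0))"
    unfolding multi_order_def by (rule sum.cong) auto
  then show ?thesis
    by (simp add: sum.distrib multi_order_def)
qed

text \<open>Induction on the order: an index of positive order has a positive entry, and lowering
  that entry gives a predecessor.\<close>

lemma multi_order_induct [case_names zero Suc]:
  fixes \<alpha> :: "'n::finite \<Rightarrow> nat"
  assumes "P (\<lambda>_. 0)" and "\<And>\<alpha> i. P \<alpha> \<Longrightarrow> P (\<alpha>(i := Suc (\<alpha> i)))"
  shows "P \<alpha>"
proof (induction "multi_order \<alpha>" arbitrary: \<alpha>)
  case 0
  then have "\<alpha> = (\<lambda>_. 0)" by (auto simp: multi_order_def)
  with assms(1) show ?case by simp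
next
  case (Suc n)
  then obtain i where "\<alpha> i \<noteq> 0" by (metis multi_order_def sum.neutral nat.distinct(1))
  then have eq: "\<alpha> = (\<alpha>(i := \<alpha> i - 1))(i := Suc ((\<alpha>(i := \<alpha> i - 1)) i))" by auto
  then have "n = multi_order (\<alpha>(i := \<alpha> i - 1))"
    using Suc(2) multi_order_Suc by (metis nat.inject)
  from assms(2)[OF Suc(1)[OF this], of i] eq show ?case by simp
qed

lemma finite_multi_order: "finite {\<alpha> :: 'n::finite \<Rightarrow> nat. multi_order \<alpha> \<le> m}"
proof (rule finite_subset)
  have "\<alpha> i \<le> multi_order \<alpha>" for \<alpha> :: "'n \<Rightarrow> nat" and i
    unfolding multi_order_def by (rule member_le_sum) auto
  then show "{\<alpha> :: 'n \<Rightarrow> nat. multi_order \<alpha> \<le> m} \<subseteq> PiE UNIV (\<lambda>_. {..m})"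
    using le_trans by (fastforce simp: PiE_def)
qed (simp add: finite_PiE)

subsection \<open>Bump functions\<close>

text \<open>The standard smooth transition across the unit interval. The denominator is positive
  because t and 1 - t are never both nonpositive.\<close>

definition smooth_step :: "real \<Rightarrow> real" where
  "smooth_step t = flat_exp 0 t * inverse (flat_exp 0 t + flat_exp 0 (1 - t))"

lemma flat_exp_0_sum_pos: "flat_exp 0 t + flat_exp 0 (1 - t) > 0"
  by (auto simp: flat_exp_def add_pos_pos)

lemma smooth_step_range: "0 \<le> smooth_step t" "smooth_step t \<le> 1"
  using flat_exp_0_sum_pos[of t]
  by (auto simp: smooth_step_def flat_exp_def field_simps add_pos_pos)

lemma smooth_step_eq_0: "t \<le> 0 \<Longrightarrow> smooth_step t = 0"
  and smooth_step_eq_1: "1 \<le> t \<Longrightarrow> smooth_step t = 1"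
  by (auto simp: smooth_step_def flat_exp_def)

lemma smooth_smooth_step: "smooth (\<lambda>x. smooth_step (c * x $ i + b))"
proof -
  have "smooth (\<lambda>x. flat_exp 0 (c * x $ i + b) *
      inverse (flat_exp 0 (c * x $ i + b) + flat_exp 0 ((- c) * x $ i + (1 - b))))"
    using flat_exp_0_sum_pos[of "c * _ $ i + b"]
    by (intro smooth_mult smooth_inverse smooth_add smooth_flat)
      (smt (verit, best) minus_mult_left)
  then show ?thesis
    by (simp add: smooth_step_def algebra_simps)
qed

text \<open>The parameter k is a steepness: for k > 0 the function is 1 where the distance to every
  face inside the box is at least 1/k, and 0 off the open box. A fixed k gives cutoffs, and k
  tending to infinity gives indicators of boxes.\<close>

definition box_bump :: "real \<Rightarrow> 'n::finite rvec \<Rightarrow> 'n rvec \<Rightarrow> 'n rvec \<Rightarrow> real" where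
  "box_bump k a b x = (\<Prod>i\<in>UNIV. smooth_step (k * (x $ i - a $ i)) * smooth_step (k * (b $ i - x $ i)))"

lemma smooth_box_bump: "smooth (box_bump k a b)"
proof -
  have "smooth (\<lambda>x. \<Prod>i\<in>UNIV. smooth_step (k * x $ i + (- k * a $ i)) * smooth_step ((- k) * x $ i + (k * b $ i)))"
    by (intro smooth_prod smooth_mult smooth_smooth_step) auto
  then show ?thesis
    by (simp add: box_bump_def[abs_def] algebra_simps)
qed

lemma box_bump_range: "0 \<le> box_bump k a b x" "box_bump k a b x \<le> 1"
  unfolding box_bump_def by (auto intro!: prod_nonneg prod_le_1 mult_le_one simp: smooth_step_range)

lemma box_bump_eq_0:
  assumes "k \<ge> 0" "x \<notin> box a b"
  shows "box_bump k a b x = 0"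
proof -
  obtain i where "x $ i \<le> a $ i \<or> b $ i \<le> x $ i"
    using assms(2) by (auto simp: mem_box_cart not_less)
  then have "smooth_step (k * (x $ i - a $ i)) * smooth_step (k * (b $ i - x $ i)) = 0"
    using assms(1) by (auto intro!: smooth_step_eq_0 simp: mult_le_0_iff)
  then show ?thesis
    unfolding box_bump_def by (auto intro!: prod_zero)
qed

lemma box_bump_eq_1:
  assumes "\<And>i. 1 \<le> k * (x $ i - a $ i)" "\<And>i. 1 \<le> k * (b $ i - x $ i)"
  shows "box_bump k a b x = 1"
  using assms by (simp add: box_bump_def smooth_step_eq_1)

lemma box_bump_tendsto:
  "(\<lambda>k. box_bump (real k) a b x) \<longlonglongrightarrow> indicator (box a b) x"
proof (cases "x \<in> box a b")
  case True
  have "eventually (\<lambda>k. 1 \<le> real k * t) sequentially" if "t > 0" for t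
  proof -
    obtain n where n: "1 / t \<le> real n" using real_arch_simple by blast
    have "1 \<le> real k * t" if "n \<le> k" for k
    proof -
      have "1 / t \<le> real k" using n that by linarith
      then show ?thesis using \<open>t > 0\<close> by (simp add: divide_le_eq)
    qed
    then show ?thesis by (rule eventually_sequentiallyI)
  qed
  then have "eventually (\<lambda>k. \<forall>i. 1 \<le> real k * (x $ i - a $ i)) sequentially"
     "eventually (\<lambda>k. \<forall>i. 1 \<le> real k * (b $ i - x $ i)) sequentially"
    using True by (auto simp: mem_box_cart intro!: eventually_all_finite)
  then have "eventually (\<lambda>k. box_bump (real k) a b x = 1) sequentially"
    by eventually_elim (rule box_bump_eq_1; blast)
  with True show ?thesis by (simp add: tendsto_eventually)
next
  case False
  then show ?thesis by (simp add: box_bump_eq_0)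
qed

subsection \<open>Test functions\<close>

lemma test_functions_mono: "\<phi> \<in> test_functions S \<Longrightarrow> S \<subseteq> T \<Longrightarrow> \<phi> \<in> test_functions T"
  by (auto simp: test_functions_def)

lemma test_functions_smooth: "\<phi> \<in> test_functions S \<Longrightarrow> smooth \<phi>"
  by (simp add: test_functions_def)

lemma test_functions_outside: "\<phi> \<in> test_functions S \<Longrightarrow> x \<notin> S \<Longrightarrow> \<phi> x = 0"
  using closure_subset[of "{x. \<phi> x \<noteq> 0}"] by (auto simp: test_functions_def)

lemma test_functionsI:
  assumes "smooth \<phi>" "{x. \<phi> x \<noteq> 0} \<subseteq> K" "compact K" "K \<subseteq> S"
  shows "\<phi> \<in> test_functions S"
proof -
  have "closure {x. \<phi> x \<noteq> 0} \<subseteq> K"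
    using assms by (simp add: closure_minimal compact_imp_closed)
  moreover have "compact (closure {x. \<phi> x \<noteq> 0})"
    using assms by (meson bounded_closure bounded_subset closed_closure compact_eq_bounded_closed)
  ultimately show ?thesis
    using assms by (auto simp: test_functions_def)
qed

lemma test_functions_support:
  assumes "\<phi> \<in> test_functions S" "smooth \<psi>" "{x. \<psi> x \<noteq> 0} \<subseteq> closure {x. \<phi> x \<noteq> 0}"
  shows "\<psi> \<in> test_functions S"
  using assms by (intro test_functionsI[where K = "closure {x. \<phi> x \<noteq> 0}"]) (auto simp: test_functions_def)

lemma test_functions_mult:
  assumes "\<phi> \<in> test_functions S" "smooth c"
  shows "(\<lambda>x. c x * \<phi> x) \<in> test_functions S"
proof (rule test_functions_support[OF assms(1)])
  show "smooth (\<lambda>x. c x * \<phi> x)"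
    using assms by (simp add: smooth_mult test_functions_smooth)
  show "{x. c x * \<phi> x \<noteq> 0} \<subseteq> closure {x. \<phi> x \<noteq> 0}"
    using closure_subset[of "{x. \<phi> x \<noteq> 0}"] by auto
qed

text \<open>Off its closed support the function vanishes on a whole neighbourhood, hence so does the
  derivative there; differentiation does not enlarge the support.\<close>

lemma test_functions_partial_deriv:
  assumes "\<phi> \<in> test_functions S"
  shows "partial_deriv i \<phi> \<in> test_functions S"
proof (rule test_functions_support[OF assms])
  show "smooth (partial_deriv i \<phi>)"
    using assms by (simp add: smooth_partial_deriv test_functions_smooth)
  have "partial_deriv i \<phi> x = 0" if "x \<notin> closure {x. \<phi> x \<noteq> 0}" for x
  proof -
    have "((\<lambda>_. 0) has_derivative (\<lambda>_. 0)) (at x)" by simp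
    then have "(\<phi> has_derivative (\<lambda>_. 0)) (at x)"
      by (rule has_derivative_transform_within_open[where s = "- closure {x. \<phi> x \<noteq> 0}"])
        (use that closure_subset[of "{x. \<phi> x \<noteq> 0}"] in auto)
    then show ?thesis
      by (simp add: has_derivative_partial_deriv)
  qed
  then show "{x. partial_deriv i \<phi> x \<noteq> 0} \<subseteq> closure {x. \<phi> x \<noteq> 0}" by blast
qed

lemma test_functions_multi_deriv:
  assumes "\<phi> \<in> test_functions S"
  shows "multi_deriv \<alpha> \<phi> \<in> test_functions S"
proof -
  have "iterated_partial_deriv is \<phi> \<in> test_functions S" for "is"
    by (induction "is") (auto simp: assms iterated_partial_deriv_Cons test_functions_partial_deriv)
  then show ?thesis by (simp add: multi_deriv_def)
qed

lemma multi_deriv_0 [simp]: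
  fixes \<phi> :: "'n::{finite,linorder} rvec \<Rightarrow> real"
  shows "multi_deriv (\<lambda>_. 0) \<phi> = \<phi>"
proof -
  have "concat (map (\<lambda>i::'n. [] :: 'n list) xs) = []" for xs by (induction xs) auto
  then show ?thesis by (simp only: multi_deriv_def replicate_0 iterated_partial_deriv_Nil)
qed

lemma multi_order_0 [simp]: "multi_order (\<lambda>_. 0) = 0"
  by (simp add: multi_order_def)

lemma multi_deriv_add:
  assumes "smooth \<phi>" "smooth \<psi>"
  shows "multi_deriv \<alpha> (\<lambda>x. \<phi> x + \<psi> x) = (\<lambda>x. multi_deriv \<alpha> \<phi> x + multi_deriv \<alpha> \<psi> x)"
proof -
  have "iterated_partial_deriv is (\<lambda>x. \<phi> x + \<psi> x)
      = (\<lambda>x. iterated_partial_deriv is \<phi> x + iterated_partial_deriv is \<psi> x)" for "is"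
  proof (induction "is")
    case (Cons i "is")
    show ?case
      by (simp add: iterated_partial_deriv_Cons Cons)
        (simp add: fun_eq_iff partial_deriv_add smooth_differentiable smooth_iterated_partial_deriv assms)
  qed simp
  then show ?thesis by (simp add: multi_deriv_def)
qed

lemma test_functions_bounded:
  assumes "\<phi> \<in> test_functions S"
  shows "\<exists>C\<ge>0. \<forall>x. \<bar>\<phi> x\<bar> \<le> C"
proof -
  let ?K = "closure {x. \<phi> x \<noteq> 0}"
  have "compact (\<phi> ` ?K)"
    using assms
    by (intro compact_continuous_image continuous_on_subset[OF smooth_continuous]) (auto simp: test_functions_def)
  then obtain C where C: "\<And>x. x \<in> ?K \<Longrightarrow> \<bar>\<phi> x\<bar> \<le> C"
    by (force dest!: compact_imp_bounded simp: bounded_iff)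
  have "\<bar>\<phi> x\<bar> \<le> max C 0" for x
    using C[of x] closure_subset[of "{x. \<phi> x \<noteq> 0}"] by (cases "\<phi> x = 0") auto
  then show ?thesis by (intro exI[of _ "max C 0"]) auto
qed

lemma smooth_borel_measurable: "smooth f \<Longrightarrow> f \<in> borel_measurable lebesgue"
  by (simp add: borel_measurable_continuous_onI measurable_completion smooth_continuous)

lemma integrable_test_function:
  assumes "\<phi> \<in> test_functions S" "locally_integrable_on u S"
  shows "integrable lebesgue (\<lambda>x. \<phi> x *\<^sub>R u x)"
proof -
  let ?K = "closure {x. \<phi> x \<noteq> 0}"
  have u: "integrable lebesgue (\<lambda>x. indicat_real ?K x *\<^sub>R u x)"
    using assms by (simp add: test_functions_def locally_integrable_on_def set_integrable_def)
  obtain C where C: "C \<ge> 0" "\<And>x. \<bar>\<phi> x\<bar> \<le> C" using test_functions_bounded[OF assms(1)] by blast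
  \<comment> \<open>Inserting the indicator of the compact support changes nothing and exhibits the
    product as a bounded function times an integrable one.\<close>
  have eq: "\<phi> x *\<^sub>R u x = \<phi> x *\<^sub>R (indicat_real ?K x *\<^sub>R u x)" for x
    using closure_subset[of "{x. \<phi> x \<noteq> 0}"] by (auto simp: indicator_def)
  show ?thesis
    unfolding eq
  proof (rule Bochner_Integration.integrable_bound)
    show "integrable lebesgue (\<lambda>x. C *\<^sub>R (indicat_real ?K x *\<^sub>R u x))"
      using u by (rule integrable_scaleR_right)
    show "(\<lambda>x. \<phi> x *\<^sub>R indicat_real ?K x *\<^sub>R u x) \<in> borel_measurable lebesgue"
      using borel_measurable_scaleR[OF smooth_borel_measurable[OF test_functions_smooth[OF assms(1)]]
          borel_measurable_integrable[OF u]] .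
    show "AE x in lebesgue. norm (\<phi> x *\<^sub>R indicat_real ?K x *\<^sub>R u x)
        \<le> norm (C *\<^sub>R indicat_real ?K x *\<^sub>R u x)"
      using C by (auto intro!: AE_I2 mult_right_mono simp: indicator_def)
  qed
qed

subsection \<open>Locally integrable functions\<close>

lemma locally_integrable_on_subset:
  "locally_integrable_on u S \<Longrightarrow> T \<subseteq> S \<Longrightarrow> locally_integrable_on u T"
  unfolding locally_integrable_on_def by blast

lemma locally_integrable_on_cong:
  assumes "\<And>x. x \<in> S \<Longrightarrow> u x = v x"
  shows "locally_integrable_on u S \<longleftrightarrow> locally_integrable_on v S"
proof -
  have "set_integrable lebesgue K u = set_integrable lebesgue K v" if "K \<subseteq> S" for K
    unfolding set_integrable_def using assms that
    by (intro Bochner_Integration.integrable_cong) (auto simp: indicator_def)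
  then show ?thesis by (simp add: locally_integrable_on_def)
qed

lemma integrable_imp_locally_integrable:
  assumes "integrable lebesgue u"
  shows "locally_integrable_on u S"
  unfolding locally_integrable_on_def set_integrable_def
  using assms by (auto intro!: integrable_mult_indicator simp: fmeasurableD lmeasurable_compact)

lemma locally_integrable_on_add:
  "locally_integrable_on u S \<Longrightarrow> locally_integrable_on v S \<Longrightarrow> locally_integrable_on (\<lambda>x. u x + v x) S"
  unfolding locally_integrable_on_def by (simp add: set_integral_add)

lemma locally_integrable_on_diff:
  "locally_integrable_on u S \<Longrightarrow> locally_integrable_on v S \<Longrightarrow> locally_integrable_on (\<lambda>x. u x - v x) S"
  unfolding locally_integrable_on_def by (simp add: set_integral_diff)

lemma locally_integrable_on_scaleR:
  "locally_integrable_on u S \<Longrightarrow> locally_integrable_on (\<lambda>x. c *\<^sub>R u x) S"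
  unfolding locally_integrable_on_def by (auto intro: set_integrable_scaleR_right)

lemma locally_integrable_test_function:
  "\<phi> \<in> test_functions S \<Longrightarrow> locally_integrable_on u S \<Longrightarrow> locally_integrable_on (\<lambda>x. \<phi> x *\<^sub>R u x) T"
  by (rule integrable_imp_locally_integrable[OF integrable_test_function])

subsection \<open>Calculus of weak derivatives\<close>

lemma set_integral_test_function:
  assumes "\<phi> \<in> test_functions S"
  shows "set_lebesgue_integral M S (\<lambda>x. \<phi> x *\<^sub>R u x) = integral\<^sup>L M (\<lambda>x. \<phi> x *\<^sub>R u x)"
  unfolding set_lebesgue_integral_def using test_functions_outside[OF assms]
  by (intro Bochner_Integration.integral_cong) (auto simp: indicator_def)

text \<open>Test functions and their derivatives vanish off S, so the set integrals are integrals
  over the whole space. This is the form used in the calculus below.\<close>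

lemma has_weak_deriv_iff:
  "has_weak_deriv S \<alpha> u g \<longleftrightarrow> locally_integrable_on u S \<and> locally_integrable_on g S \<and>
    (\<forall>\<phi>\<in>test_functions S. integral\<^sup>L lebesgue (\<lambda>x. multi_deriv \<alpha> \<phi> x *\<^sub>R u x)
       = (- 1) ^ multi_order \<alpha> *\<^sub>R integral\<^sup>L lebesgue (\<lambda>x. \<phi> x *\<^sub>R g x))"
  unfolding has_weak_deriv_def
  by (simp add: set_integral_test_function test_functions_multi_deriv cong: conj_cong)

text \<open>A test function of T is also one of S, and values off T never enter. The freedom to
  replace u by a function equal to it on T later identifies the cut-off product with the original
  one.\<close>

lemma has_weak_deriv_subset:
  assumes "has_weak_deriv S \<alpha> u g" "T \<subseteq> S"
    and "\<And>x. x \<in> T \<Longrightarrow> u x = u' x" "\<And>x. x \<in> T \<Longrightarrow> g x = g' x"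
  shows "has_weak_deriv T \<alpha> u' g'"
proof -
  have cong: "integral\<^sup>L lebesgue (\<lambda>x. \<phi> x *\<^sub>R v x) = integral\<^sup>L lebesgue (\<lambda>x. \<phi> x *\<^sub>R v' x)"
    if "\<phi> \<in> test_functions T" "\<And>x. x \<in> T \<Longrightarrow> v x = v' x" for \<phi> and v v' :: "'a rvec \<Rightarrow> 'b"
  proof (intro Bochner_Integration.integral_cong refl)
    fix x show "\<phi> x *\<^sub>R v x = \<phi> x *\<^sub>R v' x"
      using that(2)[of x] test_functions_outside[OF that(1), of x] by (cases "x \<in> T") auto
  qed
  show ?thesis
    unfolding has_weak_deriv_iff
  proof (intro conjI ballI)
    show "locally_integrable_on u' T" "locally_integrable_on g' T"
      using assms locally_integrable_on_subset locally_integrable_on_cong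
      unfolding has_weak_deriv_iff by blast+
    fix \<phi> assume \<phi>: "\<phi> \<in> test_functions T"
    then have "\<phi> \<in> test_functions S" using assms(2) test_functions_mono by blast
    then have "integral\<^sup>L lebesgue (\<lambda>x. multi_deriv \<alpha> \<phi> x *\<^sub>R u x)
       = (- 1) ^ multi_order \<alpha> *\<^sub>R integral\<^sup>L lebesgue (\<lambda>x. \<phi> x *\<^sub>R g x)"
      using assms(1) by (simp add: has_weak_deriv_iff)
    also have "integral\<^sup>L lebesgue (\<lambda>x. \<phi> x *\<^sub>R g x) = integral\<^sup>L lebesgue (\<lambda>x. \<phi> x *\<^sub>R g' x)"
      by (rule cong[OF \<phi> assms(4)])
    also have "integral\<^sup>L lebesgue (\<lambda>x. multi_deriv \<alpha> \<phi> x *\<^sub>R u x)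
        = integral\<^sup>L lebesgue (\<lambda>x. multi_deriv \<alpha> \<phi> x *\<^sub>R u' x)"
      by (rule cong[OF test_functions_multi_deriv[OF \<phi>] assms(3)])
    finally show "integral\<^sup>L lebesgue (\<lambda>x. multi_deriv \<alpha> \<phi> x *\<^sub>R u' x)
       = (- 1) ^ multi_order \<alpha> *\<^sub>R integral\<^sup>L lebesgue (\<lambda>x. \<phi> x *\<^sub>R g' x)" .
  qed
qed

lemma has_weak_deriv_zero: "has_weak_deriv S \<alpha> (\<lambda>_. 0) (\<lambda>_. 0)"
  by (simp add: has_weak_deriv_iff integrable_imp_locally_integrable)

lemma has_weak_deriv_add:
  assumes "has_weak_deriv S \<alpha> u g" "has_weak_deriv S \<alpha> v h"
  shows "has_weak_deriv S \<alpha> (\<lambda>x. u x + v x) (\<lambda>x. g x + h x)"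
proof -
  have add: "integral\<^sup>L lebesgue (\<lambda>x. \<phi> x *\<^sub>R (f x + f' x))
      = integral\<^sup>L lebesgue (\<lambda>x. \<phi> x *\<^sub>R f x) + integral\<^sup>L lebesgue (\<lambda>x. \<phi> x *\<^sub>R f' x)"
    if "\<phi> \<in> test_functions S" "locally_integrable_on f S" "locally_integrable_on f' S"
    for \<phi> and f f' :: "'a rvec \<Rightarrow> 'b"
    using that by (simp add: scaleR_add_right
        Bochner_Integration.integral_add[OF integrable_test_function integrable_test_function])
  show ?thesis
    using assms unfolding has_weak_deriv_iff
    by (simp del: scaleR_add_right add: locally_integrable_on_add add test_functions_multi_deriv)
      (simp add: scaleR_add_right)
qed

lemma has_weak_deriv_sum_list:
  "(\<And>l. l \<in> set L \<Longrightarrow> has_weak_deriv S \<alpha> (u l) (g l)) \<Longrightarrow>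
    has_weak_deriv S \<alpha> (\<lambda>x. \<Sum>l\<leftarrow>L. u l x) (\<lambda>x. \<Sum>l\<leftarrow>L. g l x)"
  by (induction L) (auto intro: has_weak_deriv_zero has_weak_deriv_add)

section \<open>Reduction to weak derivatives of first order\<close>

abbreviation unit_index :: "'n \<Rightarrow> 'n::finite \<Rightarrow> nat" where
  "unit_index i \<equiv> (\<lambda>_. 0)(i := Suc 0)"

lemma multi_deriv_unit: "smooth f \<Longrightarrow> multi_deriv (unit_index i) f = partial_deriv i f"
  using multi_deriv_Suc[of f "\<lambda>_. 0" i] by simp

lemma multi_order_unit: "multi_order (unit_index i) = 1"
  using multi_order_Suc[of "\<lambda>_. 0" i] by simp

lemma has_weak_deriv_unit_iff:
  "has_weak_deriv S (unit_index i) u g \<longleftrightarrow> locally_integrable_on u S \<and> locally_integrable_on g S \<and>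
    (\<forall>\<phi>\<in>test_functions S. integral\<^sup>L lebesgue (\<lambda>x. partial_deriv i \<phi> x *\<^sub>R u x)
       = - integral\<^sup>L lebesgue (\<lambda>x. \<phi> x *\<^sub>R g x))"
  unfolding has_weak_deriv_iff
  by (auto simp: multi_deriv_unit multi_order_unit test_functions_smooth)

text \<open>Testing the formula for \<alpha> with a partial derivative of \<phi> produces the one
  for the raised index. Together with the converse below, this reduces higher weak derivatives to
  first-order ones, for which the product rule is simple.\<close>

lemma has_weak_deriv_Suc_imp_unit:
  assumes "has_weak_deriv S \<alpha> u g" "has_weak_deriv S (\<alpha>(i := Suc (\<alpha> i))) u h"
  shows "has_weak_deriv S (unit_index i) g h"
  unfolding has_weak_deriv_unit_iff
proof (intro conjI ballI)
  fix \<phi> assume \<phi>: "\<phi> \<in> test_functions S"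
  have "(- 1) ^ multi_order \<alpha> *\<^sub>R integral\<^sup>L lebesgue (\<lambda>x. partial_deriv i \<phi> x *\<^sub>R g x)
      = integral\<^sup>L lebesgue (\<lambda>x. multi_deriv \<alpha> (partial_deriv i \<phi>) x *\<^sub>R u x)"
    using assms(1) test_functions_partial_deriv[OF \<phi>] by (simp add: has_weak_deriv_iff)
  also have "\<dots> = (- 1) ^ multi_order \<alpha> *\<^sub>R - integral\<^sup>L lebesgue (\<lambda>x. \<phi> x *\<^sub>R h x)"
    using assms(2) \<phi> by (simp add: has_weak_deriv_iff multi_deriv_Suc multi_order_Suc test_functions_smooth)
  finally show "integral\<^sup>L lebesgue (\<lambda>x. partial_deriv i \<phi> x *\<^sub>R g x)
      = - integral\<^sup>L lebesgue (\<lambda>x. \<phi> x *\<^sub>R h x)"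
    by (simp del: scaleR_minus_right)
qed (use assms in \<open>auto simp: has_weak_deriv_iff\<close>)

lemma has_weak_deriv_Suc:
  assumes "has_weak_deriv S \<alpha> u g" "has_weak_deriv S (unit_index i) g h"
  shows "has_weak_deriv S (\<alpha>(i := Suc (\<alpha> i))) u h"
  using assms unfolding has_weak_deriv_iff[of _ \<alpha>] has_weak_deriv_unit_iff
  by (simp add: has_weak_deriv_iff[of _ "\<alpha>(i := _)"] multi_deriv_Suc multi_order_Suc
      test_functions_smooth test_functions_partial_deriv)

text \<open>For every test function \<phi> of the whole space, \<phi> times c is a test function of
  S, so the classical product rule for it suffices. The result is global because c vanishes off a
  compact subset of S, whatever u does outside.\<close>

lemma has_weak_deriv_test_function_mult:
  assumes "has_weak_deriv S (unit_index i) u g" "c \<in> test_functions S"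
  shows "has_weak_deriv UNIV (unit_index i) (\<lambda>x. c x *\<^sub>R u x)
    (\<lambda>x. partial_deriv i c x *\<^sub>R u x + c x *\<^sub>R g x)"
proof -
  have li: "locally_integrable_on u S" "locally_integrable_on g S"
    using assms(1) by (auto simp: has_weak_deriv_iff)
  note dc = test_functions_partial_deriv[OF assms(2), of i]
  show ?thesis
    unfolding has_weak_deriv_unit_iff
  proof (intro conjI ballI)
    show "locally_integrable_on (\<lambda>x. c x *\<^sub>R u x) UNIV"
      "locally_integrable_on (\<lambda>x. partial_deriv i c x *\<^sub>R u x + c x *\<^sub>R g x) UNIV"
      using li assms(2) dc by (auto intro: locally_integrable_on_add locally_integrable_test_function)
    fix \<phi> :: "'a rvec \<Rightarrow> real" assume \<phi>: "\<phi> \<in> test_functions UNIV"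
    note \<phi>s = test_functions_smooth[OF \<phi>] and cs = test_functions_smooth[OF assms(2)]
    have \<phi>c: "(\<lambda>x. \<phi> x * c x) \<in> test_functions S"
      and d\<phi>c: "(\<lambda>x. partial_deriv i \<phi> x * c x) \<in> test_functions S"
      and \<phi>dc: "(\<lambda>x. \<phi> x * partial_deriv i c x) \<in> test_functions S"
      using \<phi>s assms(2) dc by (auto intro: test_functions_mult smooth_partial_deriv)
    have "partial_deriv i (\<lambda>x. \<phi> x * c x) = (\<lambda>x. \<phi> x * partial_deriv i c x + partial_deriv i \<phi> x * c x)"
      using \<phi>s cs by (simp add: fun_eq_iff partial_deriv_mult smooth_differentiable)
    then have "integral\<^sup>L lebesgue (\<lambda>x. (\<phi> x * partial_deriv i c x) *\<^sub>R u x + (partial_deriv i \<phi> x * c x) *\<^sub>R u x)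
        = - integral\<^sup>L lebesgue (\<lambda>x. (\<phi> x * c x) *\<^sub>R g x)"
      using assms(1)[unfolded has_weak_deriv_unit_iff, THEN conjunct2, THEN conjunct2, rule_format, OF \<phi>c]
      by (simp add: scaleR_add_left)
    then have "integral\<^sup>L lebesgue (\<lambda>x. (\<phi> x * partial_deriv i c x) *\<^sub>R u x)
        + integral\<^sup>L lebesgue (\<lambda>x. (partial_deriv i \<phi> x * c x) *\<^sub>R u x)
        = - integral\<^sup>L lebesgue (\<lambda>x. (\<phi> x * c x) *\<^sub>R g x)"
      by (subst (asm) Bochner_Integration.integral_add[OF integrable_test_function[OF \<phi>dc li(1)]
            integrable_test_function[OF d\<phi>c li(1)]])
    then show "integral\<^sup>L lebesgue (\<lambda>x. partial_deriv i \<phi> x *\<^sub>R c x *\<^sub>R u x)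
        = - integral\<^sup>L lebesgue (\<lambda>x. \<phi> x *\<^sub>R (partial_deriv i c x *\<^sub>R u x + c x *\<^sub>R g x))"
      using Bochner_Integration.integral_add[OF integrable_test_function[OF \<phi>dc li(1)]
          integrable_test_function[OF \<phi>c li(2)]]
      by (simp add: scaleR_add_right algebra_simps)
  qed
qed

text \<open>The terms of the Leibniz formula are kept in a list, so that no sum over multi-indices has to be
  reindexed in the induction step.\<close>

lemma weak_Leibniz:
  fixes \<alpha> :: "'n::{finite,linorder} \<Rightarrow> nat"
  assumes \<eta>: "\<eta> \<in> test_functions K"
  shows "\<exists>L. (\<forall>c \<beta>. (c, \<beta>) \<in> set L \<longrightarrow> c \<in> test_functions K \<and> multi_order \<beta> \<le> multi_order \<alpha>) \<and>
    (\<forall>S u (g :: _ \<Rightarrow> _ \<Rightarrow> 'b::euclidean_space). K \<subseteq> S \<longrightarrow>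
      (\<forall>\<beta>. multi_order \<beta> \<le> multi_order \<alpha> \<longrightarrow> has_weak_deriv S \<beta> u (g \<beta>)) \<longrightarrow>
      has_weak_deriv UNIV \<alpha> (\<lambda>x. \<eta> x *\<^sub>R u x) (\<lambda>x. \<Sum>(c, \<beta>)\<leftarrow>L. c x *\<^sub>R g \<beta> x))"
proof (induction \<alpha> rule: multi_order_induct)
  case zero
  have "has_weak_deriv UNIV (\<lambda>_. 0) (\<lambda>x. \<eta> x *\<^sub>R u x) (\<lambda>x. \<eta> x *\<^sub>R g x)"
    if "K \<subseteq> S" "has_weak_deriv S (\<lambda>_. 0) u g" for S and u g :: "'n rvec \<Rightarrow> 'b"
    unfolding has_weak_deriv_iff
  proof (intro conjI ballI)
    have \<eta>S: "\<eta> \<in> test_functions S" using \<eta> that(1) test_functions_mono by blast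
    show "locally_integrable_on (\<lambda>x. \<eta> x *\<^sub>R u x) UNIV" "locally_integrable_on (\<lambda>x. \<eta> x *\<^sub>R g x) UNIV"
      using \<eta>S that(2) by (auto simp: has_weak_deriv_iff intro: locally_integrable_test_function)
    fix \<phi> :: "'n rvec \<Rightarrow> real" assume "\<phi> \<in> test_functions UNIV"
    then have "(\<lambda>x. \<phi> x * \<eta> x) \<in> test_functions S"
      using \<eta>S test_functions_mult test_functions_smooth by blast
    then show "integral\<^sup>L lebesgue (\<lambda>x. multi_deriv (\<lambda>_. 0) \<phi> x *\<^sub>R \<eta> x *\<^sub>R u x) =
        (- 1) ^ multi_order (\<lambda>_::'n. 0) *\<^sub>R integral\<^sup>L lebesgue (\<lambda>x. \<phi> x *\<^sub>R \<eta> x *\<^sub>R g x)"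
      using that(2) by (simp add: has_weak_deriv_iff)
  qed
  then show ?case
    using \<eta> by (intro exI[of _ "[(\<eta>, \<lambda>_. 0)]"]) auto
next
  case (Suc \<alpha> i)
  let ?\<alpha> = "\<alpha>(i := Suc (\<alpha> i))"
  obtain L where L1: "\<forall>c \<beta>. (c, \<beta>) \<in> set L \<longrightarrow> c \<in> test_functions K \<and> multi_order \<beta> \<le> multi_order \<alpha>"
    and D1: "\<forall>S u (g :: _ \<Rightarrow> _ \<Rightarrow> 'b). K \<subseteq> S \<longrightarrow>
      (\<forall>\<beta>. multi_order \<beta> \<le> multi_order \<alpha> \<longrightarrow> has_weak_deriv S \<beta> u (g \<beta>)) \<longrightarrow>
      has_weak_deriv UNIV \<alpha> (\<lambda>x. \<eta> x *\<^sub>R u x) (\<lambda>x. \<Sum>(c, \<beta>)\<leftarrow>L. c x *\<^sub>R g \<beta> x)"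
    using Suc by (elim exE conjE) (rule that)
  note L = L1[rule_format] and D = D1[rule_format]
  \<comment> \<open>Each term splits in two by the product rule. Equal multi-indices are never
    collected, so binomial coefficients appear only as repeated entries.\<close>
  define L' where "L' = concat (map (\<lambda>(c, \<beta>). [(partial_deriv i c, \<beta>), (c, \<beta>(i := Suc (\<beta> i)))]) L)"
  have sum_L': "(\<Sum>(c, \<beta>)\<leftarrow>L'. c x *\<^sub>R g \<beta> x)
      = (\<Sum>(c, \<beta>)\<leftarrow>L. partial_deriv i c x *\<^sub>R g \<beta> x + c x *\<^sub>R g (\<beta>(i := Suc (\<beta> i))) x)"
    for x and g :: "_ \<Rightarrow> _ \<Rightarrow> 'b"
    unfolding L'_def by (induction L) (auto simp: add.assoc)
  have coeff: "c \<in> test_functions K \<and> multi_order \<beta> \<le> multi_order ?\<alpha>" if cL: "(c, \<beta>) \<in> set L'" for c \<beta>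
  proof -
    obtain l where l: "l \<in> set L"
      "(c, \<beta>) \<in> set (case l of (c, \<beta>) \<Rightarrow> [(partial_deriv i c, \<beta>), (c, \<beta>(i := Suc (\<beta> i)))])"
      using cL unfolding L'_def set_concat set_map by blast
    obtain c' \<beta>' where "l = (c', \<beta>')" by (cases l)
    with l have l: "(c', \<beta>') \<in> set L"
      "(c, \<beta>) = (partial_deriv i c', \<beta>') \<or> (c, \<beta>) = (c', \<beta>'(i := Suc (\<beta>' i)))"
      by simp_all
    show ?thesis
      using l(2) L[OF l(1)] by (auto simp: multi_order_Suc test_functions_partial_deriv)
  qed
  have deriv: "has_weak_deriv UNIV ?\<alpha> (\<lambda>x. \<eta> x *\<^sub>R u x) (\<lambda>x. \<Sum>(c, \<beta>)\<leftarrow>L'. c x *\<^sub>R g \<beta> x)"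
    if S: "K \<subseteq> S" and g: "\<And>\<beta>. multi_order \<beta> \<le> multi_order ?\<alpha> \<Longrightarrow> has_weak_deriv S \<beta> u (g \<beta>)"
    for S u and g :: "_ \<Rightarrow> _ \<Rightarrow> 'b"
  proof (rule has_weak_deriv_Suc)
    show "has_weak_deriv UNIV \<alpha> (\<lambda>x. \<eta> x *\<^sub>R u x) (\<lambda>x. \<Sum>(c, \<beta>)\<leftarrow>L. c x *\<^sub>R g \<beta> x)"
      using D[OF S] g by (simp add: multi_order_Suc)
    have "has_weak_deriv UNIV (unit_index i) (\<lambda>x. c x *\<^sub>R g \<beta> x)
        (\<lambda>x. partial_deriv i c x *\<^sub>R g \<beta> x + c x *\<^sub>R g (\<beta>(i := Suc (\<beta> i))) x)"
      if "(c, \<beta>) \<in> set L" for c \<beta>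
    proof (rule has_weak_deriv_test_function_mult)
      show "c \<in> test_functions S" using L[OF that] S test_functions_mono by blast
      show "has_weak_deriv S (unit_index i) (g \<beta>) (g (\<beta>(i := Suc (\<beta> i))))"
        using L[OF that] by (intro has_weak_deriv_Suc_imp_unit[where \<alpha> = \<beta> and u = u] g) (auto simp: multi_order_Suc)
    qed
    then have "has_weak_deriv UNIV (unit_index i) (\<lambda>x. \<Sum>(c, \<beta>)\<leftarrow>L. c x *\<^sub>R g \<beta> x)
        (\<lambda>x. \<Sum>(c, \<beta>)\<leftarrow>L. partial_deriv i c x *\<^sub>R g \<beta> x + c x *\<^sub>R g (\<beta>(i := Suc (\<beta> i))) x)"
      unfolding split_beta by (intro has_weak_deriv_sum_list) auto
    then show "has_weak_deriv UNIV (unit_index i) (\<lambda>x. \<Sum>(c, \<beta>)\<leftarrow>L. c x *\<^sub>R g \<beta> x)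
        (\<lambda>x. \<Sum>(c, \<beta>)\<leftarrow>L'. c x *\<^sub>R g \<beta> x)"
      by (simp add: sum_L')
  qed
  show ?case
    by (rule exI[of _ L'], rule conjI; intro allI impI; (rule coeff | rule deriv); blast)
qed

text \<open>The sum is at most the number of terms times the largest one, and the p-th power of the
  largest is itself one of the summands on the right.\<close>

lemma powr_sum_le:
  fixes f :: "'i \<Rightarrow> real"
  assumes "finite I" "\<And>i. i \<in> I \<Longrightarrow> 0 \<le> f i" "0 \<le> p"
  shows "(\<Sum>i\<in>I. f i) powr p \<le> real (card I) powr p * (\<Sum>i\<in>I. f i powr p)"
proof (cases "I = {}")
  case False
  define M where "M = Max (f ` I)"
  have "M \<in> f ` I" using assms(1) False by (simp add: M_def)
  then obtain j where j: "j \<in> I" "M = f j" by blast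
  have "f i \<le> M" if "i \<in> I" for i using assms(1) that by (simp add: M_def)
  then have "(\<Sum>i\<in>I. f i) \<le> real (card I) * M"
    using sum_bounded_above[of I f M] by simp
  then have "(\<Sum>i\<in>I. f i) powr p \<le> (real (card I) * M) powr p"
    using assms by (intro powr_mono2) (auto intro: sum_nonneg)
  also have "\<dots> = real (card I) powr p * f j powr p"
    using assms j by (simp add: powr_mult)
  also have "\<dots> \<le> real (card I) powr p * (\<Sum>i\<in>I. f i powr p)"
    using assms j by (intro mult_left_mono member_le_sum) auto
  finally show ?thesis .
qed simp

text \<open>The terms of the Leibniz formula depend on \<eta> and \<alpha> alone, and their
  coefficients are bounded and vanish off K. The order of the quantifiers is the point: one C serves
  all S, u, g and \<alpha>, hence later all cubes.\<close>

lemma weak_deriv_cutoff_bound: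
  fixes \<eta> :: "'n::{finite,linorder} rvec \<Rightarrow> real"
  assumes \<eta>: "\<eta> \<in> test_functions K" and "0 \<le> p"
  shows "\<exists>C\<ge>0. \<forall>S u (g :: _ \<Rightarrow> _ \<Rightarrow> 'b::euclidean_space) \<alpha>. K \<subseteq> S \<longrightarrow> multi_order \<alpha> \<le> m \<longrightarrow>
      (\<forall>\<beta>. multi_order \<beta> \<le> m \<longrightarrow> has_weak_deriv S \<beta> u (g \<beta>)) \<longrightarrow>
      (\<exists>G. has_weak_deriv UNIV \<alpha> (\<lambda>x. \<eta> x *\<^sub>R u x) G \<and>
        (\<forall>x. norm (G x) powr p \<le> C * (indicator K x * (\<Sum>\<beta> | multi_order \<beta> \<le> m. norm (g \<beta> x) powr p))))"
proof -
  let ?I = "{\<beta> :: 'n \<Rightarrow> nat. multi_order \<beta> \<le> m}"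
  define Q where "Q C \<alpha> \<longleftrightarrow> C \<ge> 0 \<and> (\<forall>S u (g :: _ \<Rightarrow> _ \<Rightarrow> 'b). K \<subseteq> S \<longrightarrow>
      (\<forall>\<beta>. multi_order \<beta> \<le> m \<longrightarrow> has_weak_deriv S \<beta> u (g \<beta>)) \<longrightarrow>
      (\<exists>G. has_weak_deriv UNIV \<alpha> (\<lambda>x. \<eta> x *\<^sub>R u x) G \<and>
        (\<forall>x. norm (G x) powr p \<le> C * (indicator K x * (\<Sum>\<beta>\<in>?I. norm (g \<beta> x) powr p)))))"
    for C \<alpha>
  have "\<exists>C. Q C \<alpha>" if \<alpha>: "multi_order \<alpha> \<le> m" for \<alpha>
  proof -
    obtain L where L1: "\<forall>c \<beta>. (c, \<beta>) \<in> set L \<longrightarrow> c \<in> test_functions K \<and> multi_order \<beta> \<le> multi_order \<alpha>"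
      and D1: "\<forall>S u (g :: _ \<Rightarrow> _ \<Rightarrow> 'b). K \<subseteq> S \<longrightarrow>
        (\<forall>\<beta>. multi_order \<beta> \<le> multi_order \<alpha> \<longrightarrow> has_weak_deriv S \<beta> u (g \<beta>)) \<longrightarrow>
        has_weak_deriv UNIV \<alpha> (\<lambda>x. \<eta> x *\<^sub>R u x) (\<lambda>x. \<Sum>(c, \<beta>)\<leftarrow>L. c x *\<^sub>R g \<beta> x)"
      using weak_Leibniz[OF \<eta>, of \<alpha>, where 'b = 'b] by (elim exE conjE) (rule that)
    note L = L1[rule_format] and D = D1[rule_format]
    have "\<exists>B\<ge>0. \<forall>x (g :: _ \<Rightarrow> _ \<Rightarrow> 'b). norm (\<Sum>(c, \<beta>)\<leftarrow>L. c x *\<^sub>R g \<beta> x)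
        \<le> B * (indicator K x * (\<Sum>\<beta>\<in>?I. norm (g \<beta> x)))"
      using L
    proof (induction L)
      case Nil
      then show ?case by (auto intro!: exI[of _ 0])
    next
      case (Cons l L)
      obtain c \<beta> where l: "l = (c, \<beta>)" by (cases l)
      have c: "c \<in> test_functions K" and \<beta>: "\<beta> \<in> ?I"
        using Cons.prems[of c \<beta>] \<alpha> by (auto simp: l)
      obtain B where B: "B \<ge> 0" "\<And>x (g :: _ \<Rightarrow> _ \<Rightarrow> 'b). norm (\<Sum>(c, \<beta>)\<leftarrow>L. c x *\<^sub>R g \<beta> x)
        \<le> B * (indicator K x * (\<Sum>\<beta>\<in>?I. norm (g \<beta> x)))"
        using Cons by (meson list.set_intros(2))
      obtain C where C: "C \<ge> 0" "\<And>x. \<bar>c x\<bar> \<le> C" using test_functions_bounded[OF c] by blast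
      have "norm (\<Sum>(c, \<beta>)\<leftarrow>l # L. c x *\<^sub>R g \<beta> x)
          \<le> (C + B) * (indicator K x * (\<Sum>\<beta>\<in>?I. norm (g \<beta> x)))" for x and g :: "_ \<Rightarrow> _ \<Rightarrow> 'b"
      proof -
        \<comment> \<open>The coefficient vanishes off K, so the indicator can be inserted without
          loss.\<close>
        have "norm (c x *\<^sub>R g \<beta> x) = indicator K x * (\<bar>c x\<bar> * norm (g \<beta> x))"
          using test_functions_outside[OF c] by (auto simp: indicator_def)
        also have "\<dots> \<le> indicator K x * (C * (\<Sum>\<beta>\<in>?I. norm (g \<beta> x)))"
          using C \<beta> finite_multi_order
          by (intro mult_left_mono mult_mono member_le_sum[where f = "\<lambda>\<beta>. norm (g \<beta> x)"]) auto
        finally show ?thesis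
          using norm_triangle_ineq[of "c x *\<^sub>R g \<beta> x" "\<Sum>(c, \<beta>)\<leftarrow>L. c x *\<^sub>R g \<beta> x"] B(2)[of x g]
          by (simp add: l algebra_simps)
      qed
      then show ?case
        using B C by (intro exI[of _ "C + B"]) auto
    qed
    then obtain B where B: "B \<ge> 0" "\<And>x (g :: _ \<Rightarrow> _ \<Rightarrow> 'b). norm (\<Sum>(c, \<beta>)\<leftarrow>L. c x *\<^sub>R g \<beta> x)
        \<le> B * (indicator K x * (\<Sum>\<beta>\<in>?I. norm (g \<beta> x)))"
      by blast
    have "norm (\<Sum>(c, \<beta>)\<leftarrow>L. c x *\<^sub>R g \<beta> x) powr p
        \<le> (B powr p * real (card ?I) powr p) * (indicator K x * (\<Sum>\<beta>\<in>?I. norm (g \<beta> x) powr p))"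
      for x and g :: "_ \<Rightarrow> _ \<Rightarrow> 'b"
    proof (cases "x \<in> K")
      case True
      have "norm (\<Sum>(c, \<beta>)\<leftarrow>L. c x *\<^sub>R g \<beta> x) powr p \<le> (B * (\<Sum>\<beta>\<in>?I. norm (g \<beta> x))) powr p"
        using B(2)[of x g] True \<open>0 \<le> p\<close> by (intro powr_mono2) auto
      also have "\<dots> = B powr p * (\<Sum>\<beta>\<in>?I. norm (g \<beta> x)) powr p"
        using B(1) by (simp add: powr_mult sum_nonneg)
      also have "\<dots> \<le> B powr p * (real (card ?I) powr p * (\<Sum>\<beta>\<in>?I. norm (g \<beta> x) powr p))"
        using \<open>0 \<le> p\<close> by (intro mult_left_mono powr_sum_le finite_multi_order) auto
      finally show ?thesis using True by simp
    next
      case False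
      then show ?thesis using B(2)[of x g] by simp
    qed
    moreover have "has_weak_deriv UNIV \<alpha> (\<lambda>x. \<eta> x *\<^sub>R u x) (\<lambda>x. \<Sum>(c, \<beta>)\<leftarrow>L. c x *\<^sub>R g \<beta> x)"
      if "K \<subseteq> S" "\<And>\<beta>. multi_order \<beta> \<le> m \<Longrightarrow> has_weak_deriv S \<beta> u (g \<beta>)"
      for S u and g :: "_ \<Rightarrow> _ \<Rightarrow> 'b"
      using D[OF that(1), of u g] that(2) \<alpha> by auto
    ultimately have "Q (B powr p * real (card ?I) powr p) \<alpha>"
      unfolding Q_def by (intro conjI) (simp, blast)
    then show ?thesis ..
  qed
  then obtain C where C: "\<And>\<alpha>. multi_order \<alpha> \<le> m \<Longrightarrow> Q (C \<alpha>) \<alpha>"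
    by metis
  show ?thesis
  \<comment> \<open>The finitely many constants are nonnegative, so their sum dominates each of
    them.\<close>
  proof (intro exI[of _ "\<Sum>\<alpha>\<in>?I. C \<alpha>"] conjI allI impI)
    show "0 \<le> (\<Sum>\<alpha>\<in>?I. C \<alpha>)" using C by (intro sum_nonneg) (auto simp: Q_def)
    fix S u and g :: "_ \<Rightarrow> _ \<Rightarrow> 'b" and \<alpha> :: "'n \<Rightarrow> nat"
    assume *: "K \<subseteq> S" "multi_order \<alpha> \<le> m" "\<forall>\<beta>. multi_order \<beta> \<le> m \<longrightarrow> has_weak_deriv S \<beta> u (g \<beta>)"
    then obtain G where G: "has_weak_deriv UNIV \<alpha> (\<lambda>x. \<eta> x *\<^sub>R u x) G"
      "\<And>x. norm (G x) powr p \<le> C \<alpha> * (indicator K x * (\<Sum>\<beta>\<in>?I. norm (g \<beta> x) powr p))"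
      using C[OF *(2)] unfolding Q_def by blast
    have "C \<alpha> \<le> (\<Sum>\<alpha>\<in>?I. C \<alpha>)"
      using C *(2) by (intro member_le_sum finite_multi_order) (auto simp: Q_def)
    then have "norm (G x) powr p \<le> (\<Sum>\<alpha>\<in>?I. C \<alpha>) * (indicator K x * (\<Sum>\<beta>\<in>?I. norm (g \<beta> x) powr p))" for x
      by (intro order_trans[OF G(2)] mult_right_mono mult_nonneg_nonneg sum_nonneg) auto
    with G(1) show "\<exists>G. has_weak_deriv UNIV \<alpha> (\<lambda>x. \<eta> x *\<^sub>R u x) G \<and> (\<forall>x. norm (G x) powr p
        \<le> (\<Sum>\<alpha>\<in>?I. C \<alpha>) * (indicator K x * (\<Sum>\<beta>\<in>?I. norm (g \<beta> x) powr p)))"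
      by blast
  qed
qed

subsection \<open>Uniqueness of weak derivatives\<close>

text \<open>Lebesgue differentiation: off a negligible set, f x is the limit of the averages of f
  over small cubes with corner x, and all these averages vanish.\<close>

lemma AE_zero_if_box_integrals_zero:
  fixes f :: "'a::euclidean_space \<Rightarrow> 'b::euclidean_space"
  assumes f: "integrable lebesgue f"
    and zero: "\<And>a b. integral\<^sup>L lebesgue (\<lambda>x. indicator (box a b) x *\<^sub>R f x) = 0"
  shows "AE x in lebesgue. f x = 0"
proof -
  have set: "set_integrable lebesgue A f" if "A \<in> sets lebesgue" for A
    unfolding set_integrable_def using f that by (rule integrable_mult_indicator[rotated])
  have "f integrable_on cbox a b" for a b
    by (rule set_lebesgue_integral_eq_integral(1)[OF set]) simp
  then obtain N where N: "negligible N" "\<And>x e. x \<notin> N \<Longrightarrow> 0 < e \<Longrightarrow>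
      \<exists>d>0. \<forall>h. 0 < h \<and> h < d \<longrightarrow> norm (integral (cbox x (x + h *\<^sub>R One)) f /\<^sub>R h ^ DIM('a) - f x) < e"
    using integrable_ccontinuous_explicit[of f] by metis
  have int0: "integral (cbox a b) f = 0" for a b
    using set_lebesgue_integral_eq_integral(2)[OF set[of "box a b"]] zero[of a b]
    by (simp add: integral_open_interval set_lebesgue_integral_def)
  have "f x = 0" if x: "x \<notin> N" for x
  proof (rule ccontr)
    assume "f x \<noteq> 0"
    then obtain d where "d > 0" "\<forall>h. 0 < h \<and> h < d \<longrightarrow>
        norm (integral (cbox x (x + h *\<^sub>R One)) f /\<^sub>R h ^ DIM('a) - f x) < norm (f x)"
      using N(2)[OF x, of "norm (f x)"] by auto
    then show False
      by (auto simp: int0 dest!: spec[of _ "d / 2"])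
  qed
  then show ?thesis
    using N(1) by (intro AE_I'[of N]) (auto simp: negligible_iff_null_sets)
qed

text \<open>Products of box bumps converge to indicators of boxes, so dominated convergence turns
  orthogonality to test functions into vanishing integrals over boxes. Countably many closed boxes
  exhaust S.\<close>

lemma fundamental_lemma_calculus_of_variations:
  fixes g :: "'n::finite rvec \<Rightarrow> 'b::euclidean_space"
  assumes "open S" and g: "locally_integrable_on g S"
    and zero: "\<And>\<phi>. \<phi> \<in> test_functions S \<Longrightarrow> integral\<^sup>L lebesgue (\<lambda>x. \<phi> x *\<^sub>R g x) = 0"
  shows "AE x in lebesgue. x \<in> S \<longrightarrow> g x = 0"
proof -
  have cbox: "AE x in lebesgue. x \<in> cbox a b \<longrightarrow> g x = 0" if "cbox a b \<subseteq> S" for a b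
  proof -
    let ?f = "\<lambda>x. indicat_real (box a b) x *\<^sub>R g x"
    have int: "integrable lebesgue (\<lambda>x. indicat_real (cbox a b) x *\<^sub>R g x)"
      using g that by (simp add: locally_integrable_on_def set_integrable_def)
    have intf: "integrable lebesgue ?f"
    proof -
      have "?f = (\<lambda>x. indicat_real (box a b) x *\<^sub>R (indicat_real (cbox a b) x *\<^sub>R g x))"
        using box_subset_cbox[of a b] by (auto simp: fun_eq_iff indicator_def)
      then show ?thesis
        using integrable_mult_indicator[OF _ int, of "box a b"] by simp
    qed
    have "AE x in lebesgue. ?f x = 0"
    proof (rule AE_zero_if_box_integrals_zero[OF intf])
      fix c d
      \<comment> \<open>The box from c to d is arbitrary and may leave S; the second factor keeps
        the support inside \<open>cbox a b\<close>, hence in S.\<close>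
      let ?\<phi> = "\<lambda>k x. box_bump (real k) c d x * box_bump (real k) a b x"
      have \<phi>: "?\<phi> k \<in> test_functions S" for k
      proof (rule test_functions_mult[OF _ smooth_box_bump])
        show "box_bump (real k) a b \<in> test_functions S"
          using box_bump_eq_0[of "real k" _ a b] box_subset_cbox[of a b] that
          by (intro test_functionsI[where K = "cbox a b"] smooth_box_bump) auto
      qed
      have "(\<lambda>k. integral\<^sup>L lebesgue (\<lambda>x. ?\<phi> k x *\<^sub>R g x))
          \<longlonglongrightarrow> integral\<^sup>L lebesgue (\<lambda>x. indicator (box c d) x *\<^sub>R ?f x)"
      proof (rule integral_dominated_convergence)
        show "(\<lambda>x. indicator (box c d) x *\<^sub>R ?f x) \<in> borel_measurable lebesgue"
          using integrable_mult_indicator[OF _ intf, of "box c d"] by simp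
        show "integrable lebesgue (\<lambda>x. norm (indicat_real (cbox a b) x *\<^sub>R g x))"
          using int by (rule integrable_norm)
        show "(\<lambda>x. ?\<phi> k x *\<^sub>R g x) \<in> borel_measurable lebesgue" for k
          using integrable_test_function[OF \<phi> g] by (rule borel_measurable_integrable)
        show "AE x in lebesgue. (\<lambda>k. ?\<phi> k x *\<^sub>R g x) \<longlonglongrightarrow> indicator (box c d) x *\<^sub>R ?f x"
        proof (rule AE_I2)
          fix x
          have "(\<lambda>k. ?\<phi> k x *\<^sub>R g x) \<longlonglongrightarrow> (indicator (box c d) x * indicator (box a b) x) *\<^sub>R g x"
            by (intro tendsto_intros box_bump_tendsto)
          then show "(\<lambda>k. ?\<phi> k x *\<^sub>R g x) \<longlonglongrightarrow> indicator (box c d) x *\<^sub>R ?f x" by simp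
        qed
        show "AE x in lebesgue. norm (?\<phi> k x *\<^sub>R g x) \<le> norm (indicat_real (cbox a b) x *\<^sub>R g x)" for k
        proof (rule AE_I2)
          fix x
          have "\<bar>?\<phi> k x\<bar> \<le> indicator (cbox a b) x"
            using box_bump_range[of "real k" c d x] box_bump_range[of "real k" a b x]
              box_bump_eq_0[of "real k" x a b] box_subset_cbox[of a b]
            by (cases "x \<in> box a b"; cases "x \<in> cbox a b") (auto simp: abs_mult intro!: mult_le_one)
          then show "norm (?\<phi> k x *\<^sub>R g x) \<le> norm (indicat_real (cbox a b) x *\<^sub>R g x)"
            by (simp add: mult_right_mono)
        qed
      qed
      then show "integral\<^sup>L lebesgue (\<lambda>x. indicator (box c d) x *\<^sub>R ?f x) = 0"
        using zero[OF \<phi>] by (simp add: LIMSEQ_const_iff)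
    qed
    \<comment> \<open>So far only the open box is reached; its boundary is negligible.\<close>
    moreover have "AE x in lebesgue. x \<notin> cbox a b - box a b"
      using negligible_frontier_interval[of a b] by (intro AE_not_in) (simp add: negligible_iff_null_sets)
    ultimately show ?thesis
      by eventually_elim (auto simp: indicator_def split: if_splits)
  qed
  obtain \<D> where \<D>: "countable \<D>" "\<D> \<subseteq> Pow S" "\<And>X. X \<in> \<D> \<Longrightarrow> \<exists>a b. X = cbox a b" "\<Union>\<D> = S"
    using open_countable_Union_open_cbox[OF \<open>open S\<close>] by blast
  have "AE x in lebesgue. \<forall>X\<in>\<D>. x \<in> X \<longrightarrow> g x = 0"
  proof (rule AE_ball_countable'[OF _ \<D>(1)])
    fix X assume X: "X \<in> \<D>"
    then obtain a b where "X = cbox a b" using \<D>(3) by blast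
    then show "AE x in lebesgue. x \<in> X \<longrightarrow> g x = 0"
      using cbox[of a b] \<D>(2) X by auto
  qed
  then show ?thesis
    unfolding \<D>(4)[symmetric] by eventually_elim auto
qed

lemma weak_deriv_unique_AE:
  assumes "open S" "has_weak_deriv S \<alpha> u g" "has_weak_deriv S \<alpha> u h"
  shows "AE x in lebesgue. x \<in> S \<longrightarrow> g x = h x"
proof -
  have li: "locally_integrable_on g S" "locally_integrable_on h S"
    using assms by (auto simp: has_weak_deriv_iff)
  have "AE x in lebesgue. x \<in> S \<longrightarrow> g x - h x = 0"
  proof (rule fundamental_lemma_calculus_of_variations)
    fix \<phi> :: "'a rvec \<Rightarrow> real" assume \<phi>: "\<phi> \<in> test_functions S"
    have "(- 1) ^ multi_order \<alpha> *\<^sub>R integral\<^sup>L lebesgue (\<lambda>x. \<phi> x *\<^sub>R g x)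
        = (- 1) ^ multi_order \<alpha> *\<^sub>R integral\<^sup>L lebesgue (\<lambda>x. \<phi> x *\<^sub>R h x)"
      using assms(2,3) \<phi> by (simp add: has_weak_deriv_iff)
    then have "integral\<^sup>L lebesgue (\<lambda>x. \<phi> x *\<^sub>R g x) = integral\<^sup>L lebesgue (\<lambda>x. \<phi> x *\<^sub>R h x)"
      by simp
    then show "integral\<^sup>L lebesgue (\<lambda>x. \<phi> x *\<^sub>R (g x - h x)) = 0"
      by (simp add: scaleR_diff_right Bochner_Integration.integral_diff[OF
            integrable_test_function[OF \<phi> li(1)] integrable_test_function[OF \<phi> li(2)]])
  qed (use assms(1) li in \<open>auto intro: locally_integrable_on_diff\<close>)
  then show ?thesis by simp
qed

subsection \<open>Gluing weak derivatives\<close>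

lemma locally_integrable_on_AE:
  assumes "locally_integrable_on h S" "AE x in lebesgue. x \<in> S \<longrightarrow> g x = h x"
  shows "locally_integrable_on g S"
proof -
  obtain N where N: "N \<in> null_sets lebesgue" "\<And>x. x \<notin> N \<Longrightarrow> x \<in> S \<Longrightarrow> g x = h x"
    using assms(2) unfolding completion.AE_iff_null_sets by auto
  show ?thesis
    unfolding locally_integrable_on_def
  proof (intro allI impI)
    fix K assume K: "compact K" "K \<subseteq> S"
    have "set_integrable lebesgue K h"
      using assms(1) K by (simp add: locally_integrable_on_def)
    then show "set_integrable lebesgue K g"
    proof (rule absolutely_integrable_spike)
      show "negligible N" using N(1) by (simp add: negligible_iff_null_sets)
      show "g x = h x" if "x \<in> K - N" for x using that N(2) K(2) by blast
    qed
  qed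
qed

lemma has_weak_deriv_AE:
  assumes "has_weak_deriv S \<alpha> u h" "AE x in lebesgue. x \<in> S \<longrightarrow> g x = h x"
  shows "has_weak_deriv S \<alpha> u g"
proof -
  have li: "locally_integrable_on h S" "locally_integrable_on g S"
    using assms locally_integrable_on_AE by (auto simp: has_weak_deriv_iff)
  have "integral\<^sup>L lebesgue (\<lambda>x. \<phi> x *\<^sub>R g x) = integral\<^sup>L lebesgue (\<lambda>x. \<phi> x *\<^sub>R h x)"
    if \<phi>: "\<phi> \<in> test_functions S" for \<phi>
  proof (rule integral_cong_AE)
    show "AE x in lebesgue. \<phi> x *\<^sub>R g x = \<phi> x *\<^sub>R h x"
      using assms(2) by eventually_elim (use test_functions_outside[OF \<phi>] in force)
  qed (use borel_measurable_integrable[OF integrable_test_function[OF \<phi>]] li in blast)+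
  with assms(1) li show ?thesis
    by (simp add: has_weak_deriv_iff)
qed

text \<open>Finitely many of the open sets cover a given compact subset of S, which therefore lies
  in a finite union of the compact sets, and u is integrable on each of these.\<close>

lemma locally_integrable_on_glue:
  assumes "\<And>i. i \<in> I \<Longrightarrow> open (B i)" "\<And>i. i \<in> I \<Longrightarrow> compact (K i)" "\<And>i. i \<in> I \<Longrightarrow> B i \<subseteq> K i"
    "S \<subseteq> (\<Union>i\<in>I. B i)" "\<And>i. i \<in> I \<Longrightarrow> locally_integrable_on u (K i)"
  shows "locally_integrable_on u S"
  unfolding locally_integrable_on_def
proof (intro allI impI)
  fix L assume L: "compact L" "L \<subseteq> S"
  obtain J where J: "J \<subseteq> I" "finite J" "L \<subseteq> (\<Union>i\<in>J. B i)"
    using compactE_image[OF L(1), of I B] assms(1,4) L(2) by (metis order_trans)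
  have sets: "C \<in> sets lebesgue" if "compact C" for C :: "_ rvec set"
    using that by (simp add: fmeasurableD lmeasurable_compact)
  have "set_integrable lebesgue (\<Union>i\<in>J. K i) u"
    using J assms(2,5) by (intro set_integrable_UN) (auto simp: locally_integrable_on_def intro!: sets)
  moreover have "L \<subseteq> (\<Union>i\<in>J. K i)"
    using J(1,3) assms(3) by (intro order_trans[OF J(3)] UN_mono) auto
  ultimately show "set_integrable lebesgue L u"
    using set_integrable_subset[OF _ sets[OF L(1)]] by blast
qed

lemma multi_deriv_zero: "multi_deriv \<alpha> (\<lambda>_. 0) = (\<lambda>_. 0)"
proof -
  have "iterated_partial_deriv is (\<lambda>_. 0) = (\<lambda>_::'a rvec. 0)" for "is"
    by (induction "is") (simp_all add: iterated_partial_deriv_Cons)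
  then show ?thesis by (simp add: multi_deriv_def)
qed

text \<open>A test function of S meets only finitely many of the sets needed to cover its support.
  Bumps are split off one at a time, each time leaving a remainder that vanishes on one more of the
  sets \<open>B i\<close>; no normalised partition of unity has to be built.\<close>

lemma has_weak_deriv_glue:
  fixes w g :: "'n::{finite,linorder} rvec \<Rightarrow> 'b::euclidean_space"
  assumes U: "\<And>i. i \<in> I \<Longrightarrow> U i \<subseteq> S" and \<psi>: "\<And>i. i \<in> I \<Longrightarrow> \<psi> i \<in> test_functions (U i)"
    and B: "\<And>i. i \<in> I \<Longrightarrow> open (B i)" "\<And>i x. i \<in> I \<Longrightarrow> x \<in> B i \<Longrightarrow> \<psi> i x = 1" "S \<subseteq> (\<Union>i\<in>I. B i)"
    and g: "\<And>i. i \<in> I \<Longrightarrow> has_weak_deriv (U i) \<alpha> w g"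
  shows "has_weak_deriv S \<alpha> w g"
  unfolding has_weak_deriv_iff
proof (intro conjI ballI)
  let ?K = "\<lambda>i. closure {x. \<psi> i x \<noteq> 0}"
  have K: "compact (?K i)" "?K i \<subseteq> U i" if "i \<in> I" for i
    using \<psi>[OF that] by (auto simp: test_functions_def)
  have BK: "B i \<subseteq> ?K i" if "i \<in> I" for i
    using B(2)[OF that] closure_subset[of "{x. \<psi> i x \<noteq> 0}"] by force
  have liK: "locally_integrable_on w (?K i)" "locally_integrable_on g (?K i)" if "i \<in> I" for i
    using g[OF that] K(2)[OF that] locally_integrable_on_subset unfolding has_weak_deriv_iff by blast+
  show liw: "locally_integrable_on w S"
    by (rule locally_integrable_on_glue[OF B(1) K(1) BK B(3) liK(1)])
  show lig: "locally_integrable_on g S"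
    by (rule locally_integrable_on_glue[OF B(1) K(1) BK B(3) liK(2)])
  note li = liw lig
  let ?P = "\<lambda>\<phi>. integral\<^sup>L lebesgue (\<lambda>x. multi_deriv \<alpha> \<phi> x *\<^sub>R w x)
      = (- 1) ^ multi_order \<alpha> *\<^sub>R integral\<^sup>L lebesgue (\<lambda>x. \<phi> x *\<^sub>R g x)"
  \<comment> \<open>The covering condition concerns the set where \<phi> is nonzero and not its
    closure: this is what survives when a bump is split off.\<close>
  have finite: "?P \<phi>"
    if "finite J" "J \<subseteq> I" "\<phi> \<in> test_functions S" "{x. \<phi> x \<noteq> 0} \<subseteq> (\<Union>i\<in>J. B i)" for J \<phi>
    using that
  proof (induction J arbitrary: \<phi> rule: finite_induct)
    case empty
    then have \<phi>: "\<phi> = (\<lambda>_. 0)" by auto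
    with \<phi> show ?case by (simp add: multi_deriv_zero)
  next
    case (insert j J)
    have j: "j \<in> I" using insert.prems by simp
    \<comment> \<open>The first part is a test function of \<open>U j\<close>; the second vanishes
      on \<open>B j\<close>, where the bump is 1, so the remaining sets cover it.\<close>
    define \<phi>1 where "\<phi>1 = (\<lambda>x. \<phi> x * \<psi> j x)"
    define \<phi>2 where "\<phi>2 = (\<lambda>x. (1 + (-1) * \<psi> j x) * \<phi> x)"
    have s: "smooth \<phi>" "smooth (\<psi> j)"
      using insert.prems(2) \<psi>[OF j] by (auto simp: test_functions_smooth)
    have t1: "\<phi>1 \<in> test_functions (U j)"
      unfolding \<phi>1_def by (intro test_functions_mult \<psi> j s)
    then have t1': "\<phi>1 \<in> test_functions S" using U[OF j] by (rule test_functions_mono)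
    have t2: "\<phi>2 \<in> test_functions S"
      unfolding \<phi>2_def by (intro test_functions_mult insert.prems smooth_add smooth_mult smooth_const s)
    have eq: "\<phi> = (\<lambda>x. \<phi>1 x + \<phi>2 x)" by (simp add: \<phi>1_def \<phi>2_def algebra_simps)
    have "{x. \<phi>2 x \<noteq> 0} \<subseteq> (\<Union>i\<in>J. B i)"
      using insert.prems(3) B(2)[OF j] by (auto simp: \<phi>2_def)
    then have P2: "?P \<phi>2" using insert t2 by simp
    have P1: "?P \<phi>1" using g[OF j] t1 by (simp add: has_weak_deriv_iff)
    have "multi_deriv \<alpha> \<phi> = (\<lambda>x. multi_deriv \<alpha> \<phi>1 x + multi_deriv \<alpha> \<phi>2 x)"
      using t1 t2 by (subst eq) (simp add: multi_deriv_add test_functions_smooth)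
    then show ?case
      using P1 P2 integrable_test_function[OF t1' li(2)] integrable_test_function[OF t2 li(2)]
        integrable_test_function[OF test_functions_multi_deriv[OF t1'] li(1)]
        integrable_test_function[OF test_functions_multi_deriv[OF t2] li(1)]
      by (simp add: eq scaleR_add_left scaleR_add_right)
  qed
  fix \<phi> assume \<phi>: "\<phi> \<in> test_functions S"
  have c: "compact (closure {x. \<phi> x \<noteq> 0})" "closure {x. \<phi> x \<noteq> 0} \<subseteq> (\<Union>i\<in>I. B i)"
    using \<phi> B(3) by (auto simp: test_functions_def)
  obtain J where J: "J \<subseteq> I" "finite J" "closure {x. \<phi> x \<noteq> 0} \<subseteq> (\<Union>i\<in>J. B i)"
    by (rule compactE_image[OF c(1) B(1) c(2)])
  show "?P \<phi>"
    by (rule finite[OF J(2,1) \<phi> order_trans[OF closure_subset J(3)]])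
qed

text \<open>Local derivatives agree almost everywhere on overlaps, and countability of I keeps the
  union of all exceptional sets negligible. Choosing one index per point thus gives a version of
  every local derivative, and measurability is inherited through this agreement.\<close>

lemma weak_deriv_glue:
  fixes w :: "'n::{finite,linorder} rvec \<Rightarrow> 'b::euclidean_space"
  assumes "countable I" and U: "\<And>i. i \<in> I \<Longrightarrow> open (U i)" "\<And>i. i \<in> I \<Longrightarrow> U i \<subseteq> S"
    and \<psi>: "\<And>i. i \<in> I \<Longrightarrow> \<psi> i \<in> test_functions (U i)"
    and B: "\<And>i. i \<in> I \<Longrightarrow> open (B i)" "\<And>i x. i \<in> I \<Longrightarrow> x \<in> B i \<Longrightarrow> \<psi> i x = 1" "S \<subseteq> (\<Union>i\<in>I. B i)"
    and h: "\<And>i. i \<in> I \<Longrightarrow> has_weak_deriv (U i) \<alpha> w (h i)"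
  shows "\<exists>g. has_weak_deriv S \<alpha> w g"
proof -
  have BO: "B i \<subseteq> U i" if "i \<in> I" for i
  proof
    fix x assume "x \<in> B i"
    then show "x \<in> U i"
      using B(2)[OF that] test_functions_outside[OF \<psi>[OF that], of x] by fastforce
  qed
  define pick where "pick x = (SOME i. i \<in> I \<and> x \<in> B i)" for x
  have pick: "pick x \<in> I" "x \<in> B (pick x)" if "x \<in> S" for x
    using that B(3) someI_ex[of "\<lambda>i. i \<in> I \<and> x \<in> B i"] unfolding pick_def by blast+
  have "AE x in lebesgue. x \<in> U i \<inter> U j \<longrightarrow> h i x = h j x" if "i \<in> I" "j \<in> I" for i j
  proof (rule weak_deriv_unique_AE)
    show "open (U i \<inter> U j)" using U that by blast
    show "has_weak_deriv (U i \<inter> U j) \<alpha> w (h i)" "has_weak_deriv (U i \<inter> U j) \<alpha> w (h j)"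
      using that h by (auto intro: has_weak_deriv_subset)
  qed
  then have "AE x in lebesgue. \<forall>i\<in>I. \<forall>j\<in>I. x \<in> U i \<inter> U j \<longrightarrow> h i x = h j x"
    using \<open>countable I\<close> by (intro AE_ball_countable') auto
  then have AE: "AE x in lebesgue. x \<in> U i \<longrightarrow> h (pick x) x = h i x" if "i \<in> I" for i
  proof eventually_elim
    case (elim x)
    then show ?case using that pick[of x] BO U(2) by blast
  qed
  show ?thesis
  proof (intro exI[of _ "\<lambda>x. h (pick x) x"] has_weak_deriv_glue[OF U(2) \<psi> B])
    show "has_weak_deriv (U i) \<alpha> w (\<lambda>x. h (pick x) x)" if "i \<in> I" for i
      by (rule has_weak_deriv_AE[OF h[OF that] AE[OF that]])
  qed
qed

text \<open>Local integrability speaks of compact sets only; writing S as a countable union of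
  closed boxes assembles measurability on all of S. The indicator removes the uncontrolled values
  off S.\<close>

lemma locally_integrable_borel_measurable:
  assumes "open S" "locally_integrable_on g S"
  shows "(\<lambda>x. indicat_real S x *\<^sub>R g x) \<in> borel_measurable lebesgue"
proof -
  obtain \<D> where \<D>: "countable \<D>" "\<D> \<subseteq> Pow S" "\<And>X. X \<in> \<D> \<Longrightarrow> \<exists>a b. X = cbox a b" "\<Union>\<D> = S"
    using open_countable_Union_open_cbox[OF \<open>open S\<close>] by blast
  have S: "S \<in> sets lebesgue" using \<open>open S\<close> by simp
  have "g \<in> borel_measurable (lebesgue_on S)"
  proof (rule measurable_piecewise_restrict[OF \<D>(1)])
    fix X assume X: "X \<in> \<D>"
    then have XS: "X \<subseteq> S" "compact X" "X \<in> sets lebesgue" using \<D>(2,3) by fastforce+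
    then show "X \<inter> space (lebesgue_on S) \<in> sets (lebesgue_on S)"
      using S by (auto simp: sets_restrict_space space_restrict_space)
    have "restrict_space (lebesgue_on S) X = lebesgue_on X"
      using XS S by (simp add: restrict_restrict_space Int_absorb1)
    moreover have "g \<in> borel_measurable (lebesgue_on X)"
      using assms(2) XS borel_measurable_integrable
      unfolding locally_integrable_on_def set_integrable_def
      by (subst borel_measurable_restrict_space_iff) auto
    ultimately show "g \<in> borel_measurable (restrict_space (lebesgue_on S) X)" by simp
  qed (use \<D>(4) in \<open>auto simp: space_restrict_space\<close>)
  then show ?thesis
    using S by (simp add: borel_measurable_restrict_space_iff)
qed

subsection \<open>Dilations\<close>

lemma lebesgue_affine:
  fixes b :: "'a::euclidean_space"
  assumes "r \<noteq> 0"
  shows "lebesgue = density (distr lebesgue lebesgue (\<lambda>x. b + r *\<^sub>R x)) (\<lambda>_. ennreal (\<bar>r\<bar> ^ DIM('a)))"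
    and "(\<lambda>x. b + r *\<^sub>R x) \<in> lebesgue \<rightarrow>\<^sub>M lebesgue"
proof -
  have eq: "(\<lambda>x. b + (\<Sum>j\<in>Basis. (r * (x \<bullet> j)) *\<^sub>R j)) = (\<lambda>x. b + r *\<^sub>R x)"
    unfolding scaleR_scaleR[symmetric] scaleR_sum_right[symmetric] euclidean_representation ..
  show "lebesgue = density (distr lebesgue lebesgue (\<lambda>x. b + r *\<^sub>R x)) (\<lambda>_. ennreal (\<bar>r\<bar> ^ DIM('a)))"
    using lebesgue_affine_euclidean[of "\<lambda>_. r" b] assms unfolding eq by simp
  show "(\<lambda>x. b + r *\<^sub>R x) \<in> lebesgue \<rightarrow>\<^sub>M lebesgue"
    using lebesgue_affine_measurable[of "\<lambda>_. r" b] assms unfolding eq by simp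
qed

lemma nn_integral_lebesgue_affine:
  fixes b :: "'a::euclidean_space"
  assumes "0 < r" and F: "F \<in> borel_measurable lebesgue"
  shows "(\<integral>\<^sup>+y. F (b + r *\<^sub>R y) \<partial>lebesgue) = ennreal (inverse r ^ DIM('a)) * (\<integral>\<^sup>+x. F x \<partial>lebesgue)"
proof -
  note T = lebesgue_affine(2)[of r b]
  have "(\<integral>\<^sup>+x. F x \<partial>lebesgue)
      = (\<integral>\<^sup>+x. F x \<partial>density (distr lebesgue lebesgue (\<lambda>x. b + r *\<^sub>R x)) (\<lambda>_. ennreal (\<bar>r\<bar> ^ DIM('a))))"
    using lebesgue_affine(1)[of r b] \<open>0 < r\<close> by simp
  also have "\<dots> = (\<integral>\<^sup>+y. ennreal (r ^ DIM('a)) * F (b + r *\<^sub>R y) \<partial>lebesgue)"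
    using T F \<open>0 < r\<close> by (simp add: nn_integral_density nn_integral_distr)
  also have "\<dots> = ennreal (r ^ DIM('a)) * (\<integral>\<^sup>+y. F (b + r *\<^sub>R y) \<partial>lebesgue)"
    using T F \<open>0 < r\<close> by (intro nn_integral_cmult measurable_compose[OF T F]) simp
  finally show ?thesis
    using \<open>0 < r\<close> by (simp add: mult.assoc[symmetric] ennreal_mult[symmetric] power_mult_distrib[symmetric])
qed

lemma integrable_lebesgue_affine:
  fixes b :: "'a::euclidean_space" and f :: "'a \<Rightarrow> 'b::euclidean_space"
  assumes "0 < r" and f: "integrable lebesgue f"
  shows "integrable lebesgue (\<lambda>y. f (b + r *\<^sub>R y))"
    and "integral\<^sup>L lebesgue f = r ^ DIM('a) *\<^sub>R integral\<^sup>L lebesgue (\<lambda>y. f (b + r *\<^sub>R y))"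
proof -
  note T = lebesgue_affine(2)[of r b]
  let ?D = "density (distr lebesgue lebesgue (\<lambda>x. b + r *\<^sub>R x)) (\<lambda>_. ennreal (r ^ DIM('a)))"
  have eq: "lebesgue = ?D" using lebesgue_affine(1)[of r b] \<open>0 < r\<close> by simp
  have m: "f \<in> borel_measurable lebesgue" using f by simp
  have "integrable ?D f" using f eq by simp
  then have "integrable lebesgue (\<lambda>y. r ^ DIM('a) *\<^sub>R f (b + r *\<^sub>R y))"
    using T m \<open>0 < r\<close> by (simp add: integrable_density integrable_distr_eq)
  from integrable_scaleR_right[OF this, of "inverse (r ^ DIM('a))"]
  show "integrable lebesgue (\<lambda>y. f (b + r *\<^sub>R y))"
    using \<open>0 < r\<close> by simp
  have "integral\<^sup>L lebesgue f = integral\<^sup>L ?D f" using eq by simp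
  also have "\<dots> = integral\<^sup>L lebesgue (\<lambda>y. r ^ DIM('a) *\<^sub>R f (b + r *\<^sub>R y))"
    using T m \<open>0 < r\<close> by (simp add: integral_density integral_distr)
  finally show "integral\<^sup>L lebesgue f = r ^ DIM('a) *\<^sub>R integral\<^sup>L lebesgue (\<lambda>y. f (b + r *\<^sub>R y))"
    by simp
qed

lemma locally_integrable_on_affine:
  assumes "0 < r" "locally_integrable_on u S"
  shows "locally_integrable_on (\<lambda>y. u (b + r *\<^sub>R y)) ((\<lambda>y. b + r *\<^sub>R y) -` S)"
  unfolding locally_integrable_on_def
proof (intro allI impI)
  fix K assume K: "compact K" "K \<subseteq> (\<lambda>y. b + r *\<^sub>R y) -` S"
  let ?A = "\<lambda>y. b + r *\<^sub>R y"
  have "compact (?A ` K)" "?A ` K \<subseteq> S"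
    using K by (auto intro!: compact_continuous_image continuous_intros)
  then have "integrable lebesgue (\<lambda>x. indicat_real (?A ` K) x *\<^sub>R u x)"
    using assms(2) by (simp add: locally_integrable_on_def set_integrable_def)
  from integrable_lebesgue_affine(1)[OF \<open>0 < r\<close> this, of b]
  have "integrable lebesgue (\<lambda>y. indicat_real (?A ` K) (?A y) *\<^sub>R u (?A y))" .
  moreover have "indicat_real (?A ` K) (?A y) = indicat_real K y" for y
    using \<open>0 < r\<close> by (auto simp: indicator_def)
  ultimately show "set_integrable lebesgue K (\<lambda>y. u (?A y))"
    by (simp add: set_integrable_def)
qed

lemma test_functions_affine:
  assumes "0 < r" "\<phi> \<in> test_functions S"
  shows "(\<lambda>y. \<phi> (b + r *\<^sub>R y)) \<in> test_functions ((\<lambda>y. b + r *\<^sub>R y) -` S)"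
proof (rule test_functionsI)
  let ?A = "\<lambda>y. b + r *\<^sub>R y" and ?B = "\<lambda>x. inverse r *\<^sub>R (x - b)" and ?K = "closure {x. \<phi> x \<noteq> 0}"
  have AB: "?A (?B x) = x" for x using \<open>0 < r\<close> by simp
  have BA: "?B (?A y) = y" for y using \<open>0 < r\<close> by simp
  show "smooth (\<lambda>y. \<phi> (?A y))"
    using assms(2) by (intro smooth_affine test_functions_smooth)
  show "compact (?B ` ?K)"
    using assms(2) by (intro compact_continuous_image continuous_intros) (simp add: test_functions_def)
  show "?B ` ?K \<subseteq> ?A -` S"
    using assms(2) AB by (auto simp: test_functions_def)
  show "{y. \<phi> (?A y) \<noteq> 0} \<subseteq> ?B ` ?K"
  proof
    fix y assume "y \<in> {y. \<phi> (?A y) \<noteq> 0}"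
    then have "?A y \<in> ?K" using closure_subset[of "{x. \<phi> x \<noteq> 0}"] by auto
    then have "?B (?A y) \<in> ?B ` ?K" by (rule imageI)
    then show "y \<in> ?B ` ?K" unfolding BA .
  qed
qed

text \<open>The test function is transported by the inverse affine map. The Jacobian r^d occurs on
  both sides and cancels, which leaves the chain rule factor r^|\<alpha>|.\<close>

lemma has_weak_deriv_affine:
  fixes u :: "'n::{finite,linorder} rvec \<Rightarrow> 'b::euclidean_space"
  assumes "0 < r" "has_weak_deriv S \<alpha> u g"
  shows "has_weak_deriv ((\<lambda>y. b + r *\<^sub>R y) -` S) \<alpha> (\<lambda>y. u (b + r *\<^sub>R y))
    (\<lambda>y. r ^ multi_order \<alpha> *\<^sub>R g (b + r *\<^sub>R y))"
  unfolding has_weak_deriv_iff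
proof (intro conjI ballI)
  let ?A = "\<lambda>y. b + r *\<^sub>R y" and ?k = "multi_order \<alpha>" and ?d = "DIM('n rvec)"
  have li: "locally_integrable_on u S" "locally_integrable_on g S"
    using assms(2) by (auto simp: has_weak_deriv_iff)
  show "locally_integrable_on (\<lambda>y. u (?A y)) (?A -` S)"
    "locally_integrable_on (\<lambda>y. r ^ ?k *\<^sub>R g (?A y)) (?A -` S)"
    using assms li by (auto intro: locally_integrable_on_affine locally_integrable_on_scaleR)
  fix \<phi> assume \<phi>: "\<phi> \<in> test_functions (?A -` S)"
  define \<psi> where "\<psi> x = \<phi> (- (inverse r *\<^sub>R b) + inverse r *\<^sub>R x)" for x
  have \<psi>A: "\<psi> (?A y) = \<phi> y" for y
    using \<open>0 < r\<close> by (simp add: \<psi>_def algebra_simps)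
  have "(\<lambda>x. - (inverse r *\<^sub>R b) + inverse r *\<^sub>R x) -` (?A -` S) = S"
    using \<open>0 < r\<close> by (auto simp: algebra_simps)
  then have \<psi>: "\<psi> \<in> test_functions S"
    using test_functions_affine[OF _ \<phi>, of "inverse r" "- (inverse r *\<^sub>R b)"] \<open>0 < r\<close>
    by (simp add: \<psi>_def[abs_def])
  have "multi_deriv \<alpha> (\<lambda>y. \<psi> (?A y)) = (\<lambda>y. r ^ ?k * multi_deriv \<alpha> \<psi> (?A y))"
    by (rule multi_deriv_affine[OF test_functions_smooth[OF \<psi>]])
  then have d\<phi>: "multi_deriv \<alpha> \<phi> y = r ^ ?k * multi_deriv \<alpha> \<psi> (?A y)" for y
    unfolding \<psi>A by (simp add: fun_eq_iff)
  have "r ^ ?d *\<^sub>R integral\<^sup>L lebesgue (\<lambda>y. multi_deriv \<alpha> \<phi> y *\<^sub>R u (?A y))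
      = r ^ ?k *\<^sub>R (r ^ ?d *\<^sub>R integral\<^sup>L lebesgue (\<lambda>y. multi_deriv \<alpha> \<psi> (?A y) *\<^sub>R u (?A y)))"
    by (simp add: d\<phi> scaleR_scaleR[symmetric] mult.commute del: scaleR_scaleR)
      (simp add: mult.commute)
  also have "\<dots> = r ^ ?k *\<^sub>R integral\<^sup>L lebesgue (\<lambda>x. multi_deriv \<alpha> \<psi> x *\<^sub>R u x)"
    using integrable_lebesgue_affine(2)[OF \<open>0 < r\<close>
        integrable_test_function[OF test_functions_multi_deriv[OF \<psi>] li(1)], of \<alpha> b] by simp
  also have "\<dots> = r ^ ?k *\<^sub>R ((- 1) ^ ?k *\<^sub>R integral\<^sup>L lebesgue (\<lambda>x. \<psi> x *\<^sub>R g x))"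
    using assms(2) \<psi> by (simp add: has_weak_deriv_iff)
  also have "\<dots> = r ^ ?k *\<^sub>R ((- 1) ^ ?k *\<^sub>R (r ^ ?d *\<^sub>R integral\<^sup>L lebesgue (\<lambda>y. \<phi> y *\<^sub>R g (?A y))))"
    using integrable_lebesgue_affine(2)[OF \<open>0 < r\<close> integrable_test_function[OF \<psi> li(2)], of b]
    by (simp add: \<psi>A)
  also have "\<dots> = r ^ ?d *\<^sub>R ((- 1) ^ ?k *\<^sub>R integral\<^sup>L lebesgue (\<lambda>y. \<phi> y *\<^sub>R (r ^ ?k *\<^sub>R g (?A y))))"
    by (simp add: scaleR_left_commute[of "\<phi> _"] del: scaleR_scaleR)
      (simp add: mult.commute mult.left_commute)
  finally show "integral\<^sup>L lebesgue (\<lambda>y. multi_deriv \<alpha> \<phi> y *\<^sub>R u (?A y))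
      = (- 1) ^ ?k *\<^sub>R integral\<^sup>L lebesgue (\<lambda>y. \<phi> y *\<^sub>R (r ^ ?k *\<^sub>R g (?A y)))"
    using \<open>0 < r\<close> by (simp only: scaleR_cancel_left) simp
qed

subsection \<open>Localised Sobolev norms\<close>

text \<open>The p-th power of a Sobolev norm on K, with the family of derivatives as an argument, so
  that one notion serves plain, rescaled and weighted derivatives. Values in \<open>ennreal\<close>
  permit estimates before finiteness is known.\<close>

definition energy ::
    "nat \<Rightarrow> real \<Rightarrow> 'n::finite rvec set \<Rightarrow> (('n \<Rightarrow> nat) \<Rightarrow> 'n rvec \<Rightarrow> 'b::euclidean_space) \<Rightarrow> ennreal" where
  "energy m p K g = (\<Sum>\<alpha> | multi_order \<alpha> \<le> m. \<integral>\<^sup>+x\<in>K. ennreal (norm (g \<alpha> x) powr p) \<partial>lebesgue)"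

lemma energy_cong:
  "(\<And>\<alpha> x. multi_order \<alpha> \<le> m \<Longrightarrow> x \<in> K \<Longrightarrow> norm (g \<alpha> x) = norm (h \<alpha> x)) \<Longrightarrow> energy m p K g = energy m p K h"
  unfolding energy_def by (auto intro!: sum.cong nn_integral_cong simp: indicator_def)

lemma energy_measurable:
  assumes "K \<in> sets lebesgue" "K \<subseteq> S" "(\<lambda>x. indicat_real S x *\<^sub>R f x) \<in> borel_measurable lebesgue"
  shows "(\<lambda>x. ennreal (norm (f x :: 'b::euclidean_space) powr p) * indicator K x) \<in> borel_measurable lebesgue"
proof -
  have "(\<lambda>x. ennreal (norm (indicat_real S x *\<^sub>R f x) powr p) * indicator K x) \<in> borel_measurable lebesgue"
    using assms(1,3) by measurable
  moreover have "(\<lambda>x. ennreal (norm (indicat_real S x *\<^sub>R f x) powr p) * indicator K x)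
      = (\<lambda>x. ennreal (norm (f x) powr p) * indicator K x)"
    using assms(2) by (auto simp: fun_eq_iff indicator_def)
  ultimately show ?thesis by simp
qed

lemma energy_affine:
  fixes g :: "('n::finite \<Rightarrow> nat) \<Rightarrow> 'n rvec \<Rightarrow> 'b::euclidean_space"
  assumes "0 < r"
    and "\<And>\<alpha>. multi_order \<alpha> \<le> m \<Longrightarrow>
      (\<lambda>x. ennreal (norm (g \<alpha> x) powr p) * indicator K x) \<in> borel_measurable lebesgue"
  shows "energy m p ((\<lambda>y. b + r *\<^sub>R y) -` K) (\<lambda>\<alpha> y. g \<alpha> (b + r *\<^sub>R y))
    = ennreal (inverse r ^ CARD('n)) * energy m p K g"
proof -
  have ind: "indicator ((\<lambda>y. b + r *\<^sub>R y) -` K) y = (indicator K (b + r *\<^sub>R y) :: ennreal)" for y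
    by (simp add: indicator_def)
  show ?thesis
    unfolding energy_def ind sum_distrib_left
    using nn_integral_lebesgue_affine[OF \<open>0 < r\<close> assms(2), of _ b] by (intro sum.cong) auto
qed

lemma energy_sobolev:
  fixes w :: "'n::{finite,linorder} rvec \<Rightarrow> 'b::euclidean_space"
  assumes "w \<in> sobolev_space m p" "0 < p"
  shows "energy m p UNIV (\<lambda>\<alpha>. weak_deriv UNIV \<alpha> w) = ennreal (sobolev_norm m p w powr p)"
proof -
  let ?f = "\<lambda>\<alpha> x. norm (weak_deriv UNIV \<alpha> w x) powr p"
  have "energy m p UNIV (\<lambda>\<alpha>. weak_deriv UNIV \<alpha> w) = (\<Sum>\<alpha> | multi_order \<alpha> \<le> m. ennreal (integral\<^sup>L lebesgue (?f \<alpha>)))"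
    using assms(1) unfolding energy_def sobolev_space_def
    by (intro sum.cong) (auto intro!: nn_integral_eq_integral)
  also have "\<dots> = ennreal (\<Sum>\<alpha> | multi_order \<alpha> \<le> m. integral\<^sup>L lebesgue (?f \<alpha>))"
    by (intro sum_ennreal) auto
  also have "(\<Sum>\<alpha> | multi_order \<alpha> \<le> m. integral\<^sup>L lebesgue (?f \<alpha>)) = sobolev_norm m p w powr p"
    using assms(2) by (simp add: sobolev_norm_def powr_powr sum_nonneg)
  finally show ?thesis .
qed

lemma has_weak_deriv_weak_deriv: "has_weak_deriv S \<alpha> u g \<Longrightarrow> has_weak_deriv S \<alpha> u (weak_deriv S \<alpha> u)"
  unfolding weak_deriv_def by (rule someI[of "has_weak_deriv S \<alpha> u"])

text \<open>This leads from functions on S to functions on the whole space, where the algebra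
  property can be applied. The constant is fixed before S, u and g, and finiteness is asked on K
  only.\<close>

lemma sobolev_cutoff:
  fixes \<eta> :: "'n::{finite,linorder} rvec \<Rightarrow> real"
  assumes \<eta>: "\<eta> \<in> test_functions K" and "0 < p" and K: "K \<in> sets lebesgue"
  shows "\<exists>C\<ge>0. \<forall>S u (g :: _ \<Rightarrow> _ \<Rightarrow> 'b::euclidean_space). open S \<longrightarrow> K \<subseteq> S \<longrightarrow>
      (\<forall>\<beta>. multi_order \<beta> \<le> m \<longrightarrow> has_weak_deriv S \<beta> u (g \<beta>)) \<longrightarrow> energy m p K g < \<infinity> \<longrightarrow>
      (\<lambda>x. \<eta> x *\<^sub>R u x) \<in> sobolev_space m p \<and>
      ennreal (sobolev_norm m p (\<lambda>x. \<eta> x *\<^sub>R u x) powr p) \<le> ennreal C * energy m p K g"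
proof -
  let ?I = "{\<beta> :: 'n \<Rightarrow> nat. multi_order \<beta> \<le> m}"
  obtain C where "C \<ge> 0" and C: "\<forall>S u (g :: _ \<Rightarrow> _ \<Rightarrow> 'b) \<alpha>. K \<subseteq> S \<longrightarrow> multi_order \<alpha> \<le> m \<longrightarrow>
      (\<forall>\<beta>. multi_order \<beta> \<le> m \<longrightarrow> has_weak_deriv S \<beta> u (g \<beta>)) \<longrightarrow>
      (\<exists>G. has_weak_deriv UNIV \<alpha> (\<lambda>x. \<eta> x *\<^sub>R u x) G \<and>
        (\<forall>x. norm (G x) powr p \<le> C * (indicator K x * (\<Sum>\<beta>\<in>?I. norm (g \<beta> x) powr p))))"
    using weak_deriv_cutoff_bound[OF \<eta> less_imp_le[OF \<open>0 < p\<close>], of m, where 'b = 'b]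
    by (elim exE conjE) (rule that)
  have main: "(\<lambda>x. \<eta> x *\<^sub>R u x) \<in> sobolev_space m p \<and>
      ennreal (sobolev_norm m p (\<lambda>x. \<eta> x *\<^sub>R u x) powr p) \<le> ennreal (real (card ?I) * C) * energy m p K g"
    if "open S" "K \<subseteq> S" and g: "\<And>\<beta>. multi_order \<beta> \<le> m \<Longrightarrow> has_weak_deriv S \<beta> u (g \<beta>)"
      and fin: "energy m p K g < \<infinity>" for S u and g :: "_ \<Rightarrow> _ \<Rightarrow> 'b"
  proof -
    let ?w = "\<lambda>x. \<eta> x *\<^sub>R u x"
    have meas: "(\<lambda>x. ennreal (norm (g \<beta> x) powr p) * indicator K x) \<in> borel_measurable lebesgue"
      if "multi_order \<beta> \<le> m" for \<beta>
      using g[OF that] locally_integrable_borel_measurable[OF \<open>open S\<close>]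
      by (intro energy_measurable[OF K \<open>K \<subseteq> S\<close>]) (auto simp: has_weak_deriv_iff)
    have bound: "has_weak_deriv UNIV \<alpha> ?w (weak_deriv UNIV \<alpha> ?w) \<and>
        weak_deriv UNIV \<alpha> ?w \<in> borel_measurable lebesgue \<and>
        (\<integral>\<^sup>+x. ennreal (norm (weak_deriv UNIV \<alpha> ?w x) powr p) \<partial>lebesgue) \<le> ennreal C * energy m p K g"
      if \<alpha>: "multi_order \<alpha> \<le> m" for \<alpha>
    proof -
      obtain G where G: "has_weak_deriv UNIV \<alpha> ?w G"
        "\<And>x. norm (G x) powr p \<le> C * (indicator K x * (\<Sum>\<beta>\<in>?I. norm (g \<beta> x) powr p))"
        using C[rule_format, OF \<open>K \<subseteq> S\<close> \<alpha> g] by blast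
      note D = has_weak_deriv_weak_deriv[OF G(1)]
      \<comment> \<open>\<open>weak_deriv\<close> is an unspecified version, so the bound for G
        passes to it only through uniqueness almost everywhere.\<close>
      have "AE x in lebesgue. weak_deriv UNIV \<alpha> ?w x = G x"
        using weak_deriv_unique_AE[OF open_UNIV D G(1)] by simp
      then have "AE x in lebesgue. ennreal (norm (weak_deriv UNIV \<alpha> ?w x) powr p)
          = ennreal (norm (G x) powr p)"
        by eventually_elim simp
      then have "(\<integral>\<^sup>+x. ennreal (norm (weak_deriv UNIV \<alpha> ?w x) powr p) \<partial>lebesgue)
          = (\<integral>\<^sup>+x. ennreal (norm (G x) powr p) \<partial>lebesgue)"
        by (rule nn_integral_cong_AE)
      also have "\<dots> \<le> (\<integral>\<^sup>+x. ennreal C * (\<Sum>\<beta>\<in>?I. ennreal (norm (g \<beta> x) powr p) * indicator K x) \<partial>lebesgue)"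
      proof (rule nn_integral_mono)
        fix x
        have "ennreal (norm (G x) powr p) \<le> ennreal (C * (indicator K x * (\<Sum>\<beta>\<in>?I. norm (g \<beta> x) powr p)))"
          by (intro ennreal_leI G(2))
        also have "\<dots> = ennreal C * (\<Sum>\<beta>\<in>?I. ennreal (norm (g \<beta> x) powr p) * indicator K x)"
          using \<open>C \<ge> 0\<close>
          by (cases "x \<in> K") (simp_all add: ennreal_mult sum_nonneg sum_ennreal)
        finally show "ennreal (norm (G x) powr p)
            \<le> ennreal C * (\<Sum>\<beta>\<in>?I. ennreal (norm (g \<beta> x) powr p) * indicator K x)" .
      qed
      also have "\<dots> = ennreal C * energy m p K g"
        using meas unfolding energy_def
        by (subst nn_integral_cmult) (auto intro!: borel_measurable_sum nn_integral_sum arg_cong[of _ _ "(*) _"])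
      finally show ?thesis
        using D locally_integrable_borel_measurable[OF open_UNIV, of "weak_deriv UNIV \<alpha> ?w"]
        by (simp add: has_weak_deriv_iff)
    qed
    have "integrable lebesgue (\<lambda>x. norm (weak_deriv UNIV \<alpha> ?w x) powr p)" if \<alpha>: "multi_order \<alpha> \<le> m" for \<alpha>
    proof (rule integrableI_nonneg)
      show "(\<lambda>x. norm (weak_deriv UNIV \<alpha> ?w x) powr p) \<in> borel_measurable lebesgue"
        using bound[OF \<alpha>] by (intro powr_real_measurable borel_measurable_norm) auto
      have "ennreal C * energy m p K g < \<infinity>"
        using fin by (simp add: ennreal_mult_less_top)
      then show "(\<integral>\<^sup>+x. ennreal (norm (weak_deriv UNIV \<alpha> ?w x) powr p) \<partial>lebesgue) < \<infinity>"
        using bound[OF \<alpha>] by (meson le_less_trans)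
    qed simp
    moreover have "?w \<in> borel_measurable lebesgue"
    proof -
      have "\<eta> \<in> test_functions S" using \<eta> \<open>K \<subseteq> S\<close> by (rule test_functions_mono)
      moreover have "locally_integrable_on u S" using g[of "\<lambda>_. 0"] by (simp add: has_weak_deriv_iff)
      ultimately show ?thesis by (intro borel_measurable_integrable integrable_test_function)
    qed
    ultimately have w: "?w \<in> sobolev_space m p"
      using bound by (auto simp: sobolev_space_def)
    have "ennreal (sobolev_norm m p ?w powr p) = energy m p UNIV (\<lambda>\<alpha>. weak_deriv UNIV \<alpha> ?w)"
      using energy_sobolev[OF w \<open>0 < p\<close>] by simp
    \<comment> \<open>Each derivative of the cut-off function is bounded by the full energy of g,
      whence the factor \<open>card ?I\<close>.\<close>
    also have "\<dots> \<le> (\<Sum>\<alpha>\<in>?I. ennreal C * energy m p K g)"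
      using bound unfolding energy_def[of m p UNIV] by (intro sum_mono) simp
    also have "\<dots> = ennreal (real (card ?I) * C) * energy m p K g"
      using \<open>C \<ge> 0\<close> by (simp add: ennreal_mult mult.assoc ennreal_of_nat_eq_real_of_nat)
    finally show ?thesis using w by simp
  qed
  show ?thesis
    using \<open>C \<ge> 0\<close> main by (intro exI[of _ "real (card ?I) * C"] conjI allI impI) (auto simp del: of_nat_mult)
qed

subsection \<open>Cubes\<close>

definition open_cube :: "real \<Rightarrow> 'n::finite rvec set" where
  "open_cube s = box (\<chi> i. - s) (\<chi> i. s)"

definition closed_cube :: "real \<Rightarrow> 'n::finite rvec set" where
  "closed_cube s = cbox (\<chi> i. - s) (\<chi> i. s)"

lemma mem_open_cube: "x \<in> open_cube s \<longleftrightarrow> (\<forall>i. \<bar>x $ i\<bar> < s)"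
  by (simp add: open_cube_def mem_box_cart abs_less_iff) (metis minus_less_iff)

lemma mem_closed_cube: "x \<in> closed_cube s \<longleftrightarrow> (\<forall>i. \<bar>x $ i\<bar> \<le> s)"
  by (simp add: closed_cube_def mem_box_cart abs_le_iff) (metis minus_le_iff)

lemma open_cube_subset_closed_cube: "s \<le> t \<Longrightarrow> open_cube s \<subseteq> closed_cube t"
  by (rule subsetI) (simp add: mem_open_cube mem_closed_cube, meson less_imp_le less_le_trans)

lemma closed_cube_subset_open_cube: "s < t \<Longrightarrow> closed_cube s \<subseteq> open_cube t"
  by (rule subsetI) (simp add: mem_open_cube mem_closed_cube, meson le_less_trans)

lemma open_cube_mono: "s \<le> t \<Longrightarrow> open_cube s \<subseteq> open_cube t"
  by (rule subsetI) (simp add: mem_open_cube, meson less_le_trans)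

text \<open>Cubes are described as images, while openness and the transport of weak derivatives and
  test functions are formulated with preimages; the inverse map links the two.\<close>

lemma affine_image_eq_vimage:
  fixes b :: "'a::real_vector"
  assumes "0 < r"
  shows "(\<lambda>y. b + r *\<^sub>R y) ` X = (\<lambda>x. - (inverse r *\<^sub>R b) + inverse r *\<^sub>R x) -` X"
proof (intro equalityI subsetI)
  fix x assume "x \<in> (\<lambda>x. - (inverse r *\<^sub>R b) + inverse r *\<^sub>R x) -` X"
  moreover have "x = b + r *\<^sub>R (- (inverse r *\<^sub>R b) + inverse r *\<^sub>R x)"
    using assms by (simp add: algebra_simps)
  ultimately show "x \<in> (\<lambda>y. b + r *\<^sub>R y) ` X" by blast
qed (use assms in \<open>auto simp: algebra_simps\<close>)

lemma open_affine_cube: "0 < r \<Longrightarrow> open ((\<lambda>y. b + r *\<^sub>R y) ` open_cube s)"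
  unfolding affine_image_eq_vimage
  by (intro open_vimage continuous_intros) (simp add: open_cube_def open_box)

lemma compact_affine_cube: "compact ((\<lambda>y. b + r *\<^sub>R y) ` closed_cube s)"
  by (intro compact_continuous_image continuous_intros) (simp add: closed_cube_def)

lemma affine_cube_sets:
  "0 < r \<Longrightarrow> (\<lambda>y. b + r *\<^sub>R y) ` open_cube s \<in> sets lebesgue"
  "(\<lambda>y. b + r *\<^sub>R y) ` closed_cube s \<in> sets lebesgue"
  by (simp_all add: open_affine_cube compact_affine_cube fmeasurableD lmeasurable_compact)

text \<open>The first bump serves as cutoff before multiplication, the second one for gluing. The
  steepness is the reciprocal of the gap between the two cubes: 3 - 2 = 1 and 3/2 - 1 = 1/2. The
  value 3/2 leaves room for a compact support inside the open cube of half-side 2.\<close>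

lemma cube_bump:
  "box_bump 1 (\<chi> i. - 3) (\<chi> i. 3) \<in> test_functions (closed_cube 3)"
  "x \<in> open_cube 2 \<Longrightarrow> box_bump 1 (\<chi> i. - 3) (\<chi> i. 3) x = 1"
  "box_bump 2 (\<chi> i. - (3 / 2)) (\<chi> i. 3 / 2) \<in> test_functions (open_cube 2)"
  "x \<in> open_cube 1 \<Longrightarrow> box_bump 2 (\<chi> i. - (3 / 2)) (\<chi> i. 3 / 2) x = 1"
proof -
  have "{x. box_bump 1 (\<chi> i. - 3) (\<chi> i. 3) x \<noteq> 0} \<subseteq> closed_cube 3"
    using box_bump_eq_0[of 1] box_subset_cbox unfolding closed_cube_def by force
  then show "box_bump 1 (\<chi> i. - 3) (\<chi> i. 3) \<in> test_functions (closed_cube 3)"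
    by (rule test_functionsI[OF smooth_box_bump]) (simp_all add: closed_cube_def)
  have "{x. box_bump 2 (\<chi> i. - (3 / 2)) (\<chi> i. 3 / 2) x \<noteq> 0} \<subseteq> closed_cube (3 / 2)"
    using box_bump_eq_0[of 2] box_subset_cbox unfolding closed_cube_def by force
  then show "box_bump 2 (\<chi> i. - (3 / 2)) (\<chi> i. 3 / 2) \<in> test_functions (open_cube 2)"
    by (rule test_functionsI[OF smooth_box_bump]) (simp_all add: closed_cube_subset_open_cube, simp add: closed_cube_def)
  show "box_bump 1 (\<chi> i. - 3) (\<chi> i. 3) x = 1" if "x \<in> open_cube 2"
  proof (rule box_bump_eq_1)
    fix i
    have "\<bar>x $ i\<bar> < 2" using that by (simp add: mem_open_cube)
    then show "1 \<le> 1 * (x $ i - (\<chi> i. - 3) $ i)" "1 \<le> 1 * ((\<chi> i. 3) $ i - x $ i)" by simp_all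
  qed
  show "box_bump 2 (\<chi> i. - (3 / 2)) (\<chi> i. 3 / 2) x = 1" if "x \<in> open_cube 1"
  proof (rule box_bump_eq_1)
    fix i
    have "\<bar>x $ i\<bar> < 1" using that by (simp add: mem_open_cube)
    then show "1 \<le> 2 * (x $ i - (\<chi> i. - (3 / 2)) $ i)" "1 \<le> 2 * ((\<chi> i. 3 / 2) $ i - x $ i)"
      by (simp_all add: abs_less_iff)
  qed
qed

subsection \<open>Energies and coverings\<close>

lemma energy_mono_set: "K \<subseteq> L \<Longrightarrow> energy m p K g \<le> energy m p L g"
  unfolding energy_def by (auto intro!: sum_mono nn_integral_mono simp: indicator_def)

lemma energy_AE:
  assumes "\<And>\<alpha>. multi_order \<alpha> \<le> m \<Longrightarrow> AE x in lebesgue. x \<in> K \<longrightarrow> g \<alpha> x = h \<alpha> x"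
  shows "energy m p K g = energy m p K h"
  unfolding energy_def
proof (rule sum.cong[OF refl])
  fix \<alpha> :: "'a \<Rightarrow> nat" assume "\<alpha> \<in> {\<alpha>. multi_order \<alpha> \<le> m}"
  then have "AE x in lebesgue. ennreal (norm (g \<alpha> x) powr p) * indicator K x
      = ennreal (norm (h \<alpha> x) powr p) * indicator K x"
    using assms[of \<alpha>] by (auto simp: indicator_def elim!: eventually_mono)
  then show "(\<integral>\<^sup>+x\<in>K. ennreal (norm (g \<alpha> x) powr p) \<partial>lebesgue)
      = (\<integral>\<^sup>+x\<in>K. ennreal (norm (h \<alpha> x) powr p) \<partial>lebesgue)"
    by (rule nn_integral_cong_AE)
qed

lemma energy_le_scaled:
  assumes "0 \<le> c" "0 \<le> p"
    and "\<And>\<alpha> x. multi_order \<alpha> \<le> m \<Longrightarrow> x \<in> K \<Longrightarrow> norm (g \<alpha> x) \<le> c * norm (h \<alpha> x)"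
    and "\<And>\<alpha>. multi_order \<alpha> \<le> m \<Longrightarrow>
      (\<lambda>x. ennreal (norm (h \<alpha> x) powr p) * indicator K x) \<in> borel_measurable lebesgue"
  shows "energy m p K g \<le> ennreal (c powr p) * energy m p K h"
  unfolding energy_def sum_distrib_left
proof (rule sum_mono)
  fix \<alpha> :: "'a \<Rightarrow> nat" assume "\<alpha> \<in> {\<alpha>. multi_order \<alpha> \<le> m}"
  then have \<alpha>: "multi_order \<alpha> \<le> m" by simp
  have "norm (g \<alpha> x) powr p \<le> c powr p * norm (h \<alpha> x) powr p" if "x \<in> K" for x
  proof -
    have "norm (g \<alpha> x) powr p \<le> (c * norm (h \<alpha> x)) powr p"
      using assms(2) assms(3)[OF \<alpha> that] by (intro powr_mono2) auto
    then show ?thesis using assms(1) by (simp add: powr_mult)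
  qed
  then have "(\<integral>\<^sup>+x\<in>K. ennreal (norm (g \<alpha> x) powr p) \<partial>lebesgue)
      \<le> (\<integral>\<^sup>+x. ennreal (c powr p) * (ennreal (norm (h \<alpha> x) powr p) * indicator K x) \<partial>lebesgue)"
    by (intro nn_integral_mono) (auto simp: indicator_def ennreal_mult[symmetric] intro!: ennreal_leI)
  also have "\<dots> = ennreal (c powr p) * (\<integral>\<^sup>+x\<in>K. ennreal (norm (h \<alpha> x) powr p) \<partial>lebesgue)"
    by (rule nn_integral_cmult[OF assms(4)[OF \<alpha>]])
  finally show "(\<integral>\<^sup>+x\<in>K. ennreal (norm (g \<alpha> x) powr p) \<partial>lebesgue)
      \<le> ennreal (c powr p) * (\<integral>\<^sup>+x\<in>K. ennreal (norm (h \<alpha> x) powr p) \<partial>lebesgue)" .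
qed

lemma energy_measurable_subset:
  assumes "(\<lambda>x. ennreal (f x) * indicator S x) \<in> borel_measurable lebesgue" "K \<subseteq> S" "K \<in> sets lebesgue"
  shows "(\<lambda>x. ennreal (f x) * indicator K x) \<in> borel_measurable lebesgue"
proof -
  have "(\<lambda>x. ennreal (f x) * indicator S x * indicator K x) \<in> borel_measurable lebesgue"
    using assms(1,3) by measurable
  moreover have "(\<lambda>x. ennreal (f x) * indicator S x * indicator K x) = (\<lambda>x. ennreal (f x) * indicator K x)"
    using assms(2) by (auto simp: fun_eq_iff indicator_def)
  ultimately show ?thesis by simp
qed

text \<open>Every point of S is counted at least once. The sum over I is written as an integral over
  \<open>count_space I\<close>, so that its interchange with the Lebesgue integral is a known
  theorem.\<close>

lemma energy_cover:
  fixes g :: "('n::finite \<Rightarrow> nat) \<Rightarrow> 'n rvec \<Rightarrow> 'b::euclidean_space"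
  assumes "countable I" "S \<subseteq> (\<Union>i\<in>I. B i)" "\<And>i. i \<in> I \<Longrightarrow> B i \<subseteq> S" "\<And>i. i \<in> I \<Longrightarrow> B i \<in> sets lebesgue"
    and meas: "\<And>\<alpha>. multi_order \<alpha> \<le> m \<Longrightarrow>
      (\<lambda>x. ennreal (norm (g \<alpha> x) powr p) * indicator S x) \<in> borel_measurable lebesgue"
  shows "energy m p S g \<le> (\<integral>\<^sup>+i. energy m p (B i) g \<partial>count_space I)"
proof -
  let ?f = "\<lambda>\<alpha> x. ennreal (norm (g \<alpha> x) powr p)"
  have "energy m p S g \<le> (\<Sum>\<alpha> | multi_order \<alpha> \<le> m. \<integral>\<^sup>+i. (\<integral>\<^sup>+x\<in>B i. ?f \<alpha> x \<partial>lebesgue) \<partial>count_space I)"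
    unfolding energy_def
  proof (rule sum_mono)
    fix \<alpha> :: "'n \<Rightarrow> nat" assume \<alpha>: "\<alpha> \<in> {\<alpha>. multi_order \<alpha> \<le> m}"
    have "(\<integral>\<^sup>+x\<in>S. ?f \<alpha> x \<partial>lebesgue) \<le> (\<integral>\<^sup>+x. (\<integral>\<^sup>+i. ?f \<alpha> x * indicator (B i) x \<partial>count_space I) \<partial>lebesgue)"
    proof (rule nn_integral_mono)
      fix x
      show "?f \<alpha> x * indicator S x \<le> (\<integral>\<^sup>+i. ?f \<alpha> x * indicator (B i) x \<partial>count_space I)"
      proof (cases "x \<in> S")
        case True
        then obtain i where i: "i \<in> I" "x \<in> B i" using assms(2) by blast
        have "?f \<alpha> x * indicator (B i) x \<le> (\<integral>\<^sup>+i. ?f \<alpha> x * indicator (B i) x \<partial>count_space I)"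
          using i(1) by (rule nn_integral_ge_point)
        then show ?thesis using i True by simp
      qed simp
    qed
    also have "\<dots> = (\<integral>\<^sup>+i. (\<integral>\<^sup>+x\<in>B i. ?f \<alpha> x \<partial>lebesgue) \<partial>count_space I)"
    proof (rule nn_integral_count_space_nn_integral[OF assms(1)])
      show "(\<lambda>x. ?f \<alpha> x * indicator (B i) x) \<in> borel_measurable lebesgue" if "i \<in> I" for i
        using \<alpha> by (intro energy_measurable_subset[OF meas assms(3)[OF that] assms(4)[OF that]]) simp
    qed
    finally show "(\<integral>\<^sup>+x\<in>S. ?f \<alpha> x \<partial>lebesgue) \<le> (\<integral>\<^sup>+i. (\<integral>\<^sup>+x\<in>B i. ?f \<alpha> x \<partial>lebesgue) \<partial>count_space I)" .
  qed
  also have "\<dots> = (\<integral>\<^sup>+i. energy m p (B i) g \<partial>count_space I)"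
    unfolding energy_def by (rule nn_integral_sum[symmetric]) simp
  finally show ?thesis .
qed

text \<open>After the interchange of sum and integral, the inner sum counts the sets that contain x,
  and there are at most M of them.\<close>

lemma energy_overlap:
  fixes g :: "('n::finite \<Rightarrow> nat) \<Rightarrow> 'n rvec \<Rightarrow> 'b::euclidean_space"
  assumes "countable I" "\<And>i. i \<in> I \<Longrightarrow> K i \<subseteq> S" "\<And>i. i \<in> I \<Longrightarrow> K i \<in> sets lebesgue"
    and M: "\<And>x. finite {i \<in> I. x \<in> K i} \<and> card {i \<in> I. x \<in> K i} \<le> M"
    and meas: "\<And>\<alpha>. multi_order \<alpha> \<le> m \<Longrightarrow>
      (\<lambda>x. ennreal (norm (g \<alpha> x) powr p) * indicator S x) \<in> borel_measurable lebesgue"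
  shows "(\<integral>\<^sup>+i. energy m p (K i) g \<partial>count_space I) \<le> ennreal (real M) * energy m p S g"
proof -
  let ?f = "\<lambda>\<alpha> x. ennreal (norm (g \<alpha> x) powr p)"
  have "(\<integral>\<^sup>+i. energy m p (K i) g \<partial>count_space I)
      = (\<Sum>\<alpha> | multi_order \<alpha> \<le> m. \<integral>\<^sup>+i. (\<integral>\<^sup>+x\<in>K i. ?f \<alpha> x \<partial>lebesgue) \<partial>count_space I)"
    unfolding energy_def by (rule nn_integral_sum) simp
  also have "\<dots> \<le> (\<Sum>\<alpha> | multi_order \<alpha> \<le> m. ennreal (real M) * (\<integral>\<^sup>+x\<in>S. ?f \<alpha> x \<partial>lebesgue))"
  proof (rule sum_mono)
    fix \<alpha> :: "'n \<Rightarrow> nat" assume \<alpha>: "\<alpha> \<in> {\<alpha>. multi_order \<alpha> \<le> m}"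
    have "(\<integral>\<^sup>+i. (\<integral>\<^sup>+x\<in>K i. ?f \<alpha> x \<partial>lebesgue) \<partial>count_space I)
        = (\<integral>\<^sup>+x. (\<integral>\<^sup>+i. ?f \<alpha> x * indicator (K i) x \<partial>count_space I) \<partial>lebesgue)"
    proof (rule nn_integral_count_space_nn_integral[OF assms(1), symmetric])
      show "(\<lambda>x. ?f \<alpha> x * indicator (K i) x) \<in> borel_measurable lebesgue" if "i \<in> I" for i
        using \<alpha> by (intro energy_measurable_subset[OF meas assms(2)[OF that] assms(3)[OF that]]) simp
    qed
    also have "\<dots> \<le> (\<integral>\<^sup>+x. ennreal (real M) * (?f \<alpha> x * indicator S x) \<partial>lebesgue)"
    proof (rule nn_integral_mono)
      fix x
      have "(\<integral>\<^sup>+i. ?f \<alpha> x * indicator (K i) x \<partial>count_space I)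
          = (\<integral>\<^sup>+i. (?f \<alpha> x * indicator S x) * indicator {i \<in> I. x \<in> K i} i \<partial>count_space I)"
        using assms(2) by (intro nn_integral_cong) (auto simp: indicator_def)
      also have "\<dots> = (?f \<alpha> x * indicator S x) * emeasure (count_space I) {i \<in> I. x \<in> K i}"
        by (rule nn_integral_cmult_indicator) simp
      also have "emeasure (count_space I) {i \<in> I. x \<in> K i} = ennreal (real (card {i \<in> I. x \<in> K i}))"
        using M[of x] by (subst emeasure_count_space_finite) (auto simp: ennreal_of_nat_eq_real_of_nat)
      also have "(?f \<alpha> x * indicator S x) * \<dots> \<le> (?f \<alpha> x * indicator S x) * ennreal (real M)"
        using M[of x] by (intro mult_left_mono ennreal_leI) auto
      finally show "(\<integral>\<^sup>+i. ?f \<alpha> x * indicator (K i) x \<partial>count_space I)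
          \<le> ennreal (real M) * (?f \<alpha> x * indicator S x)"
        by (simp add: mult.commute)
    qed
    also have "\<dots> = ennreal (real M) * (\<integral>\<^sup>+x\<in>S. ?f \<alpha> x \<partial>lebesgue)"
      using \<alpha> meas by (intro nn_integral_cmult) auto
    finally show "(\<integral>\<^sup>+i. (\<integral>\<^sup>+x\<in>K i. ?f \<alpha> x \<partial>lebesgue) \<partial>count_space I)
        \<le> ennreal (real M) * (\<integral>\<^sup>+x\<in>S. ?f \<alpha> x \<partial>lebesgue)" .
  qed
  finally show ?thesis
    by (simp add: energy_def sum_distrib_left)
qed

subsection \<open>The product on a single cube\<close>

text \<open>Under x = b + r y a derivative of order k acquires the factor r^k, which is why the
  energies carry such factors. Two changes of variables to the reference cube cost r^(-d) each and
  the one back returns r^d, so a single r^(-d) is left. Apart from it the constant depends on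
  neither b nor r.\<close>

lemma local_product_estimate:
  assumes "0 < p"
    and alg: "pointwise_algebra
      (sobolev_space m p :: ('n::{finite,linorder} rvec \<Rightarrow> 'b::{real_normed_field,euclidean_space}) set)
      (sobolev_norm m p)"
  shows "\<exists>C\<ge>0. \<forall>b r S (u :: 'n rvec \<Rightarrow> 'b) v gu gv. 0 < r \<longrightarrow> open S \<longrightarrow>
      (\<lambda>y. b + r *\<^sub>R y) ` closed_cube 3 \<subseteq> S \<longrightarrow>
      (\<forall>\<beta>. multi_order \<beta> \<le> m \<longrightarrow> has_weak_deriv S \<beta> u (gu \<beta>)) \<longrightarrow>
      (\<forall>\<beta>. multi_order \<beta> \<le> m \<longrightarrow> has_weak_deriv S \<beta> v (gv \<beta>)) \<longrightarrow>
      energy m p ((\<lambda>y. b + r *\<^sub>R y) ` closed_cube 3) (\<lambda>\<beta> x. r ^ multi_order \<beta> *\<^sub>R gu \<beta> x) < \<infinity> \<longrightarrow>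
      energy m p ((\<lambda>y. b + r *\<^sub>R y) ` closed_cube 3) (\<lambda>\<beta> x. r ^ multi_order \<beta> *\<^sub>R gv \<beta> x) < \<infinity> \<longrightarrow>
      (\<exists>h. (\<forall>\<alpha>. multi_order \<alpha> \<le> m \<longrightarrow>
          has_weak_deriv ((\<lambda>y. b + r *\<^sub>R y) ` open_cube 2) \<alpha> (\<lambda>x. u x * v x) (h \<alpha>)) \<and>
        energy m p ((\<lambda>y. b + r *\<^sub>R y) ` open_cube 2) (\<lambda>\<alpha> x. r ^ multi_order \<alpha> *\<^sub>R h \<alpha> x)
          \<le> ennreal (C * inverse r ^ CARD('n))
            * energy m p ((\<lambda>y. b + r *\<^sub>R y) ` closed_cube 3) (\<lambda>\<beta> x. r ^ multi_order \<beta> *\<^sub>R gu \<beta> x)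
            * energy m p ((\<lambda>y. b + r *\<^sub>R y) ` closed_cube 3) (\<lambda>\<beta> x. r ^ multi_order \<beta> *\<^sub>R gv \<beta> x))"
proof -
  define \<eta> :: "'n rvec \<Rightarrow> real" where "\<eta> = box_bump 1 (\<chi> i. - 3) (\<chi> i. 3)"
  let ?K = "closed_cube 3 :: 'n rvec set"
  have \<eta>: "\<eta> \<in> test_functions ?K" "\<And>x. x \<in> open_cube 2 \<Longrightarrow> \<eta> x = 1"
    using cube_bump(1,2) by (auto simp: \<eta>_def)
  have Ks: "?K \<in> sets lebesgue" by (simp add: closed_cube_def)
  obtain c where c: "\<And>u v :: 'n rvec \<Rightarrow> 'b. u \<in> sobolev_space m p \<Longrightarrow> v \<in> sobolev_space m p \<Longrightarrow>
      (\<lambda>x. u x * v x) \<in> sobolev_space m p \<and>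
      sobolev_norm m p (\<lambda>x. u x * v x) \<le> c * sobolev_norm m p u * sobolev_norm m p v"
    using alg unfolding pointwise_algebra_def by blast
  obtain C where "C \<ge> 0" and C: "\<forall>S u (g :: _ \<Rightarrow> _ \<Rightarrow> 'b). open S \<longrightarrow> ?K \<subseteq> S \<longrightarrow>
      (\<forall>\<beta>. multi_order \<beta> \<le> m \<longrightarrow> has_weak_deriv S \<beta> u (g \<beta>)) \<longrightarrow> energy m p ?K g < \<infinity> \<longrightarrow>
      (\<lambda>x. \<eta> x *\<^sub>R u x) \<in> sobolev_space m p \<and>
      ennreal (sobolev_norm m p (\<lambda>x. \<eta> x *\<^sub>R u x) powr p) \<le> ennreal C * energy m p ?K g"
    using sobolev_cutoff[OF \<eta>(1) \<open>0 < p\<close> Ks, of m, where 'b = 'b] by (elim exE conjE) (rule that)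
  let ?d = "CARD('n)"
  have main: "\<exists>h. (\<forall>\<alpha>. multi_order \<alpha> \<le> m \<longrightarrow>
          has_weak_deriv ((\<lambda>y. b + r *\<^sub>R y) ` open_cube 2) \<alpha> (\<lambda>x. u x * v x) (h \<alpha>)) \<and>
        energy m p ((\<lambda>y. b + r *\<^sub>R y) ` open_cube 2) (\<lambda>\<alpha> x. r ^ multi_order \<alpha> *\<^sub>R h \<alpha> x)
          \<le> ennreal (\<bar>c\<bar> powr p * C * C * inverse r ^ ?d)
            * energy m p ((\<lambda>y. b + r *\<^sub>R y) ` ?K) (\<lambda>\<beta> x. r ^ multi_order \<beta> *\<^sub>R gu \<beta> x)
            * energy m p ((\<lambda>y. b + r *\<^sub>R y) ` ?K) (\<lambda>\<beta> x. r ^ multi_order \<beta> *\<^sub>R gv \<beta> x)"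
    if "0 < r" "open S" and KS: "(\<lambda>y. b + r *\<^sub>R y) ` ?K \<subseteq> S"
      and gu: "\<And>\<beta>. multi_order \<beta> \<le> m \<Longrightarrow> has_weak_deriv S \<beta> u (gu \<beta>)"
      and gv: "\<And>\<beta>. multi_order \<beta> \<le> m \<Longrightarrow> has_weak_deriv S \<beta> v (gv \<beta>)"
      and fu: "energy m p ((\<lambda>y. b + r *\<^sub>R y) ` ?K) (\<lambda>\<beta> x. r ^ multi_order \<beta> *\<^sub>R gu \<beta> x) < \<infinity>"
      and fv: "energy m p ((\<lambda>y. b + r *\<^sub>R y) ` ?K) (\<lambda>\<beta> x. r ^ multi_order \<beta> *\<^sub>R gv \<beta> x) < \<infinity>"
    for b r S and u v :: "'n rvec \<Rightarrow> 'b" and gu gv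
  proof -
    let ?A = "\<lambda>y. b + r *\<^sub>R y" and ?B = "\<lambda>x. - (inverse r *\<^sub>R b) + inverse r *\<^sub>R x"
    let ?E = "\<lambda>g. energy m p (?A ` ?K) (\<lambda>\<beta> x. r ^ multi_order \<beta> *\<^sub>R g \<beta> x)"
    have AB: "?A (?B x) = x" for x using \<open>0 < r\<close> by (simp add: algebra_simps)
    have opA: "open (?A -` S)"
      using \<open>open S\<close> by (intro open_vimage continuous_intros)
    have KA: "?K \<subseteq> ?A -` S" using KS by blast
    have local: "(\<lambda>y. \<eta> y *\<^sub>R f (?A y)) \<in> sobolev_space m p \<and>
        ennreal (sobolev_norm m p (\<lambda>y. \<eta> y *\<^sub>R f (?A y)) powr p)
          \<le> ennreal C * (ennreal (inverse r ^ ?d) * ?E g)"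
      if g: "\<And>\<beta>. multi_order \<beta> \<le> m \<Longrightarrow> has_weak_deriv S \<beta> f (g \<beta>)" and fin: "?E g < \<infinity>"
      for f :: "'n rvec \<Rightarrow> 'b" and g
    proof -
      have "(\<lambda>x. ennreal (norm (r ^ multi_order \<beta> *\<^sub>R g \<beta> x) powr p) * indicator (?A ` ?K) x)
          \<in> borel_measurable lebesgue" if "multi_order \<beta> \<le> m" for \<beta>
      proof (rule energy_measurable[OF affine_cube_sets(2) KS])
        have "locally_integrable_on (\<lambda>x. r ^ multi_order \<beta> *\<^sub>R g \<beta> x) S"
          using g[OF that] by (auto simp: has_weak_deriv_iff intro: locally_integrable_on_scaleR)
        then show "(\<lambda>x. indicat_real S x *\<^sub>R r ^ multi_order \<beta> *\<^sub>R g \<beta> x) \<in> borel_measurable lebesgue"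
          by (rule locally_integrable_borel_measurable[OF \<open>open S\<close>])
      qed
      moreover have "?A -` (?A ` ?K) = ?K" using \<open>0 < r\<close> by (auto simp: inj_def)
      ultimately have E: "energy m p ?K (\<lambda>\<beta> y. r ^ multi_order \<beta> *\<^sub>R g \<beta> (?A y))
          = ennreal (inverse r ^ ?d) * ?E g"
        using energy_affine[OF \<open>0 < r\<close>, of m "\<lambda>\<beta> x. r ^ multi_order \<beta> *\<^sub>R g \<beta> x" p "?A ` ?K" b] by simp
      moreover have "energy m p ?K (\<lambda>\<beta> y. r ^ multi_order \<beta> *\<^sub>R g \<beta> (?A y)) < \<infinity>"
        unfolding E using fin by (simp add: ennreal_mult_less_top)
      ultimately show ?thesis
        using C[rule_format, OF opA KA, of "\<lambda>y. f (?A y)" "\<lambda>\<beta> y. r ^ multi_order \<beta> *\<^sub>R g \<beta> (?A y)"]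
          has_weak_deriv_affine[OF \<open>0 < r\<close> g] by simp
    qed
    let ?U = "\<lambda>y. \<eta> y *\<^sub>R u (?A y)" and ?V = "\<lambda>y. \<eta> y *\<^sub>R v (?A y)"
    note U = local[of u gu, OF gu fu] and V = local[of v gv, OF gv fv]
    \<comment> \<open>Both factors are cut off before they are multiplied, so that w is a Sobolev
      function by the algebra property; on \<open>open_cube 2\<close> it is the rescaled
      product.\<close>
    define w where "w = (\<lambda>y. ?U y * ?V y)"
    have w: "w \<in> sobolev_space m p" "sobolev_norm m p w \<le> c * sobolev_norm m p ?U * sobolev_norm m p ?V"
      using c[of ?U ?V] U V by (auto simp: w_def)
    have nonneg: "0 \<le> sobolev_norm m p f" for f :: "'n rvec \<Rightarrow> 'b" by (simp add: sobolev_norm_def)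
    \<comment> \<open>The sign of the algebra constant is unknown, and taking p-th powers factor by
      factor needs nonnegative factors.\<close>
    have "sobolev_norm m p w \<le> \<bar>c\<bar> * sobolev_norm m p ?U * sobolev_norm m p ?V"
      using w(2) nonneg by (smt (verit) mult_right_mono)
    then have "sobolev_norm m p w powr p \<le> (\<bar>c\<bar> * sobolev_norm m p ?U * sobolev_norm m p ?V) powr p"
      using \<open>0 < p\<close> nonneg by (intro powr_mono2) auto
    also have "\<dots> = \<bar>c\<bar> powr p * sobolev_norm m p ?U powr p * sobolev_norm m p ?V powr p"
      using nonneg by (simp add: powr_mult)
    finally have "ennreal (sobolev_norm m p w powr p)
        \<le> ennreal (\<bar>c\<bar> powr p * sobolev_norm m p ?U powr p * sobolev_norm m p ?V powr p)"
      by (rule ennreal_leI)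
    also have "\<dots> = ennreal (\<bar>c\<bar> powr p) * ennreal (sobolev_norm m p ?U powr p) * ennreal (sobolev_norm m p ?V powr p)"
      by (simp add: ennreal_mult)
    also have "\<dots> \<le> ennreal (\<bar>c\<bar> powr p) * (ennreal C * (ennreal (inverse r ^ ?d) * ?E gu))
        * (ennreal C * (ennreal (inverse r ^ ?d) * ?E gv))"
      using U V by (intro mult_mono) auto
    finally have w_le: "ennreal (sobolev_norm m p w powr p) \<le> \<dots>" .
    \<comment> \<open>Undoing the dilation gives r^(-|\<alpha>|), which cancels against the factor
      r^|\<alpha>| in the energy.\<close>
    define h where "h \<alpha> x = inverse r ^ multi_order \<alpha> *\<^sub>R weak_deriv UNIV \<alpha> w (?B x)" for \<alpha> x
    have "has_weak_deriv (?A ` open_cube 2) \<alpha> (\<lambda>x. u x * v x) (h \<alpha>)"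
      if \<alpha>: "multi_order \<alpha> \<le> m" for \<alpha>
    proof -
      obtain g where "has_weak_deriv UNIV \<alpha> w g"
        using w(1) \<alpha> by (auto simp: sobolev_space_def)
      from has_weak_deriv_affine[OF _ has_weak_deriv_weak_deriv[OF this], of "inverse r" "- (inverse r *\<^sub>R b)"]
      have "has_weak_deriv UNIV \<alpha> (\<lambda>x. w (?B x)) (h \<alpha>)"
        using \<open>0 < r\<close> by (simp add: h_def[abs_def])
      then show ?thesis
      proof (rule has_weak_deriv_subset)
        fix x assume "x \<in> ?A ` open_cube 2"
        then have "?B x \<in> open_cube 2"
          unfolding affine_image_eq_vimage[OF \<open>0 < r\<close>] by simp
        then show "w (?B x) = u x * v x"
          unfolding w_def AB by (simp add: \<eta>(2))
      qed auto
    qed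
    moreover have "energy m p (?A ` open_cube 2) (\<lambda>\<alpha> x. r ^ multi_order \<alpha> *\<^sub>R h \<alpha> x)
        \<le> ennreal (\<bar>c\<bar> powr p * C * C * inverse r ^ ?d) * ?E gu * ?E gv"
    proof -
      let ?D = "\<lambda>\<alpha>. weak_deriv UNIV \<alpha> w"
      have "energy m p (?A ` open_cube 2) (\<lambda>\<alpha> x. r ^ multi_order \<alpha> *\<^sub>R h \<alpha> x)
          = energy m p (?A ` open_cube 2) (\<lambda>\<alpha> x. ?D \<alpha> (?B x))"
        using \<open>0 < r\<close> by (intro energy_cong) (simp add: h_def power_mult_distrib[symmetric])
      also have "\<dots> \<le> energy m p (?B -` UNIV) (\<lambda>\<alpha> x. ?D \<alpha> (?B x))"
        by (rule energy_mono_set) simp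
      also have "\<dots> = ennreal (inverse (inverse r) ^ ?d) * energy m p UNIV ?D"
      proof (rule energy_affine)
        fix \<alpha> :: "'n \<Rightarrow> nat" assume \<alpha>: "multi_order \<alpha> \<le> m"
        then have "integrable lebesgue (\<lambda>x. norm (?D \<alpha> x) powr p)"
          using w(1) by (simp add: sobolev_space_def)
        then have "(\<lambda>x. norm (?D \<alpha> x) powr p) \<in> borel_measurable lebesgue" by simp
        then show "(\<lambda>x. ennreal (norm (?D \<alpha> x) powr p) * indicator UNIV x) \<in> borel_measurable lebesgue"
          by simp
      qed (use \<open>0 < r\<close> in simp)
      also have "\<dots> \<le> ennreal (r ^ ?d) * (ennreal (\<bar>c\<bar> powr p) * (ennreal C * (ennreal (inverse r ^ ?d) * ?E gu))
        * (ennreal C * (ennreal (inverse r ^ ?d) * ?E gv)))"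
        using w_le energy_sobolev[OF w(1) \<open>0 < p\<close>] by (simp add: mult_left_mono)
      also have "\<dots> = ennreal (r ^ ?d * (\<bar>c\<bar> powr p * (C * inverse r ^ ?d) * (C * inverse r ^ ?d))) * ?E gu * ?E gv"
        using \<open>C \<ge> 0\<close> \<open>0 < r\<close> by (simp add: ennreal_mult ac_simps)
      also have "r ^ ?d * (\<bar>c\<bar> powr p * (C * inverse r ^ ?d) * (C * inverse r ^ ?d))
          = \<bar>c\<bar> powr p * C * C * inverse r ^ ?d"
        using \<open>0 < r\<close> by (simp add: field_simps)
      finally show ?thesis .
    qed
    ultimately show ?thesis by blast
  qed
  show ?thesis
    using \<open>C \<ge> 0\<close> by (rule_tac exI[of _ "\<bar>c\<bar> powr p * C * C"]) (rule conjI, simp, intro allI impI, rule main; (assumption | blast))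
qed

subsection \<open>The distance to the edge\<close>

lemma edge_weight_eq:
  fixes x :: "'n::{finite,linorder} rvec"
  shows "edge_weight l x = min 1 (L2_set (\<lambda>i. x $ i) (leading_coords (CARD('n) - l)))"
  by (simp add: edge_weight_def L2_set_def)

lemma edge_weight_pos_iff: "0 < edge_weight l x \<longleftrightarrow> x \<notin> edge l"
proof -
  let ?L = "leading_coords (CARD('a) - l) :: 'a set"
  have "L2_set (\<lambda>i. x $ i) ?L = 0 \<longleftrightarrow> (\<forall>i\<in>?L. x $ i = 0)"
    by (rule L2_set_eq_0_iff) simp
  then show ?thesis
    using L2_set_nonneg[of "\<lambda>i. x $ i" ?L] by (auto simp: edge_weight_eq edge_def less_le)
qed

lemma edge_weight_le_1: "edge_weight l x \<le> 1"
  by (simp add: edge_weight_def)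

text \<open>The Euclidean norm of the difference is at most the sum of the absolute values of its
  coordinates, hence at most d t, and truncation at 1 does not increase differences.\<close>

lemma edge_weight_diff:
  fixes x y :: "'n::{finite,linorder} rvec"
  assumes "\<And>i. \<bar>x $ i - y $ i\<bar> \<le> t"
  shows "\<bar>edge_weight l x - edge_weight l y\<bar> \<le> real CARD('n) * t"
proof -
  let ?L = "leading_coords (CARD('n) - l) :: 'n set"
  have "L2_set (\<lambda>i. x $ i) ?L \<le> L2_set (\<lambda>i. y $ i) ?L + real CARD('n) * t"
    if d: "\<And>i. \<bar>x $ i - y $ i\<bar> \<le> t" for x y :: "'n rvec"
  proof -
    have "L2_set (\<lambda>i. x $ i) ?L = L2_set (\<lambda>i. y $ i + (x $ i - y $ i)) ?L" by simp
    also have "\<dots> \<le> L2_set (\<lambda>i. y $ i) ?L + L2_set (\<lambda>i. x $ i - y $ i) ?L"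
      by (rule L2_set_triangle_ineq)
    also have "L2_set (\<lambda>i. x $ i - y $ i) ?L \<le> (\<Sum>i\<in>?L. \<bar>x $ i - y $ i\<bar>)"
      by (rule L2_set_le_sum_abs)
    also have "\<dots> \<le> (\<Sum>i\<in>UNIV. \<bar>x $ i - y $ i\<bar>)"
      by (rule sum_mono2) auto
    also have "\<dots> \<le> real CARD('n) * t"
      using sum_bounded_above[of UNIV "\<lambda>i. \<bar>x $ i - y $ i\<bar>" t] d by simp
    finally show ?thesis by simp
  qed
  from this[of x y] this[of y x] show ?thesis
    using assms by (auto simp: edge_weight_eq abs_minus_commute)
qed

lemma continuous_on_edge_weight: "continuous_on S (edge_weight l)"
  unfolding edge_weight_def[abs_def] by (intro continuous_intros)

lemma open_Compl_edge: "open (- edge l)"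
proof -
  have "- edge l = edge_weight l -` {0<..}"
    by (auto simp: edge_weight_pos_iff)
  then show ?thesis
    by (metis continuous_on_edge_weight open_greaterThan open_vimage)
qed

lemma edge_weight_measurable: "edge_weight l \<in> borel_measurable lebesgue"
  by (simp add: borel_measurable_continuous_onI measurable_completion continuous_on_edge_weight)

text \<open>The cubes with index \<open>(j, z)\<close> have side comparable to \<open>1 / 2 ^ j\<close>; those with \<open>j = 0\<close> fill the region
  far from the edge, where the weight is \<open>1\<close>.\<close>

lemma whitney_cover:
  fixes l :: nat
  shows "\<exists>(b :: nat \<times> ('n::{finite,linorder} \<Rightarrow> int) \<Rightarrow> 'n rvec) r I c1 c2 M. 0 < c1 \<and> (\<forall>\<nu>. 0 < r \<nu>) \<and>
    (\<forall>\<nu>\<in>I. \<forall>x\<in>(\<lambda>y. b \<nu> + r \<nu> *\<^sub>R y) ` closed_cube 3.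
       c1 * r \<nu> \<le> edge_weight l x \<and> edge_weight l x \<le> c2 * r \<nu>) \<and>
    - edge l \<subseteq> (\<Union>\<nu>\<in>I. (\<lambda>y. b \<nu> + r \<nu> *\<^sub>R y) ` open_cube 1) \<and>
    (\<forall>x. finite {\<nu>\<in>I. x \<in> (\<lambda>y. b \<nu> + r \<nu> *\<^sub>R y) ` closed_cube 3} \<and>
       card {\<nu>\<in>I. x \<in> (\<lambda>y. b \<nu> + r \<nu> *\<^sub>R y) ` closed_cube 3} \<le> M)"
proof -
  let ?\<rho> = "edge_weight l :: 'n rvec \<Rightarrow> real" and ?d = "real CARD('n)"
  have d: "?d > 0" by simp
  \<comment> \<open>A point of the outer cube and one of the inner cube differ by at most 4 r in
    each coordinate, so the weight varies by at most 4 d r. The factor 16 d makes this a quarter of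
    2^(-j).\<close>
  define r :: "nat \<times> ('n \<Rightarrow> int) \<Rightarrow> real" where "r \<nu> = 1 / (16 * ?d * 2 ^ fst \<nu>)" for \<nu>
  define b :: "nat \<times> ('n \<Rightarrow> int) \<Rightarrow> 'n rvec" where "b \<nu> = r \<nu> *\<^sub>R (\<chi> i. of_int (snd \<nu> i))" for \<nu>
  define A where "A \<nu> = (\<lambda>y. b \<nu> + r \<nu> *\<^sub>R y)" for \<nu>
  \<comment> \<open>A grid cube is kept if its inner cube meets the dyadic shell of its own scale;
    the weight at that one point then controls the weight on the outer cube.\<close>
  define I where "I = {\<nu>. \<exists>x\<in>A \<nu> ` open_cube 1. 1 / 2 ^ Suc (fst \<nu>) < ?\<rho> x \<and> ?\<rho> x \<le> 1 / 2 ^ fst \<nu>}"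
  have r: "0 < r \<nu>" for \<nu> using d by (simp add: r_def)
  have A_nth: "A \<nu> y $ i = r \<nu> * (of_int (snd \<nu> i) + y $ i)" for \<nu> y i
    by (simp add: A_def b_def distrib_left)
  \<comment> \<open>In units of 2^(-j): the shell gives 1/2 and 1, the variation is 1/4, hence 1/2 -
    1/4 and 1 + 1/4.\<close>
  have bounds: "1 / 2 ^ fst \<nu> / 4 \<le> ?\<rho> x \<and> ?\<rho> x \<le> 5 / 4 * (1 / 2 ^ fst \<nu>)"
    if \<nu>: "\<nu> \<in> I" "x \<in> A \<nu> ` closed_cube 3" for \<nu> x
  proof -
    obtain y z where z: "z \<in> open_cube 1" "1 / 2 ^ Suc (fst \<nu>) < ?\<rho> (A \<nu> z)" "?\<rho> (A \<nu> z) \<le> 1 / 2 ^ fst \<nu>"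
      and y: "y \<in> closed_cube 3" "x = A \<nu> y"
      using \<nu> unfolding I_def by blast
    have "\<bar>A \<nu> y $ i - A \<nu> z $ i\<bar> \<le> 4 * r \<nu>" for i
    proof -
      have "\<bar>y $ i\<bar> \<le> 3" "\<bar>z $ i\<bar> < 1" using y z by (auto simp: mem_closed_cube mem_open_cube)
      then have "\<bar>y $ i - z $ i\<bar> \<le> 4" by linarith
      moreover have "A \<nu> y $ i - A \<nu> z $ i = r \<nu> * (y $ i - z $ i)"
        by (simp add: A_nth algebra_simps)
      ultimately show ?thesis
        using r[of \<nu>] by (simp add: abs_mult mult.commute)
    qed
    then have "\<bar>?\<rho> x - ?\<rho> (A \<nu> z)\<bar> \<le> ?d * (4 * r \<nu>)"
      unfolding y(2) by (rule edge_weight_diff)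
    also have "\<dots> = 1 / 2 ^ fst \<nu> / 4" by (simp add: r_def)
    finally show ?thesis using z(2,3) by (simp add: abs_le_iff field_simps)
  qed
  have cover: "- edge l \<subseteq> (\<Union>\<nu>\<in>I. A \<nu> ` open_cube 1)"
  proof
    fix x :: "'n rvec" assume "x \<in> - edge l"
    then have pos: "0 < ?\<rho> x" by (simp add: edge_weight_pos_iff)
    obtain n where n: "(1 / 2) ^ n < ?\<rho> x" using real_arch_pow_inv[OF pos, of "1 / 2"] by auto
    \<comment> \<open>This least exponent is positive because the weight never exceeds 1, and its
      predecessor j is the index of the shell containing x.\<close>
    define k where "k = (LEAST n. (1 / 2) ^ n < ?\<rho> x)"
    have k: "(1 / 2) ^ k < ?\<rho> x" unfolding k_def by (rule LeastI[of "\<lambda>n. (1 / 2) ^ n < ?\<rho> x", OF n])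
    have "k \<noteq> 0" using k edge_weight_le_1[of l x] by (cases k) auto
    then obtain j where j: "k = Suc j" by (cases k) auto
    have "\<not> (1 / 2) ^ j < ?\<rho> x"
      using not_less_Least[of j "\<lambda>n. (1 / 2) ^ n < ?\<rho> x"] j unfolding k_def by simp
    with k j have J: "1 / 2 ^ Suc j < ?\<rho> x" "?\<rho> x \<le> 1 / 2 ^ j" by (simp_all add: power_one_over)
    define R where "R = 1 / (16 * ?d * 2 ^ j)"
    define \<nu> where "\<nu> = (j, \<lambda>i. \<lfloor>x $ i / R\<rfloor>)"
    have "r \<nu> = R" by (simp add: r_def R_def \<nu>_def)
    have "R > 0" using d by (simp add: R_def)
    \<comment> \<open>Fractional parts lie in [0, 1), hence in the open cube of half-side 1.\<close>
    define y :: "'n rvec" where "y = (\<chi> i. x $ i / R - of_int \<lfloor>x $ i / R\<rfloor>)"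
    have "A \<nu> y = x"
      using \<open>R > 0\<close> \<open>r \<nu> = R\<close> by (simp add: vec_eq_iff A_nth \<nu>_def y_def)
    moreover have "y \<in> open_cube 1"
      unfolding mem_open_cube y_def by (auto simp: abs_less_iff) linarith+
    ultimately have x: "x \<in> A \<nu> ` open_cube 1" by blast
    then have "\<nu> \<in> I" using J unfolding I_def mem_Collect_eq by (intro bexI[of _ x]) (simp_all add: \<nu>_def)
    with x show "x \<in> (\<Union>\<nu>\<in>I. A \<nu> ` open_cube 1)" by blast
  qed
  \<comment> \<open>Three scales, and at most seven lattice coordinates in each of the d
    directions.\<close>
  have overlap: "finite {\<nu>\<in>I. x \<in> A \<nu> ` closed_cube 3} \<and> card {\<nu>\<in>I. x \<in> A \<nu> ` closed_cube 3} \<le> 3 * 7 ^ CARD('n)"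
    for x
  proof (cases "\<exists>\<nu>\<in>I. x \<in> A \<nu> ` closed_cube 3")
    case False
    then have empty: "{\<nu>\<in>I. x \<in> A \<nu> ` closed_cube 3} = {}" by blast
    show ?thesis unfolding empty by simp
  next
    case True
    define J where "J = {j. 1 / 2 ^ j / 4 \<le> ?\<rho> x \<and> ?\<rho> x \<le> 5 / 4 * (1 / 2 ^ j)}"
    define j0 where "j0 = (LEAST j. j \<in> J)"
    have "\<exists>j. j \<in> J" using True bounds unfolding J_def by blast
    then have j0: "j0 \<in> J" unfolding j0_def by (rule LeastI_ex)
    \<comment> \<open>A cube of scale j whose enlargement contains x has lattice coordinates within
      3 of those of x divided by r. The zero function is a dummy: r depends only on j.\<close>
    define N where "N j = PiE UNIV (\<lambda>i. {\<lceil>x $ i / r (j, \<lambda>_. 0) - 3\<rceil>..\<lfloor>x $ i / r (j, \<lambda>_. 0) + 3\<rfloor>})" for j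
    have "{\<nu>\<in>I. x \<in> A \<nu> ` closed_cube 3} \<subseteq> Sigma {j0..j0 + 2} N"
    proof
      fix \<nu> assume "\<nu> \<in> {\<nu>\<in>I. x \<in> A \<nu> ` closed_cube 3}"
      then have \<nu>: "\<nu> \<in> I" "x \<in> A \<nu> ` closed_cube 3" by auto
      obtain y where y: "y \<in> closed_cube 3" "x = A \<nu> y" using \<nu> by blast
      have "fst \<nu> \<in> J" using bounds[OF \<nu>] by (simp add: J_def)
      then have le: "j0 \<le> fst \<nu>" unfolding j0_def by (rule Least_le)
      \<comment> \<open>Two scales compatible with the same weight differ by a factor of at most 5,
        which is below 8 = 2^3; counted from the least one, only three scales remain.\<close>
      have "1 / 2 ^ j0 / 4 \<le> 5 / 4 * (1 / 2 ^ fst \<nu> :: real)"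
        using j0 \<open>fst \<nu> \<in> J\<close> unfolding J_def by (blast intro: order_trans)
      then have "(2::real) ^ fst \<nu> \<le> 5 * 2 ^ j0" by (simp add: field_simps)
      moreover have "(2::real) ^ fst \<nu> \<ge> 8 * 2 ^ j0" if "fst \<nu> \<ge> j0 + 3"
        using power_increasing[OF that, of "2::real"] by (simp add: power_add)
      moreover have "(2::real) ^ j0 > 0" by simp
      ultimately have "fst \<nu> \<le> j0 + 2" by (smt (verit) not_less_eq_eq add_Suc_right numeral_2_eq_2 numeral_3_eq_3)
      moreover have "snd \<nu> \<in> N (fst \<nu>)"
      proof -
        have "snd \<nu> i \<in> {\<lceil>x $ i / r (fst \<nu>, \<lambda>_. 0) - 3\<rceil>..\<lfloor>x $ i / r (fst \<nu>, \<lambda>_. 0) + 3\<rfloor>}" for i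
        proof -
          have "r (fst \<nu>, \<lambda>_. 0) = r \<nu>" by (simp add: r_def)
          moreover have "x $ i / r \<nu> = of_int (snd \<nu> i) + y $ i"
            using r[of \<nu>] by (simp add: y(2) A_nth)
          moreover have "\<bar>y $ i\<bar> \<le> 3" using y(1) by (simp add: mem_closed_cube)
          ultimately show ?thesis unfolding atLeastAtMost_iff ceiling_le_iff le_floor_iff by auto
        qed
        then show ?thesis unfolding N_def by (intro PiE_I) simp_all
      qed
      ultimately show "\<nu> \<in> Sigma {j0..j0 + 2} N" using le by (cases \<nu>) auto
    qed
    moreover have N: "finite (N j) \<and> card (N j) \<le> 7 ^ CARD('n)" for j
    proof -
      have card7: "card {\<lceil>s - 3\<rceil>..\<lfloor>s + 3\<rfloor>} \<le> 7" for s :: real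
      proof -
        have "real_of_int (\<lfloor>s + 3\<rfloor> - \<lceil>s - 3\<rceil>) \<le> 6"
          using of_int_floor_le[of "s + 3"] le_of_int_ceiling[of "s - 3"] by simp
        then have "\<lfloor>s + 3\<rfloor> - \<lceil>s - 3\<rceil> \<le> 6" by linarith
        then show ?thesis unfolding card_atLeastAtMost_int by linarith
      qed
      have "card (N j) = (\<Prod>i\<in>UNIV. card {\<lceil>x $ i / r (j, \<lambda>_. 0) - 3\<rceil>..\<lfloor>x $ i / r (j, \<lambda>_. 0) + 3\<rfloor>})"
        unfolding N_def by (rule card_PiE) simp
      also have "\<dots> \<le> (\<Prod>i\<in>(UNIV :: 'n set). 7)"
        by (rule prod_mono) (use card7 in blast)
      finally show ?thesis by (simp add: N_def finite_PiE)
    qed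
    moreover have "card (Sigma {j0..j0 + 2} N) \<le> 3 * 7 ^ CARD('n)"
    proof -
      have "card (Sigma {j0..j0 + 2} N) = (\<Sum>j\<in>{j0..j0 + 2}. card (N j))"
        using N by (intro card_SigmaI) auto
      also have "\<dots> \<le> (\<Sum>j\<in>{j0..j0 + 2}. 7 ^ CARD('n))"
        using N by (intro sum_mono) auto
      finally show ?thesis by simp
    qed
    moreover have "finite (Sigma {j0..j0 + 2} N)"
      using N by (intro finite_SigmaI) auto
    ultimately show ?thesis
      by (meson card_mono finite_subset order_trans)
  qed
  show ?thesis
  proof (intro exI conjI)
    \<comment> \<open>Since 2^(-j) = 16 d r, the bounds 1/4 and 5/4 become 4 d r and 20 d r.\<close>
    show "0 < 4 * ?d" using d by simp
    show "\<forall>\<nu>. 0 < r \<nu>" using r by blast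
    show "\<forall>\<nu>\<in>I. \<forall>x\<in>(\<lambda>y. b \<nu> + r \<nu> *\<^sub>R y) ` closed_cube 3.
       4 * ?d * r \<nu> \<le> ?\<rho> x \<and> ?\<rho> x \<le> 20 * ?d * r \<nu>"
      using bounds unfolding A_def by (auto simp: r_def field_simps)
    show "- edge l \<subseteq> (\<Union>\<nu>\<in>I. (\<lambda>y. b \<nu> + r \<nu> *\<^sub>R y) ` open_cube 1)"
      using cover unfolding A_def .
    show "\<forall>x. finite {\<nu>\<in>I. x \<in> (\<lambda>y. b \<nu> + r \<nu> *\<^sub>R y) ` closed_cube 3} \<and>
       card {\<nu>\<in>I. x \<in> (\<lambda>y. b \<nu> + r \<nu> *\<^sub>R y) ` closed_cube 3} \<le> 3 * 7 ^ CARD('n)"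
      using overlap unfolding A_def by blast
  qed
qed

text \<open>With q = \<rho> / r between c1 and c2, the power q^s is monotone in q, so it is at most
  c1^s + c2^s whatever the sign of s. Summing over the orders k and both signs of the exponent gives
  one constant.\<close>

lemma powr_comparable:
  fixes c1 c2 \<sigma> :: real
  assumes "0 < c1"
  shows "\<exists>D\<ge>0. \<forall>k\<le>m. \<forall>r \<rho>. 0 < r \<longrightarrow> c1 * r \<le> \<rho> \<longrightarrow> \<rho> \<le> c2 * r \<longrightarrow>
    \<rho> powr (real k - \<sigma>) \<le> D * r powr (real k - \<sigma>) \<and> r powr (real k - \<sigma>) \<le> D * \<rho> powr (real k - \<sigma>)"
proof -
  define D where "D s = c1 powr s + c2 powr s" for s
  have D: "q powr s \<le> D s" if "c1 \<le> q" "q \<le> c2" for q s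
  proof (cases "s \<ge> 0")
    case True
    then have "q powr s \<le> c2 powr s" using that assms by (intro powr_mono2) auto
    then show ?thesis by (simp add: D_def add_increasing)
  next
    case False
    then have "q powr s \<le> c1 powr s" using that assms by (intro powr_mono2') auto
    then show ?thesis by (simp add: D_def add_increasing2)
  qed
  define E where "E = (\<Sum>k\<le>m. D (real k - \<sigma>) + D (\<sigma> - real k))"
  have D0: "0 \<le> D s" for s by (simp add: D_def)
  have E: "D (real k - \<sigma>) \<le> E" "D (\<sigma> - real k) \<le> E" if "k \<le> m" for k
  proof -
    have "D (real k - \<sigma>) + D (\<sigma> - real k) \<le> E"
      unfolding E_def using that D0 by (intro member_le_sum[where f = "\<lambda>k. D (real k - \<sigma>) + D (\<sigma> - real k)"]) auto
    then show "D (real k - \<sigma>) \<le> E" "D (\<sigma> - real k) \<le> E"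
      using D0[of "real k - \<sigma>"] D0[of "\<sigma> - real k"] by linarith+
  qed
  show ?thesis
  proof (intro exI[of _ E] conjI allI impI)
    show "0 \<le> E" unfolding E_def by (intro sum_nonneg add_nonneg_nonneg D0)
    fix k r \<rho> assume k: "k \<le> m" and r: "0 < r" "c1 * r \<le> \<rho>" "\<rho> \<le> c2 * r"
    define q where "q = \<rho> / r"
    have q: "c1 \<le> q" "q \<le> c2" using r by (auto simp: q_def field_simps)
    then have "q > 0" using assms by simp
    have \<rho>: "\<rho> = q * r" using r by (simp add: q_def)
    let ?s = "real k - \<sigma>"
    have "\<rho> powr ?s = q powr ?s * r powr ?s" using \<rho> by (simp add: powr_mult)
    also have "\<dots> \<le> E * r powr ?s"
      using D[OF q] E[OF k] by (intro mult_right_mono) (auto intro: order_trans)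
    finally show "\<rho> powr ?s \<le> E * r powr ?s" .
    have "r powr ?s = q powr (\<sigma> - real k) * \<rho> powr ?s"
      using \<open>q > 0\<close> powr_add[of q "\<sigma> - real k" ?s] by (simp add: \<rho> powr_mult)
    also have "\<dots> \<le> E * \<rho> powr ?s"
      using D[OF q] E[OF k] by (intro mult_right_mono) (auto intro: order_trans)
    finally show "r powr ?s \<le> E * \<rho> powr ?s" .
  qed
qed

subsection \<open>Kondratiev norms as energies\<close>

text \<open>Acting on families of derivatives, it makes the p-th power of the Kondratiev norm an
  energy on the complement of the edge, which is localised by shrinking the set.\<close>

definition edge_weighted ::
    "nat \<Rightarrow> real \<Rightarrow> (('n \<Rightarrow> nat) \<Rightarrow> 'n rvec \<Rightarrow> 'b) \<Rightarrow> ('n::{finite,linorder} \<Rightarrow> nat) \<Rightarrow> 'n rvec \<Rightarrow> 'b::euclidean_space" where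
  "edge_weighted l a g \<alpha> x = edge_weight l x powr (real (multi_order \<alpha>) - a) *\<^sub>R g \<alpha> x"

lemma edge_weighted_measurable:
  assumes "has_weak_deriv (- edge l) \<alpha> u (g \<alpha>)"
  shows "(\<lambda>x. ennreal (norm (edge_weighted l a g \<alpha> x) powr p) * indicator (- edge l) x) \<in> borel_measurable lebesgue"
proof (rule energy_measurable)
  show "- edge l \<in> sets lebesgue" by (simp add: open_Compl_edge)
  have g: "(\<lambda>x. indicat_real (- edge l) x *\<^sub>R g \<alpha> x) \<in> borel_measurable lebesgue"
    using assms by (intro locally_integrable_borel_measurable open_Compl_edge) (simp add: has_weak_deriv_iff)
  have "(\<lambda>x. (edge_weight l x powr (real (multi_order \<alpha>) - a)) *\<^sub>R (indicat_real (- edge l) x *\<^sub>R g \<alpha> x))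
      \<in> borel_measurable lebesgue"
    by (intro borel_measurable_scaleR powr_real_measurable edge_weight_measurable g) simp
  then show "(\<lambda>x. indicat_real (- edge l) x *\<^sub>R edge_weighted l a g \<alpha> x) \<in> borel_measurable lebesgue"
    by (simp add: edge_weighted_def mult.commute)
qed simp

lemma kondratiev_weak_deriv:
  assumes "u \<in> kondratiev_space m a p l" "multi_order \<alpha> \<le> m"
  shows "has_weak_deriv (- edge l) \<alpha> u (weak_deriv (- edge l) \<alpha> u)"
proof -
  obtain g where "has_weak_deriv (- edge l) \<alpha> u g"
    using assms by (auto simp: kondratiev_space_def)
  then show ?thesis by (rule has_weak_deriv_weak_deriv)
qed

lemma kondratiev_energy:
  assumes u: "u \<in> kondratiev_space m a p l" and "0 < p"
  shows "energy m p (- edge l) (edge_weighted l a (\<lambda>\<alpha>. weak_deriv (- edge l) \<alpha> u))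
    = ennreal (kondratiev_norm m a p l u powr p)"
proof -
  let ?f = "\<lambda>\<alpha> x. norm (edge_weight l x powr (real (multi_order \<alpha>) - a) *\<^sub>R weak_deriv (- edge l) \<alpha> u x) powr p"
  have "energy m p (- edge l) (edge_weighted l a (\<lambda>\<alpha>. weak_deriv (- edge l) \<alpha> u))
      = (\<Sum>\<alpha> | multi_order \<alpha> \<le> m. ennreal (set_lebesgue_integral lebesgue (- edge l) (?f \<alpha>)))"
    unfolding energy_def edge_weighted_def
  proof (rule sum.cong[OF refl])
    fix \<alpha> :: "'a \<Rightarrow> nat" assume "\<alpha> \<in> {\<alpha>. multi_order \<alpha> \<le> m}"
    then have "integrable lebesgue (\<lambda>x. indicat_real (- edge l) x *\<^sub>R ?f \<alpha> x)"
      using u by (simp add: kondratiev_space_def set_integrable_def)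
    then have "(\<integral>\<^sup>+x. ennreal (indicat_real (- edge l) x *\<^sub>R ?f \<alpha> x) \<partial>lebesgue)
        = ennreal (set_lebesgue_integral lebesgue (- edge l) (?f \<alpha>))"
      unfolding set_lebesgue_integral_def by (rule nn_integral_eq_integral) simp
    moreover have "ennreal (indicat_real (- edge l) x *\<^sub>R ?f \<alpha> x) = ennreal (?f \<alpha> x) * indicator (- edge l) x" for x
      by (simp add: indicator_def)
    ultimately show "(\<integral>\<^sup>+x\<in>- edge l. ennreal (?f \<alpha> x) \<partial>lebesgue)
        = ennreal (set_lebesgue_integral lebesgue (- edge l) (?f \<alpha>))"
      by (simp only:)
  qed
  also have "\<dots> = ennreal (\<Sum>\<alpha> | multi_order \<alpha> \<le> m. set_lebesgue_integral lebesgue (- edge l) (?f \<alpha>))"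
    by (intro sum_ennreal) (simp add: set_lebesgue_integral_def)
  also have "(\<Sum>\<alpha> | multi_order \<alpha> \<le> m. set_lebesgue_integral lebesgue (- edge l) (?f \<alpha>))
      = kondratiev_norm m a p l u powr p"
    using \<open>0 < p\<close> by (simp add: kondratiev_norm_def powr_powr sum_nonneg set_lebesgue_integral_def)
  finally show ?thesis .
qed

lemma kondratiev_spaceI:
  assumes "u \<in> borel_measurable (lebesgue_on (- edge l))"
    and g: "\<And>\<alpha>. multi_order \<alpha> \<le> m \<Longrightarrow> \<exists>g. has_weak_deriv (- edge l) \<alpha> u g"
    and fin: "energy m p (- edge l) (edge_weighted l a (\<lambda>\<alpha>. weak_deriv (- edge l) \<alpha> u)) < \<infinity>"
  shows "u \<in> kondratiev_space m a p l"
proof -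
  have "set_integrable lebesgue (- edge l)
      (\<lambda>x. norm (edge_weight l x powr (real (multi_order \<alpha>) - a) *\<^sub>R weak_deriv (- edge l) \<alpha> u x) powr p)"
    if \<alpha>: "multi_order \<alpha> \<le> m" for \<alpha>
    unfolding set_integrable_def
  proof (rule integrableI_nonneg)
    let ?D = "\<lambda>\<alpha>. weak_deriv (- edge l) \<alpha> u"
    let ?f = "\<lambda>x. norm (edge_weight l x powr (real (multi_order \<alpha>) - a) *\<^sub>R ?D \<alpha> x) powr p"
    have eq: "ennreal (indicat_real (- edge l) x *\<^sub>R ?f x)
        = ennreal (norm (edge_weighted l a ?D \<alpha> x) powr p) * indicator (- edge l) x" for x
      by (simp add: indicator_def edge_weighted_def)
    have m: "(\<lambda>x. ennreal (norm (edge_weighted l a ?D \<alpha> x) powr p) * indicator (- edge l) x) \<in> borel_measurable lebesgue"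
      using g[OF \<alpha>] has_weak_deriv_weak_deriv by (intro edge_weighted_measurable[of _ _ u]) blast
    have "(\<lambda>x. enn2real (ennreal (indicat_real (- edge l) x *\<^sub>R ?f x))) \<in> borel_measurable lebesgue"
      unfolding eq using m by (rule borel_measurable_enn2real)
    then show "(\<lambda>x. indicat_real (- edge l) x *\<^sub>R ?f x) \<in> borel_measurable lebesgue"
      by simp
    have "(\<integral>\<^sup>+x. ennreal (indicat_real (- edge l) x *\<^sub>R ?f x) \<partial>lebesgue)
        \<le> energy m p (- edge l) (edge_weighted l a ?D)"
      unfolding eq energy_def
      using \<alpha> by (intro member_le_sum[where f = "\<lambda>\<alpha>. \<integral>\<^sup>+x\<in>- edge l. ennreal (norm (edge_weighted l a ?D \<alpha> x) powr p) \<partial>lebesgue"]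
          finite_multi_order) auto
    then show "(\<integral>\<^sup>+x. ennreal (indicat_real (- edge l) x *\<^sub>R ?f x) \<partial>lebesgue) < \<infinity>"
      using fin by (rule le_less_trans)
  qed simp
  with assms(1) g show ?thesis
    by (simp add: kondratiev_space_def)
qed

text \<open>Where the weight is comparable to r, its power of exponent k - a may be traded for r^(k
  - a) = r^(-a) r^k. Part (1) is for the two factors, part (2) for the product, with the exponent of
  the product in the place of a.\<close>

lemma energy_edge_weighted_le:
  fixes g :: "('n::{finite,linorder} \<Rightarrow> nat) \<Rightarrow> 'n rvec \<Rightarrow> 'b::euclidean_space"
  assumes "0 \<le> p" "0 < r" "0 \<le> D" and K: "K \<subseteq> - edge l" "K \<in> sets lebesgue"
    and g: "\<And>\<alpha>. multi_order \<alpha> \<le> m \<Longrightarrow> has_weak_deriv (- edge l) \<alpha> u (g \<alpha>)"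
  shows "(\<And>k x. k \<le> m \<Longrightarrow> x \<in> K \<Longrightarrow> r powr (real k - a) \<le> D * edge_weight l x powr (real k - a)) \<Longrightarrow>
      energy m p K (\<lambda>\<alpha> x. r ^ multi_order \<alpha> *\<^sub>R g \<alpha> x)
        \<le> ennreal ((D * r powr a) powr p) * energy m p K (edge_weighted l a g)"
    and "(\<And>k x. k \<le> m \<Longrightarrow> x \<in> K \<Longrightarrow> edge_weight l x powr (real k - a) \<le> D * r powr (real k - a)) \<Longrightarrow>
      energy m p K (edge_weighted l a g)
        \<le> ennreal ((D * r powr (- a)) powr p) * energy m p K (\<lambda>\<alpha> x. r ^ multi_order \<alpha> *\<^sub>R g \<alpha> x)"
proof -
  have split: "r ^ k = r powr a * r powr (real k - a)" for k
    using \<open>0 < r\<close> by (simp add: powr_add[symmetric] powr_realpow)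
  have split': "r powr (real k - a) = r powr (- a) * r ^ k" for k
    using \<open>0 < r\<close> by (simp add: powr_diff powr_minus powr_realpow divide_inverse mult.commute)
  show "energy m p K (\<lambda>\<alpha> x. r ^ multi_order \<alpha> *\<^sub>R g \<alpha> x)
      \<le> ennreal ((D * r powr a) powr p) * energy m p K (edge_weighted l a g)"
    if D: "\<And>k x. k \<le> m \<Longrightarrow> x \<in> K \<Longrightarrow> r powr (real k - a) \<le> D * edge_weight l x powr (real k - a)"
  proof (rule energy_le_scaled)
    show "0 \<le> D * r powr a" using \<open>0 \<le> D\<close> by simp
    fix \<alpha> :: "'n \<Rightarrow> nat" assume \<alpha>: "multi_order \<alpha> \<le> m"
    show "(\<lambda>x. ennreal (norm (edge_weighted l a g \<alpha> x) powr p) * indicator K x) \<in> borel_measurable lebesgue"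
      by (rule energy_measurable_subset[OF edge_weighted_measurable[where u = u and g = g, OF g[OF \<alpha>]] K])
    fix x assume "x \<in> K"
    have "norm (r ^ multi_order \<alpha> *\<^sub>R g \<alpha> x) = r powr a * (r powr (real (multi_order \<alpha>) - a) * norm (g \<alpha> x))"
      using \<open>0 < r\<close> by (simp add: split[of "multi_order \<alpha>"])
    also have "\<dots> \<le> r powr a * ((D * edge_weight l x powr (real (multi_order \<alpha>) - a)) * norm (g \<alpha> x))"
      using D[OF \<alpha> \<open>x \<in> K\<close>] by (intro mult_left_mono mult_right_mono) auto
    also have "\<dots> = D * r powr a * norm (edge_weighted l a g \<alpha> x)"
      by (simp add: edge_weighted_def)
    finally show "norm (r ^ multi_order \<alpha> *\<^sub>R g \<alpha> x) \<le> D * r powr a * norm (edge_weighted l a g \<alpha> x)" .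
  qed (use \<open>0 \<le> p\<close> in simp)
  show "energy m p K (edge_weighted l a g)
      \<le> ennreal ((D * r powr (- a)) powr p) * energy m p K (\<lambda>\<alpha> x. r ^ multi_order \<alpha> *\<^sub>R g \<alpha> x)"
    if D: "\<And>k x. k \<le> m \<Longrightarrow> x \<in> K \<Longrightarrow> edge_weight l x powr (real k - a) \<le> D * r powr (real k - a)"
  proof (rule energy_le_scaled)
    show "0 \<le> D * r powr (- a)" using \<open>0 \<le> D\<close> by simp
    fix \<alpha> :: "'n \<Rightarrow> nat" assume \<alpha>: "multi_order \<alpha> \<le> m"
    show "(\<lambda>x. ennreal (norm (r ^ multi_order \<alpha> *\<^sub>R g \<alpha> x) powr p) * indicator K x) \<in> borel_measurable lebesgue"
    proof (rule energy_measurable[OF K(2,1)])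
      show "(\<lambda>x. indicat_real (- edge l) x *\<^sub>R r ^ multi_order \<alpha> *\<^sub>R g \<alpha> x) \<in> borel_measurable lebesgue"
        using g[OF \<alpha>]
        by (intro locally_integrable_borel_measurable open_Compl_edge locally_integrable_on_scaleR)
          (simp add: has_weak_deriv_iff)
    qed
    fix x assume "x \<in> K"
    have "norm (edge_weighted l a g \<alpha> x) = edge_weight l x powr (real (multi_order \<alpha>) - a) * norm (g \<alpha> x)"
      by (simp add: edge_weighted_def)
    also have "\<dots> \<le> (D * r powr (real (multi_order \<alpha>) - a)) * norm (g \<alpha> x)"
      using D[OF \<alpha> \<open>x \<in> K\<close>] by (intro mult_right_mono) auto
    also have "\<dots> = D * r powr (- a) * norm (r ^ multi_order \<alpha> *\<^sub>R g \<alpha> x)"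
      using \<open>0 < r\<close> by (simp add: split'[of "multi_order \<alpha>"])
    finally show "norm (edge_weighted l a g \<alpha> x) \<le> D * r powr (- a) * norm (r ^ multi_order \<alpha> *\<^sub>R g \<alpha> x)" .
  qed (use \<open>0 \<le> p\<close> in simp)
qed

text \<open>The exponent \<open>2 a - d / p\<close> is the one for which all powers of the side length \<open>r\<close> cancel.\<close>

lemma scaling_exponents_cancel:
  fixes a p r D1 D2 C :: real
  assumes "0 < p" "0 < r" "0 \<le> D1" "0 \<le> D2"
  shows "(D2 * r powr (- (2 * a - real d / p))) powr p * (C * inverse r ^ d) * (D1 * r powr a) powr p * (D1 * r powr a) powr p
    = D2 powr p * C * D1 powr p * D1 powr p"
proof -
  have "inverse r ^ d = r powr (- real d)"
    using assms by (simp add: powr_minus powr_realpow power_inverse)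
  then have "(r powr (- (2 * a - real d / p))) powr p * inverse r ^ d * (r powr a) powr p * (r powr a) powr p
      = r powr (- (2 * a - real d / p) * p + (- real d) + a * p + a * p)"
    by (simp only: powr_powr powr_add)
  also have "- (2 * a - real d / p) * p + (- real d) + a * p + a * p = 0"
    using assms by (simp add: field_simps)
  finally have "(r powr (- (2 * a - real d / p))) powr p * inverse r ^ d * (r powr a) powr p * (r powr a) powr p = 1"
    using assms by simp
  then have "D2 powr p * C * D1 powr p * D1 powr p
      * ((r powr (- (2 * a - real d / p))) powr p * inverse r ^ d * (r powr a) powr p * (r powr a) powr p)
      = D2 powr p * C * D1 powr p * D1 powr p"
    by (simp only: mult_1_right)
  then show ?thesis
    using assms by (simp only: powr_mult powr_ge_zero ac_simps)
qed

text \<open>Formulated with p-th powers, because these are what adds up over the cubes; the root is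
  taken once at the end.\<close>

lemma kondratiev_product:
  fixes p a :: real and m l :: nat
  assumes "0 < p"
    and "pointwise_algebra
           (sobolev_space m p :: ('n::{finite,linorder} rvec \<Rightarrow> 'b::{real_normed_field,euclidean_space}) set)
           (sobolev_norm m p)"
  shows "\<exists>C\<ge>0. \<forall>u\<in>kondratiev_space m a p l. \<forall>v\<in>kondratiev_space m a p l.
           (\<lambda>x::'n rvec. u x * v x :: 'b) \<in> kondratiev_space m (2 * a - real CARD('n) / p) p l \<and>
           kondratiev_norm m (2 * a - real CARD('n) / p) p l (\<lambda>x. u x * v x) powr p
             \<le> C * kondratiev_norm m a p l u powr p * kondratiev_norm m a p l v powr p"
proof -
  let ?\<Omega> = "- edge l :: 'n rvec set" and ?\<sigma> = "2 * a - real CARD('n) / p" and ?d = "CARD('n)"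
  obtain C where "C \<ge> 0" and C: "\<forall>b r S (u :: 'n rvec \<Rightarrow> 'b) v gu gv. 0 < r \<longrightarrow> open S \<longrightarrow>
      (\<lambda>y. b + r *\<^sub>R y) ` closed_cube 3 \<subseteq> S \<longrightarrow>
      (\<forall>\<beta>. multi_order \<beta> \<le> m \<longrightarrow> has_weak_deriv S \<beta> u (gu \<beta>)) \<longrightarrow>
      (\<forall>\<beta>. multi_order \<beta> \<le> m \<longrightarrow> has_weak_deriv S \<beta> v (gv \<beta>)) \<longrightarrow>
      energy m p ((\<lambda>y. b + r *\<^sub>R y) ` closed_cube 3) (\<lambda>\<beta> x. r ^ multi_order \<beta> *\<^sub>R gu \<beta> x) < \<infinity> \<longrightarrow>
      energy m p ((\<lambda>y. b + r *\<^sub>R y) ` closed_cube 3) (\<lambda>\<beta> x. r ^ multi_order \<beta> *\<^sub>R gv \<beta> x) < \<infinity> \<longrightarrow>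
      (\<exists>h. (\<forall>\<alpha>. multi_order \<alpha> \<le> m \<longrightarrow>
          has_weak_deriv ((\<lambda>y. b + r *\<^sub>R y) ` open_cube 2) \<alpha> (\<lambda>x. u x * v x) (h \<alpha>)) \<and>
        energy m p ((\<lambda>y. b + r *\<^sub>R y) ` open_cube 2) (\<lambda>\<alpha> x. r ^ multi_order \<alpha> *\<^sub>R h \<alpha> x)
          \<le> ennreal (C * inverse r ^ CARD('n))
            * energy m p ((\<lambda>y. b + r *\<^sub>R y) ` closed_cube 3) (\<lambda>\<beta> x. r ^ multi_order \<beta> *\<^sub>R gu \<beta> x)
            * energy m p ((\<lambda>y. b + r *\<^sub>R y) ` closed_cube 3) (\<lambda>\<beta> x. r ^ multi_order \<beta> *\<^sub>R gv \<beta> x))"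
    using local_product_estimate[OF assms] by (elim exE conjE) (rule that)
  obtain b :: "nat \<times> ('n \<Rightarrow> int) \<Rightarrow> 'n rvec" and r I c1 c2 M where "0 < c1" and r': "\<forall>\<nu>. 0 < r \<nu>"
    and weight': "\<forall>\<nu>\<in>I. \<forall>x\<in>(\<lambda>y. b \<nu> + r \<nu> *\<^sub>R y) ` closed_cube 3.
       c1 * r \<nu> \<le> edge_weight l x \<and> edge_weight l x \<le> c2 * r \<nu>"
    and cover: "?\<Omega> \<subseteq> (\<Union>\<nu>\<in>I. (\<lambda>y. b \<nu> + r \<nu> *\<^sub>R y) ` open_cube 1)"
    and overlap: "\<forall>x. finite {\<nu>\<in>I. x \<in> (\<lambda>y. b \<nu> + r \<nu> *\<^sub>R y) ` closed_cube 3} \<and>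
       card {\<nu>\<in>I. x \<in> (\<lambda>y. b \<nu> + r \<nu> *\<^sub>R y) ` closed_cube 3} \<le> M"
    using whitney_cover[of l, where 'n = 'n] by (elim exE conjE) (rule that)
  note r = r'[rule_format] and weight = weight'[rule_format]
  define A where "A \<nu> = (\<lambda>y. b \<nu> + r \<nu> *\<^sub>R y)" for \<nu>
  let ?K = "\<lambda>\<nu>. A \<nu> ` closed_cube 3" and ?U = "\<lambda>\<nu>. A \<nu> ` open_cube 2" and ?B = "\<lambda>\<nu>. A \<nu> ` open_cube 1"
  have BU: "?B \<nu> \<subseteq> ?U \<nu>" and UK: "?U \<nu> \<subseteq> ?K \<nu>" for \<nu>
    by (auto intro!: image_mono open_cube_mono open_cube_subset_closed_cube)
  have K\<Omega>: "?K \<nu> \<subseteq> ?\<Omega>" if "\<nu> \<in> I" for \<nu>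
  proof
    fix x assume "x \<in> ?K \<nu>"
    then have "0 < edge_weight l x"
      using weight[OF that, of x] mult_pos_pos[OF \<open>0 < c1\<close> r[of \<nu>]] unfolding A_def by linarith
    then show "x \<in> ?\<Omega>" by (simp add: edge_weight_pos_iff)
  qed
  have U\<Omega>: "?U \<nu> \<subseteq> ?\<Omega>" and B\<Omega>: "?B \<nu> \<subseteq> ?\<Omega>" if "\<nu> \<in> I" for \<nu>
    using order_trans[OF UK K\<Omega>[OF that]] order_trans[OF BU order_trans[OF UK K\<Omega>[OF that]]] .
  have sets: "?K \<nu> \<in> sets lebesgue" "?B \<nu> \<in> sets lebesgue" for \<nu>
    unfolding A_def by (rule affine_cube_sets(2)) (rule affine_cube_sets(1)[OF r])
  have opU: "open (?U \<nu>)" "open (?B \<nu>)" for \<nu>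
    unfolding A_def by (intro open_affine_cube r)+
  obtain D1 where "D1 \<ge> 0" and D1: "\<And>k r \<rho>. k \<le> m \<Longrightarrow> 0 < r \<Longrightarrow> c1 * r \<le> \<rho> \<Longrightarrow> \<rho> \<le> c2 * r \<Longrightarrow>
      r powr (real k - a) \<le> D1 * \<rho> powr (real k - a)"
    using powr_comparable[OF \<open>0 < c1\<close>, of m c2 a] by blast
  obtain D2 where "D2 \<ge> 0" and D2: "\<And>k r \<rho>. k \<le> m \<Longrightarrow> 0 < r \<Longrightarrow> c1 * r \<le> \<rho> \<Longrightarrow> \<rho> \<le> c2 * r \<Longrightarrow>
      \<rho> powr (real k - ?\<sigma>) \<le> D2 * r powr (real k - ?\<sigma>)"
    using powr_comparable[OF \<open>0 < c1\<close>, of m c2 ?\<sigma>] by blast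
  \<comment> \<open>The factor that is left when all powers of r have cancelled, the same for every
    cube.\<close>
  define C' where "C' = D2 powr p * C * D1 powr p * D1 powr p"
  have "C' \<ge> 0" using \<open>C \<ge> 0\<close> by (simp add: C'_def)
  have main: "(\<lambda>x. u x * v x) \<in> kondratiev_space m ?\<sigma> p l \<and>
      kondratiev_norm m ?\<sigma> p l (\<lambda>x. u x * v x) powr p
        \<le> (C' * real M) * kondratiev_norm m a p l u powr p * kondratiev_norm m a p l v powr p"
    if u: "u \<in> kondratiev_space m a p l" and v: "v \<in> kondratiev_space m a p l" for u v :: "'n rvec \<Rightarrow> 'b"
  proof -
    let ?w = "\<lambda>x. u x * v x"
    define gu gv gw where g_def: "gu = (\<lambda>\<alpha>. weak_deriv ?\<Omega> \<alpha> u)" "gv = (\<lambda>\<alpha>. weak_deriv ?\<Omega> \<alpha> v)"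
      "gw = (\<lambda>\<alpha>. weak_deriv ?\<Omega> \<alpha> ?w)"
    have gu: "has_weak_deriv ?\<Omega> \<alpha> u (gu \<alpha>)" and gv: "has_weak_deriv ?\<Omega> \<alpha> v (gv \<alpha>)"
      if "multi_order \<alpha> \<le> m" for \<alpha>
      using kondratiev_weak_deriv[OF u that] kondratiev_weak_deriv[OF v that] by (simp_all add: g_def)
    let ?F = "\<lambda>g. energy m p ?\<Omega> (edge_weighted l a g)"
    have Fu: "?F gu = ennreal (kondratiev_norm m a p l u powr p)"
      and Fv: "?F gv = ennreal (kondratiev_norm m a p l v powr p)"
      using kondratiev_energy[OF u \<open>0 < p\<close>] kondratiev_energy[OF v \<open>0 < p\<close>] by (simp_all add: g_def)
    let ?E = "\<lambda>\<nu> g. energy m p (?K \<nu>) (\<lambda>\<beta> x. r \<nu> ^ multi_order \<beta> *\<^sub>R g \<beta> x)"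
    let ?F' = "\<lambda>\<nu> g. energy m p (?K \<nu>) (edge_weighted l a g)"
    have E_le: "?E \<nu> g \<le> ennreal ((D1 * r \<nu> powr a) powr p) * ?F' \<nu> g"
      if "\<nu> \<in> I" "\<And>\<alpha>. multi_order \<alpha> \<le> m \<Longrightarrow> has_weak_deriv ?\<Omega> \<alpha> f (g \<alpha>)"
      for \<nu> and f :: "'n rvec \<Rightarrow> 'b" and g
    proof (rule energy_edge_weighted_le(1)[where u = f])
      show "r \<nu> powr (real k - a) \<le> D1 * edge_weight l x powr (real k - a)"
        if "k \<le> m" "x \<in> ?K \<nu>" for k x
        using weight[OF \<open>\<nu> \<in> I\<close> that(2)[unfolded A_def]] by (intro D1[OF that(1) r]) auto
    qed (use \<open>0 < p\<close> r \<open>D1 \<ge> 0\<close> K\<Omega> sets that in auto)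
    have E_fin: "?E \<nu> gu < \<infinity>" "?E \<nu> gv < \<infinity>" if "\<nu> \<in> I" for \<nu>
    proof -
      have "?F' \<nu> gu \<le> ?F gu" "?F' \<nu> gv \<le> ?F gv"
        using K\<Omega>[OF that] by (auto intro: energy_mono_set)
      then have "?F' \<nu> gu < \<infinity>" "?F' \<nu> gv < \<infinity>"
        unfolding Fu Fv by (auto intro: le_less_trans)
      then show "?E \<nu> gu < \<infinity>" "?E \<nu> gv < \<infinity>"
        by (auto intro!: le_less_trans[OF E_le[OF that gu]] le_less_trans[OF E_le[OF that gv]]
            simp: ennreal_mult_less_top)
    qed
    define local where "local \<nu> h \<longleftrightarrow> (\<forall>\<alpha>. multi_order \<alpha> \<le> m \<longrightarrow> has_weak_deriv (?U \<nu>) \<alpha> ?w (h \<alpha>)) \<and>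
        energy m p (?U \<nu>) (\<lambda>\<alpha> x. r \<nu> ^ multi_order \<alpha> *\<^sub>R h \<alpha> x)
          \<le> ennreal (C * inverse (r \<nu>) ^ ?d) * ?E \<nu> gu * ?E \<nu> gv" for \<nu> h
    have "\<exists>h. local \<nu> h" if "\<nu> \<in> I" for \<nu>
      using C[rule_format, OF r open_Compl_edge, of "b \<nu>" \<nu> l u gu v gv] K\<Omega>[OF that] gu gv E_fin[OF that]
      unfolding local_def A_def by blast
    then obtain h where h_local: "\<And>\<nu>. \<nu> \<in> I \<Longrightarrow> local \<nu> (h \<nu>)" by metis
    then have h: "\<And>\<nu> \<alpha>. \<nu> \<in> I \<Longrightarrow> multi_order \<alpha> \<le> m \<Longrightarrow> has_weak_deriv (?U \<nu>) \<alpha> ?w (h \<nu> \<alpha>)"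
      and h_le: "\<And>\<nu>. \<nu> \<in> I \<Longrightarrow> energy m p (?U \<nu>) (\<lambda>\<alpha> x. r \<nu> ^ multi_order \<alpha> *\<^sub>R h \<nu> \<alpha> x)
          \<le> ennreal (C * inverse (r \<nu>) ^ ?d) * ?E \<nu> gu * ?E \<nu> gv"
      unfolding local_def by blast+
    \<comment> \<open>The gluing bump of the reference cube, transported to the cube with index
      \<nu>.\<close>
    define \<psi> :: "nat \<times> ('n \<Rightarrow> int) \<Rightarrow> 'n rvec \<Rightarrow> real" where
      "\<psi> \<nu> x = box_bump 2 (\<chi> i. - (3 / 2)) (\<chi> i. 3 / 2) (- (inverse (r \<nu>) *\<^sub>R b \<nu>) + inverse (r \<nu>) *\<^sub>R x)" for \<nu> x
    have \<psi>: "\<psi> \<nu> \<in> test_functions (?U \<nu>)" for \<nu>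
      using test_functions_affine[OF _ cube_bump(3), of "inverse (r \<nu>)" "- (inverse (r \<nu>) *\<^sub>R b \<nu>)"] r[of \<nu>]
      unfolding A_def affine_image_eq_vimage[OF r] \<psi>_def[abs_def] by simp
    have \<psi>1: "\<psi> \<nu> x = 1" if "x \<in> ?B \<nu>" for \<nu> x
      using that unfolding A_def affine_image_eq_vimage[OF r] \<psi>_def by (simp add: cube_bump(4))
    \<comment> \<open>Existence of a global weak derivative has to come before the norm estimate:
      only then is \<open>gw\<close> a weak derivative of the product and comparable with the local
      ones.\<close>
    have ex_w: "\<exists>g. has_weak_deriv ?\<Omega> \<alpha> ?w g" if \<alpha>: "multi_order \<alpha> \<le> m" for \<alpha>
    proof (rule weak_deriv_glue[where U = ?U and \<psi> = \<psi> and B = ?B and I = I and h = "\<lambda>\<nu>. h \<nu> \<alpha>"])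
      show "?U \<nu> \<subseteq> ?\<Omega>" if "\<nu> \<in> I" for \<nu> by (rule U\<Omega>[OF that])
      show "?\<Omega> \<subseteq> (\<Union>\<nu>\<in>I. ?B \<nu>)" using cover unfolding A_def .
    qed (use \<psi> \<psi>1 opU h \<alpha> in auto)
    have gw: "has_weak_deriv ?\<Omega> \<alpha> ?w (gw \<alpha>)" if "multi_order \<alpha> \<le> m" for \<alpha>
      using ex_w[OF that] has_weak_deriv_weak_deriv unfolding g_def by blast
    have piece: "energy m p (?B \<nu>) (edge_weighted l ?\<sigma> gw) \<le> ennreal C' * ?F' \<nu> gu * ?F' \<nu> gv"
      if \<nu>: "\<nu> \<in> I" for \<nu>
    proof -
      have "energy m p (?B \<nu>) (edge_weighted l ?\<sigma> gw) \<le> ennreal ((D2 * r \<nu> powr (- ?\<sigma>)) powr p)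
          * energy m p (?B \<nu>) (\<lambda>\<alpha> x. r \<nu> ^ multi_order \<alpha> *\<^sub>R gw \<alpha> x)"
      proof (rule energy_edge_weighted_le(2)[where u = ?w])
        show "edge_weight l x powr (real k - ?\<sigma>) \<le> D2 * r \<nu> powr (real k - ?\<sigma>)"
          if "k \<le> m" "x \<in> ?B \<nu>" for k x
        proof -
          have "x \<in> ?K \<nu>" using that(2) BU[of \<nu>] UK[of \<nu>] by (meson subsetD)
          from weight[OF \<nu> this[unfolded A_def]] show ?thesis
            by (intro D2[OF that(1) r]) auto
        qed
        show "?B \<nu> \<subseteq> ?\<Omega>" by (rule B\<Omega>[OF \<nu>])
      qed (use \<open>0 < p\<close> r \<open>D2 \<ge> 0\<close> sets gw in auto)
      also have "energy m p (?B \<nu>) (\<lambda>\<alpha> x. r \<nu> ^ multi_order \<alpha> *\<^sub>R gw \<alpha> x)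
          \<le> energy m p (?U \<nu>) (\<lambda>\<alpha> x. r \<nu> ^ multi_order \<alpha> *\<^sub>R gw \<alpha> x)"
        by (rule energy_mono_set[OF BU])
      \<comment> \<open>On the middle cube \<open>gw\<close> and \<open>h \<nu>\<close> are
        derivatives of the same function, hence equal almost everywhere, and the local estimate
        applies.\<close>
      also have "\<dots> = energy m p (?U \<nu>) (\<lambda>\<alpha> x. r \<nu> ^ multi_order \<alpha> *\<^sub>R h \<nu> \<alpha> x)"
      proof (rule energy_AE)
        fix \<alpha> :: "'n \<Rightarrow> nat" assume \<alpha>: "multi_order \<alpha> \<le> m"
        have "has_weak_deriv (?U \<nu>) \<alpha> ?w (gw \<alpha>)"
          by (rule has_weak_deriv_subset[OF gw[OF \<alpha>] U\<Omega>[OF \<nu>]]) simp_all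
        from weak_deriv_unique_AE[OF opU(1) this h[OF \<nu> \<alpha>]]
        show "AE x in lebesgue. x \<in> ?U \<nu> \<longrightarrow> r \<nu> ^ multi_order \<alpha> *\<^sub>R gw \<alpha> x = r \<nu> ^ multi_order \<alpha> *\<^sub>R h \<nu> \<alpha> x"
          by eventually_elim simp
      qed
      also have "\<dots> \<le> ennreal (C * inverse (r \<nu>) ^ ?d) * ?E \<nu> gu * ?E \<nu> gv"
        by (rule h_le[OF \<nu>])
      also have "\<dots> \<le> ennreal (C * inverse (r \<nu>) ^ ?d) * (ennreal ((D1 * r \<nu> powr a) powr p) * ?F' \<nu> gu)
          * (ennreal ((D1 * r \<nu> powr a) powr p) * ?F' \<nu> gv)"
        by (intro mult_mono E_le[OF \<nu> gu] E_le[OF \<nu> gv] order_refl) auto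
      finally have "energy m p (?B \<nu>) (edge_weighted l ?\<sigma> gw) \<le> ennreal ((D2 * r \<nu> powr (- ?\<sigma>)) powr p)
          * (ennreal (C * inverse (r \<nu>) ^ ?d) * (ennreal ((D1 * r \<nu> powr a) powr p) * ?F' \<nu> gu)
          * (ennreal ((D1 * r \<nu> powr a) powr p) * ?F' \<nu> gv))"
        by (simp add: mult_left_mono)
      also have "\<dots> = ennreal ((D2 * r \<nu> powr (- ?\<sigma>)) powr p * (C * inverse (r \<nu>) ^ ?d)
          * (D1 * r \<nu> powr a) powr p * (D1 * r \<nu> powr a) powr p) * ?F' \<nu> gu * ?F' \<nu> gv"
        using \<open>C \<ge> 0\<close> r[of \<nu>] by (simp only: ennreal_mult powr_ge_zero mult_nonneg_nonneg zero_le_power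
            inverse_nonnegative_iff_nonnegative less_imp_le ac_simps)
      also have "(D2 * r \<nu> powr (- ?\<sigma>)) powr p * (C * inverse (r \<nu>) ^ ?d)
          * (D1 * r \<nu> powr a) powr p * (D1 * r \<nu> powr a) powr p = C'"
        unfolding C'_def by (rule scaling_exponents_cancel[OF \<open>0 < p\<close> r \<open>D1 \<ge> 0\<close> \<open>D2 \<ge> 0\<close>])
      finally show ?thesis .
    qed
    have "energy m p ?\<Omega> (edge_weighted l ?\<sigma> gw)
        \<le> (\<integral>\<^sup>+\<nu>. energy m p (?B \<nu>) (edge_weighted l ?\<sigma> gw) \<partial>count_space I)"
    proof (rule energy_cover)
      show "?\<Omega> \<subseteq> (\<Union>\<nu>\<in>I. ?B \<nu>)" using cover unfolding A_def .
      show "?B \<nu> \<subseteq> ?\<Omega>" if "\<nu> \<in> I" for \<nu> by (rule B\<Omega>[OF that])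
    qed (use sets edge_weighted_measurable[where u = ?w and g = gw, OF gw] in auto)
    \<comment> \<open>Only the local energies of u have to be summed; those of v are replaced by the
      global one, uniformly in \<nu>.\<close>
    also have "\<dots> \<le> (\<integral>\<^sup>+\<nu>. (ennreal C' * ?F gv) * ?F' \<nu> gu \<partial>count_space I)"
    proof (rule nn_integral_mono)
      fix \<nu> assume "\<nu> \<in> space (count_space I)"
      then have \<nu>: "\<nu> \<in> I" by simp
      have "energy m p (?B \<nu>) (edge_weighted l ?\<sigma> gw) \<le> ennreal C' * ?F' \<nu> gu * ?F' \<nu> gv"
        by (rule piece[OF \<nu>])
      also have "\<dots> \<le> ennreal C' * ?F' \<nu> gu * ?F gv"
        by (intro mult_left_mono energy_mono_set K\<Omega>[OF \<nu>]) simp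
      finally show "energy m p (?B \<nu>) (edge_weighted l ?\<sigma> gw) \<le> (ennreal C' * ?F gv) * ?F' \<nu> gu"
        by (simp only: ac_simps)
    qed
    also have "\<dots> = (ennreal C' * ?F gv) * (\<integral>\<^sup>+\<nu>. ?F' \<nu> gu \<partial>count_space I)"
      by (rule nn_integral_cmult) simp
    also have "\<dots> \<le> (ennreal C' * ?F gv) * (ennreal (real M) * ?F gu)"
    proof (rule mult_left_mono[OF energy_overlap])
      show "finite {\<nu>\<in>I. x \<in> ?K \<nu>} \<and> card {\<nu>\<in>I. x \<in> ?K \<nu>} \<le> M" for x
        using overlap unfolding A_def by blast
    qed (use sets K\<Omega> edge_weighted_measurable[where u = u and g = gu, OF gu] in auto)
    also have "\<dots> = ennreal ((C' * real M) * kondratiev_norm m a p l u powr p * kondratiev_norm m a p l v powr p)"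
      using \<open>C' \<ge> 0\<close> by (simp add: Fu Fv ennreal_mult ac_simps)
    finally have le: "energy m p ?\<Omega> (edge_weighted l ?\<sigma> gw)
        \<le> ennreal ((C' * real M) * kondratiev_norm m a p l u powr p * kondratiev_norm m a p l v powr p)" .
    have w: "?w \<in> kondratiev_space m ?\<sigma> p l"
    proof (rule kondratiev_spaceI)
      show "?w \<in> borel_measurable (lebesgue_on ?\<Omega>)"
        using u v by (intro borel_measurable_times) (auto simp: kondratiev_space_def)
      show "energy m p ?\<Omega> (edge_weighted l ?\<sigma> (\<lambda>\<alpha>. weak_deriv ?\<Omega> \<alpha> ?w)) < \<infinity>"
        using le_less_trans[OF le] by (simp add: g_def)
    qed (rule ex_w)
    have "ennreal (kondratiev_norm m ?\<sigma> p l ?w powr p)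
        \<le> ennreal ((C' * real M) * kondratiev_norm m a p l u powr p * kondratiev_norm m a p l v powr p)"
      using le kondratiev_energy[OF w \<open>0 < p\<close>] by (simp add: g_def)
    then have "kondratiev_norm m ?\<sigma> p l ?w powr p
        \<le> (C' * real M) * kondratiev_norm m a p l u powr p * kondratiev_norm m a p l v powr p"
      using \<open>C' \<ge> 0\<close> by (subst (asm) ennreal_le_iff) auto
    with w show ?thesis by blast
  qed
  show ?thesis
    using \<open>C' \<ge> 0\<close> main by (intro exI[of _ "C' * real M"]) simp
qed

theorem theorem31:
  fixes p a :: real and m l :: nat
  assumes "1 \<le> p" and "1 \<le> m" and "l < CARD('n::{finite,linorder})"
    and "pointwise_algebra
           (sobolev_space m p :: ('n rvec \<Rightarrow> 'b::{real_normed_field,euclidean_space}) set)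
           (sobolev_norm m p)"
  shows "\<exists>c. \<forall>u\<in>kondratiev_space m a p l. \<forall>v\<in>kondratiev_space m a p l.
           (\<lambda>x::'n rvec. u x * v x :: 'b)
             \<in> kondratiev_space m (2 * a - real CARD('n) / p) p l \<and>
           kondratiev_norm m (2 * a - real CARD('n) / p) p l (\<lambda>x. u x * v x)
             \<le> c * kondratiev_norm m a p l u * kondratiev_norm m a p l v"
proof -
  have "0 < p" using assms(1) by simp
  obtain C where "C \<ge> 0" and C: "\<And>u v :: 'n rvec \<Rightarrow> 'b.
      u \<in> kondratiev_space m a p l \<Longrightarrow> v \<in> kondratiev_space m a p l \<Longrightarrow>
      (\<lambda>x. u x * v x) \<in> kondratiev_space m (2 * a - real CARD('n) / p) p l \<and>
      kondratiev_norm m (2 * a - real CARD('n) / p) p l (\<lambda>x. u x * v x) powr p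
        \<le> C * kondratiev_norm m a p l u powr p * kondratiev_norm m a p l v powr p"
    using kondratiev_product[OF \<open>0 < p\<close> assms(4), of a l] by blast
  \<comment> \<open>Passage from p-th powers to norms; nonnegativity of all quantities makes the
    root monotone and multiplicative.\<close>
  have root: "x \<le> C powr (1 / p) * y * z"
    if "x powr p \<le> C * y powr p * z powr p" "0 \<le> x" "0 \<le> y" "0 \<le> z" for x y z
  proof -
    have "(x powr p) powr (1 / p) \<le> (C * y powr p * z powr p) powr (1 / p)"
      using that \<open>0 < p\<close> by (intro powr_mono2) auto
    then show ?thesis
      using that \<open>0 < p\<close> \<open>C \<ge> 0\<close> by (simp add: powr_mult powr_powr)
  qed
  have nonneg: "0 \<le> kondratiev_norm m a p l u" for a and u :: "'n rvec \<Rightarrow> 'b"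
    by (simp add: kondratiev_norm_def)
  show ?thesis
    using C root nonneg by (intro exI[of _ "C powr (1 / p)"]) blast
qed

end
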